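(* Let $(R,\mathfrak m)$ be a Noetherian local ring, $I$ an integrally closed ideal of $R$ having height greater than zero, and $M$ a finitely generated $R$-module. Let $(\mathbb F_*,\varphi_i)$, with $\varphi_i:F_i\to F_{i-1}$, be a minimal free resolution of $M$. For $t\geq 1$, set $J_t:=\operatorname{Ann}(\operatorname{Tor}_t^R(R/I,M))$. If $\operatorname{image}(\varphi_t)$ is contained in $\overline{\mathfrak m J_t}\,F_{t-1}$, then $$\operatorname{image}(\varphi_t\otimes_R 1_{R/I})\cap\operatorname{socle}(F_{t-1}/IF_{t-1})=0.$$
   Context: For an ideal $K$, $\overline{K}$ denotes its integral closure; $K$ is integrally closed if $K=\overline{K}$. The socle of an $R$-module $N$ is $\{u\in N:\mathfrak m u=0\}$. *)

theory Defs
  imports "HOL-Algebra.Module" "HOL-Algebra.Ideal_Product" "HOL-Algebra.Ring_Divisibility"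
    "HOL-Library.Extended_Nat"
begin

section \<open>Ideals\<close>

definition local_ring :: "('a, 'r) ring_scheme \<Rightarrow> 'a set \<Rightarrow> bool" where
  "local_ring R \<mm> \<longleftrightarrow> cring R \<and> {J. maximalideal J R} = {\<mm>}"

text \<open>The \<open>i\<close>-th power of the ideal \<open>I\<close> is its power in the multiplicative monoid
  \<^term>\<open>ideals_set R\<close> of ideals of \<open>R\<close>; in particular the zeroth power is \<^term>\<open>carrier R\<close>.\<close>

definition integral_closure :: "('a, 'r) ring_scheme \<Rightarrow> 'a set \<Rightarrow> 'a set" where
  "integral_closure R I = {x \<in> carrier R. \<exists>n\<ge>1. \<exists>a.
     (\<forall>i\<in>{1..n}. a i \<in> I [^]\<^bsub>ideals_set R\<^esub> (i::nat)) \<and>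
     x [^]\<^bsub>R\<^esub> n \<oplus>\<^bsub>R\<^esub> (\<Oplus>\<^bsub>R\<^esub>i\<in>{1..n}. a i \<otimes>\<^bsub>R\<^esub> x [^]\<^bsub>R\<^esub> (n - i)) = \<zero>\<^bsub>R\<^esub>}"

definition prime_height :: "('a, 'r) ring_scheme \<Rightarrow> 'a set \<Rightarrow> enat" where
  "prime_height R P = (SUP n \<in> {n. \<exists>c :: nat \<Rightarrow> 'a set. (\<forall>i\<le>n. primeideal (c i) R) \<and>
     (\<forall>i<n. c i \<subset> c (Suc i)) \<and> c n = P}. enat n)"

text \<open>The unit ideal lies in no prime ideal, so its height is the empty infimum \<open>\<infinity>\<close>.\<close>

definition ideal_height :: "('a, 'r) ring_scheme \<Rightarrow> 'a set \<Rightarrow> enat" where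
  "ideal_height R I = (INF P \<in> {P. primeideal P R \<and> I \<subseteq> P}. prime_height R P)"


section \<open>Modules\<close>

text \<open>In a module record the ring fields \<^const>\<open>monoid.mult\<close> and \<^const>\<open>monoid.one\<close> carry no meaning;
  in the modules constructed below they are left undefined.\<close>

definition mod_span :: "('a, 'r) ring_scheme \<Rightarrow> ('a, 'b, 'm) module_scheme \<Rightarrow> 'b set \<Rightarrow> 'b set" where
  "mod_span R M S = \<Inter>{H. submodule H R M \<and> S \<subseteq> H}"

definition fin_gen_module :: "('a, 'r) ring_scheme \<Rightarrow> ('a, 'b, 'm) module_scheme \<Rightarrow> bool" where
  "fin_gen_module R M \<longleftrightarrow> module R M \<and>
     (\<exists>S. finite S \<and> S \<subseteq> carrier M \<and> mod_span R M S = carrier M)"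

definition fin_free_module :: "('a, 'r) ring_scheme \<Rightarrow> ('a, 'b, 'm) module_scheme \<Rightarrow> bool" where
  "fin_free_module R M \<longleftrightarrow> module R M \<and>
     (\<exists>B. finite B \<and> B \<subseteq> carrier M \<and>
        (\<forall>x \<in> carrier M. \<exists>!c. c \<in> B \<rightarrow>\<^sub>E carrier R \<and> x = (\<Oplus>\<^bsub>M\<^esub>b\<in>B. c b \<odot>\<^bsub>M\<^esub> b)))"

definition ideal_smult ::
  "('a, 'r) ring_scheme \<Rightarrow> 'a set \<Rightarrow> ('a, 'b, 'm) module_scheme \<Rightarrow> 'b set" where
  "ideal_smult R K M = mod_span R M {a \<odot>\<^bsub>M\<^esub> x |a x. a \<in> K \<and> x \<in> carrier M}"

definition annihilator :: "('a, 'r) ring_scheme \<Rightarrow> ('a, 'b, 'm) module_scheme \<Rightarrow> 'a set" where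
  "annihilator R M = {a \<in> carrier R. \<forall>x \<in> carrier M. a \<odot>\<^bsub>M\<^esub> x = \<zero>\<^bsub>M\<^esub>}"

definition socle :: "'a set \<Rightarrow> ('a, 'b, 'm) module_scheme \<Rightarrow> 'b set" where
  "socle \<mm> M = {x \<in> carrier M. \<forall>a \<in> \<mm>. a \<odot>\<^bsub>M\<^esub> x = \<zero>\<^bsub>M\<^esub>}"

definition mod_hom ::
  "('a, 'r) ring_scheme \<Rightarrow> ('a, 'b, 'm) module_scheme \<Rightarrow> ('a, 'c, 'n) module_scheme \<Rightarrow> ('b \<Rightarrow> 'c) set" where
  "mod_hom R M N = {f \<in> carrier M \<rightarrow> carrier N.
     (\<forall>x\<in>carrier M. \<forall>y\<in>carrier M. f (x \<oplus>\<^bsub>M\<^esub> y) = f x \<oplus>\<^bsub>N\<^esub> f y) \<and>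
     (\<forall>a\<in>carrier R. \<forall>x\<in>carrier M. f (a \<odot>\<^bsub>M\<^esub> x) = a \<odot>\<^bsub>N\<^esub> f x)}"

definition regular_module :: "('a, 'r) ring_scheme \<Rightarrow> ('a, 'a) module" where
  "regular_module R = \<lparr>carrier = carrier R, monoid.mult = undefined, one = undefined,
     zero = \<zero>\<^bsub>R\<^esub>, add = add R, smult = (\<otimes>\<^bsub>R\<^esub>)\<rparr>"

text \<open>As for \<^const>\<open>rcoset_mult\<close>, the scalar multiple of a coset is the union of the (equal)
  cosets obtained from its representatives.\<close>

definition quot_mod :: "('a, 'b, 'm) module_scheme \<Rightarrow> 'b set \<Rightarrow> ('a, 'b set) module" where
  "quot_mod M N = \<lparr>carrier = a_rcosets\<^bsub>M\<^esub> N, monoid.mult = undefined, one = undefined,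
     zero = N, add = set_add M, smult = (\<lambda>a X. \<Union>x\<in>X. N +>\<^bsub>M\<^esub> (a \<odot>\<^bsub>M\<^esub> x))\<rparr>"

abbreviation quot_ring_mod :: "('a, 'r) ring_scheme \<Rightarrow> 'a set \<Rightarrow> ('a, 'a set) module" where
  "quot_ring_mod R I \<equiv> quot_mod (regular_module R) I"


section \<open>Tensor products\<close>

text \<open>The free module on a set \<open>X\<close>: finitely supported functions \<open>X \<rightarrow> R\<close>, extended by zero.\<close>

definition free_mod :: "('a, 'r) ring_scheme \<Rightarrow> 'x set \<Rightarrow> ('a, 'x \<Rightarrow> 'a) module" where
  "free_mod R X = \<lparr>carrier = {f. (\<forall>x. f x \<in> carrier R) \<and> finite {x. f x \<noteq> \<zero>\<^bsub>R\<^esub>} \<and> {x. f x \<noteq> \<zero>\<^bsub>R\<^esub>} \<subseteq> X},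
     monoid.mult = undefined, one = undefined, zero = (\<lambda>_. \<zero>\<^bsub>R\<^esub>),
     add = (\<lambda>f g x. f x \<oplus>\<^bsub>R\<^esub> g x), smult = (\<lambda>a f x. a \<otimes>\<^bsub>R\<^esub> f x)\<rparr>"

definition free_gen :: "('a, 'r) ring_scheme \<Rightarrow> 'x \<Rightarrow> 'x \<Rightarrow> 'a" where
  "free_gen R x = (\<lambda>y. if y = x then \<one>\<^bsub>R\<^esub> else \<zero>\<^bsub>R\<^esub>)"

definition tensor_rel ::
  "('a, 'r) ring_scheme \<Rightarrow> ('a, 'b, 'm) module_scheme \<Rightarrow> ('a, 'c, 'n) module_scheme \<Rightarrow> ('b \<times> 'c \<Rightarrow> 'a) set" where
  "tensor_rel R M N =
    (let L = free_mod R (carrier M \<times> carrier N); e = (\<lambda>x y. free_gen R (x, y)) in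
     mod_span R L
      ({e (x \<oplus>\<^bsub>M\<^esub> x') y \<ominus>\<^bsub>L\<^esub> (e x y \<oplus>\<^bsub>L\<^esub> e x' y) |x x' y. x \<in> carrier M \<and> x' \<in> carrier M \<and> y \<in> carrier N} \<union>
       {e x (y \<oplus>\<^bsub>N\<^esub> y') \<ominus>\<^bsub>L\<^esub> (e x y \<oplus>\<^bsub>L\<^esub> e x y') |x y y'. x \<in> carrier M \<and> y \<in> carrier N \<and> y' \<in> carrier N} \<union>
       {e (a \<odot>\<^bsub>M\<^esub> x) y \<ominus>\<^bsub>L\<^esub> a \<odot>\<^bsub>L\<^esub> e x y |a x y. a \<in> carrier R \<and> x \<in> carrier M \<and> y \<in> carrier N} \<union>
       {e x (a \<odot>\<^bsub>N\<^esub> y) \<ominus>\<^bsub>L\<^esub> a \<odot>\<^bsub>L\<^esub> e x y |a x y. a \<in> carrier R \<and> x \<in> carrier M \<and> y \<in> carrier N}))"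

definition tensor ::
  "('a, 'r) ring_scheme \<Rightarrow> ('a, 'b, 'm) module_scheme \<Rightarrow> ('a, 'c, 'n) module_scheme \<Rightarrow>
   ('a, ('b \<times> 'c \<Rightarrow> 'a) set) module" where
  "tensor R M N = quot_mod (free_mod R (carrier M \<times> carrier N)) (tensor_rel R M N)"

definition pure_tensor ::
  "('a, 'r) ring_scheme \<Rightarrow> ('a, 'b, 'm) module_scheme \<Rightarrow> ('a, 'c, 'n) module_scheme \<Rightarrow>
   'b \<Rightarrow> 'c \<Rightarrow> ('b \<times> 'c \<Rightarrow> 'a) set" where
  "pure_tensor R M N x y =
     tensor_rel R M N +>\<^bsub>free_mod R (carrier M \<times> carrier N)\<^esub> free_gen R (x, y)"

text \<open>\<open>f \<otimes> g : M \<otimes> N \<rightarrow> M' \<otimes> N'\<close> is the unique linear map with \<open>x \<otimes> y \<mapsto> f x \<otimes> g y\<close>;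
  existence and uniqueness are proved in \<open>tensor_map_unique\<close> below.\<close>

definition tensor_map ::
  "('a, 'r) ring_scheme \<Rightarrow> ('a, 'b, 'm) module_scheme \<Rightarrow> ('a, 'c, 'n) module_scheme \<Rightarrow>
   ('a, 'd, 'p) module_scheme \<Rightarrow> ('a, 'e, 'q) module_scheme \<Rightarrow> ('b \<Rightarrow> 'd) \<Rightarrow> ('c \<Rightarrow> 'e) \<Rightarrow>
   ('b \<times> 'c \<Rightarrow> 'a) set \<Rightarrow> ('d \<times> 'e \<Rightarrow> 'a) set" where
  "tensor_map R M N M' N' f g =
     (THE h. h \<in> mod_hom R (tensor R M N) (tensor R M' N') \<and>
        h \<in> extensional (carrier (tensor R M N)) \<and>
        (\<forall>x \<in> carrier M. \<forall>y \<in> carrier N.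
           h (pure_tensor R M N x y) = pure_tensor R M' N' (f x) (g y)))"

text \<open>The canonical isomorphism \<open>M/IM \<rightarrow> M \<otimes> R/I\<close>, sending the class of \<open>x\<close> to \<open>x \<otimes> 1\<close>;
  the union runs over equal cosets.  See \<open>quot_to_tensor_iso\<close> below.\<close>

definition quot_to_tensor ::
  "('a, 'r) ring_scheme \<Rightarrow> ('a, 'b, 'm) module_scheme \<Rightarrow> 'a set \<Rightarrow> 'b set \<Rightarrow> ('b \<times> 'a set \<Rightarrow> 'a) set" where
  "quot_to_tensor R M I X = (\<Union>x\<in>X. pure_tensor R M (quot_ring_mod R I) x (I +>\<^bsub>R\<^esub> \<one>\<^bsub>R\<^esub>))"


section \<open>Free resolutions and Tor\<close>

text \<open>The map \<open>\<phi> i : F i \<rightarrow> F (i - 1)\<close> is meaningful for \<open>i \<ge> 1\<close> only;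
  \<open>\<epsilon> : F 0 \<rightarrow> M\<close> is the augmentation.\<close>

definition free_resolution ::
  "('a, 'r) ring_scheme \<Rightarrow> ('a, 'b, 'm) module_scheme \<Rightarrow> (nat \<Rightarrow> ('a, 'c, 'n) module_scheme) \<Rightarrow>
   (nat \<Rightarrow> 'c \<Rightarrow> 'c) \<Rightarrow> ('c \<Rightarrow> 'b) \<Rightarrow> bool" where
  "free_resolution R M F \<phi> \<epsilon> \<longleftrightarrow>
     (\<forall>i. fin_free_module R (F i)) \<and>
     (\<forall>i\<ge>1. \<phi> i \<in> mod_hom R (F i) (F (i - 1))) \<and>
     \<epsilon> \<in> mod_hom R (F 0) M \<and>
     \<epsilon> ` carrier (F 0) = carrier M \<and>
     \<phi> 1 ` carrier (F 1) = a_kernel (F 0) M \<epsilon> \<and>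
     (\<forall>i\<ge>1. \<phi> (Suc i) ` carrier (F (Suc i)) = a_kernel (F i) (F (i - 1)) (\<phi> i))"

definition minimal_free_resolution ::
  "('a, 'r) ring_scheme \<Rightarrow> 'a set \<Rightarrow> ('a, 'b, 'm) module_scheme \<Rightarrow> (nat \<Rightarrow> ('a, 'c, 'n) module_scheme) \<Rightarrow>
   (nat \<Rightarrow> 'c \<Rightarrow> 'c) \<Rightarrow> ('c \<Rightarrow> 'b) \<Rightarrow> bool" where
  "minimal_free_resolution R \<mm> M F \<phi> \<epsilon> \<longleftrightarrow> free_resolution R M F \<phi> \<epsilon> \<and>
     (\<forall>i\<ge>1. \<phi> i ` carrier (F i) \<subseteq> ideal_smult R \<mm> (F (i - 1)))"

text \<open>For a free resolution \<open>(F, \<phi>)\<close> of \<open>M\<close>, \<open>Tor\<^sub>t(N, M)\<close> is the homology of the complex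
  \<open>F \<otimes> N\<close> in degree \<open>t\<close>, as an \<open>R\<close>-module.  Up to isomorphism it does not depend on the
  resolution.\<close>

definition tor ::
  "('a, 'r) ring_scheme \<Rightarrow> (nat \<Rightarrow> ('a, 'c, 'n) module_scheme) \<Rightarrow> (nat \<Rightarrow> 'c \<Rightarrow> 'c) \<Rightarrow>
   ('a, 'b, 'm) module_scheme \<Rightarrow> nat \<Rightarrow> ('a, ('c \<times> 'b \<Rightarrow> 'a) set set) module" where
  "tor R F \<phi> N t =
    (let T = (\<lambda>i. tensor R (F i) N);
         d = (\<lambda>i. tensor_map R (F i) N (F (i - 1)) N (\<phi> i) (\<lambda>y. y));
         Z = (if t = 0 then carrier (T 0) else a_kernel (T t) (T (t - 1)) (d t))
     in quot_mod (T t\<lparr>carrier := Z\<rparr>) (d (Suc t) ` carrier (T (Suc t))))"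


section \<open>Well-definedness\<close>

lemma mod_span_submodule:
  assumes "module R M" "S \<subseteq> carrier M"
  shows "submodule (mod_span R M S) R M"
proof -
  interpret module R M by fact
  have c: "carrier M \<in> {H. submodule H R M \<and> S \<subseteq> H}"
    using carrier_is_submodule assms by simp
  show ?thesis
    unfolding mod_span_def
  proof (rule submoduleI)
    show "\<Inter> {H. submodule H R M \<and> S \<subseteq> H} \<subseteq> carrier M" using c by (rule Inter_lower)
    show "\<zero>\<^bsub>M\<^esub> \<in> \<Inter> {H. submodule H R M \<and> S \<subseteq> H}"
      by (auto simp: submodule_def subgroup_def)
  next
    fix a assume "a \<in> \<Inter> {H. submodule H R M \<and> S \<subseteq> H}"
    thus "\<ominus>\<^bsub>M\<^esub> a \<in> \<Inter> {H. submodule H R M \<and> S \<subseteq> H}" by (simp add: submoduleE(3))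
  next
    fix a b assume "a \<in> \<Inter> {H. submodule H R M \<and> S \<subseteq> H}" "b \<in> \<Inter> {H. submodule H R M \<and> S \<subseteq> H}"
    thus "a \<oplus>\<^bsub>M\<^esub> b \<in> \<Inter> {H. submodule H R M \<and> S \<subseteq> H}" by (simp add: submoduleE(5))
  next
    fix a x assume "a \<in> carrier R" "x \<in> \<Inter> {H. submodule H R M \<and> S \<subseteq> H}"
    thus "a \<odot>\<^bsub>M\<^esub> x \<in> \<Inter> {H. submodule H R M \<and> S \<subseteq> H}" by (simp add: submoduleE(4))
  qed
qed

lemma mod_span_superset: "S \<subseteq> mod_span R M S"
  by (auto simp: mod_span_def)

lemma mod_span_least: "submodule H R M \<Longrightarrow> S \<subseteq> H \<Longrightarrow> mod_span R M S \<subseteq> H"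
  by (auto simp: mod_span_def)

lemma mod_homD:
  assumes "f \<in> mod_hom R M N"
  shows "x \<in> carrier M \<Longrightarrow> f x \<in> carrier N"
    and "x \<in> carrier M \<Longrightarrow> y \<in> carrier M \<Longrightarrow> f (x \<oplus>\<^bsub>M\<^esub> y) = f x \<oplus>\<^bsub>N\<^esub> f y"
    and "a \<in> carrier R \<Longrightarrow> x \<in> carrier M \<Longrightarrow> f (a \<odot>\<^bsub>M\<^esub> x) = a \<odot>\<^bsub>N\<^esub> f x"
  using assms by (auto simp: mod_hom_def)

lemma mod_hom_zero:
  assumes "module R M" "module R N" "f \<in> mod_hom R M N"
  shows "f \<zero>\<^bsub>M\<^esub> = \<zero>\<^bsub>N\<^esub>"
proof -
  interpret M: module R M by fact
  interpret N: module R N by fact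
  have "f \<zero>\<^bsub>M\<^esub> \<oplus>\<^bsub>N\<^esub> f \<zero>\<^bsub>M\<^esub> = f \<zero>\<^bsub>M\<^esub>"
    by (metis M.zero_closed M.r_zero mod_homD(2)[OF assms(3)])
  thus ?thesis using mod_homD(1)[OF assms(3), of "\<zero>\<^bsub>M\<^esub>"]
    by (metis M.zero_closed N.add.l_cancel_one')
qed

lemma mod_hom_minus:
  assumes "module R M" "module R N" "f \<in> mod_hom R M N" "x \<in> carrier M"
  shows "f (\<ominus>\<^bsub>M\<^esub> x) = \<ominus>\<^bsub>N\<^esub> f x"
proof -
  interpret M: module R M by fact
  interpret N: module R N by fact
  have "f (\<ominus>\<^bsub>M\<^esub> x) \<oplus>\<^bsub>N\<^esub> f x = \<zero>\<^bsub>N\<^esub>"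
    using assms(4) mod_hom_zero[OF assms(1-3)] mod_homD(2)[OF assms(3), of "\<ominus>\<^bsub>M\<^esub> x" x]
    by (simp add: M.l_neg)
  thus ?thesis using mod_homD(1)[OF assms(3)] assms(4)
    by (simp add: N.minus_equality)
qed

lemma quot_mod_simps [simp]:
  "carrier (quot_mod M N) = a_rcosets\<^bsub>M\<^esub> N"
  "\<zero>\<^bsub>quot_mod M N\<^esub> = N"
  "X \<oplus>\<^bsub>quot_mod M N\<^esub> Y = X <+>\<^bsub>M\<^esub> Y"
  "a \<odot>\<^bsub>quot_mod M N\<^esub> X = (\<Union>x\<in>X. N +>\<^bsub>M\<^esub> (a \<odot>\<^bsub>M\<^esub> x))"
  by (simp_all add: quot_mod_def)

lemma submodule_abelian_subgroup:
  assumes "module R M" "submodule N R M"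
  shows "abelian_subgroup N M"
proof -
  interpret M: module R M by fact
  show ?thesis
    using assms(2) M.abelian_group_axioms
    by (intro abelian_subgroupI3) (simp_all add: additive_subgroup_def submodule_def)
qed

lemma coset_eq_iff:
  assumes "module R M" "submodule N R M" "x \<in> carrier M" "y \<in> carrier M"
  shows "N +>\<^bsub>M\<^esub> x = N +>\<^bsub>M\<^esub> y \<longleftrightarrow> x \<ominus>\<^bsub>M\<^esub> y \<in> N"
proof -
  interpret M: module R M by fact
  interpret N: abelian_subgroup N M by (rule submodule_abelian_subgroup) fact+
  show ?thesis
    using N.a_rcos_module[of y x] N.a_rcos_self[of x] N.a_repr_independence'[of x y] assms
    by (auto simp: a_minus_def)
qed

lemma coset_smult:
  assumes "module R M" "submodule N R M" "a \<in> carrier R" "x \<in> carrier M"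
  shows "(\<Union>y\<in>N +>\<^bsub>M\<^esub> x. N +>\<^bsub>M\<^esub> (a \<odot>\<^bsub>M\<^esub> y)) = N +>\<^bsub>M\<^esub> (a \<odot>\<^bsub>M\<^esub> x)"
proof -
  interpret M: module R M by fact
  interpret N: abelian_subgroup N M by (rule submodule_abelian_subgroup) fact+
  have "N +>\<^bsub>M\<^esub> (a \<odot>\<^bsub>M\<^esub> y) = N +>\<^bsub>M\<^esub> (a \<odot>\<^bsub>M\<^esub> x)" if y: "y \<in> N +>\<^bsub>M\<^esub> x" for y
  proof -
    have yc: "y \<in> carrier M" using y assms(4) N.a_elemrcos_carrier by blast
    have "y \<ominus>\<^bsub>M\<^esub> x \<in> N" using y yc assms(4) N.a_rcos_module by (auto simp: a_minus_def)
    hence "a \<odot>\<^bsub>M\<^esub> (y \<ominus>\<^bsub>M\<^esub> x) \<in> N" using M.submoduleE(4)[OF assms(2)] assms(3) by blast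
    moreover have "a \<odot>\<^bsub>M\<^esub> (y \<ominus>\<^bsub>M\<^esub> x) = a \<odot>\<^bsub>M\<^esub> y \<ominus>\<^bsub>M\<^esub> a \<odot>\<^bsub>M\<^esub> x"
      using assms(3,4) yc by (simp add: a_minus_def M.smult_r_distr M.smult_r_minus)
    ultimately show ?thesis using assms yc by (subst coset_eq_iff) auto
  qed
  moreover have "x \<in> N +>\<^bsub>M\<^esub> x" using assms(4) N.a_rcos_self by blast
  ultimately show ?thesis by blast
qed

lemma quot_mod_module:
  assumes "module R M" "submodule N R M"
  shows "module R (quot_mod M N)"
    and "(\<lambda>x. N +>\<^bsub>M\<^esub> x) \<in> mod_hom R M (quot_mod M N)"
proof -
  interpret M: module R M by fact
  interpret N: abelian_subgroup N M by (rule submodule_abelian_subgroup) fact+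
  let ?Q = "quot_mod M N"
  have rep: "\<exists>x\<in>carrier M. K = N +>\<^bsub>M\<^esub> x" if "K \<in> carrier ?Q" for K
    using that by (auto simp: A_RCOSETS_def')
  have cl: "N +>\<^bsub>M\<^esub> x \<in> carrier ?Q" if "x \<in> carrier M" for x
    using that by (auto simp: A_RCOSETS_def')
  have add: "(N +>\<^bsub>M\<^esub> x) \<oplus>\<^bsub>?Q\<^esub> (N +>\<^bsub>M\<^esub> y) = N +>\<^bsub>M\<^esub> (x \<oplus>\<^bsub>M\<^esub> y)"
    if "x \<in> carrier M" "y \<in> carrier M" for x y
    using that by (simp add: N.a_rcos_sum)
  have sm: "a \<odot>\<^bsub>?Q\<^esub> (N +>\<^bsub>M\<^esub> x) = N +>\<^bsub>M\<^esub> (a \<odot>\<^bsub>M\<^esub> x)" if "a \<in> carrier R" "x \<in> carrier M" for a x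
    using that assms by (simp add: coset_smult)
  have zero: "\<zero>\<^bsub>?Q\<^esub> = N +>\<^bsub>M\<^esub> \<zero>\<^bsub>M\<^esub>" by (simp add: N.a_rcos_const)
  show "(\<lambda>x. N +>\<^bsub>M\<^esub> x) \<in> mod_hom R M (quot_mod M N)"
    using cl add sm by (simp add: mod_hom_def Pi_def)
  show "module R ?Q"
  proof (rule moduleI)
    show "cring R" by (rule M.R.is_cring)
    show "abelian_group ?Q"
    proof (rule abelian_groupI)
      fix x y assume "x \<in> carrier ?Q" "y \<in> carrier ?Q"
      then obtain x' y' where "x' \<in> carrier M" "y' \<in> carrier M" "x = N +>\<^bsub>M\<^esub> x'" "y = N +>\<^bsub>M\<^esub> y'"
        using rep by blast
      thus "x \<oplus>\<^bsub>?Q\<^esub> y \<in> carrier ?Q" "x \<oplus>\<^bsub>?Q\<^esub> y = y \<oplus>\<^bsub>?Q\<^esub> x"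
        using cl[of "x' \<oplus>\<^bsub>M\<^esub> y'"] by (simp_all only: add M.M.add.m_comm M.add.m_closed)
    next
      show "\<zero>\<^bsub>?Q\<^esub> \<in> carrier ?Q" unfolding zero by (rule cl) simp
    next
      fix x y z assume "x \<in> carrier ?Q" "y \<in> carrier ?Q" "z \<in> carrier ?Q"
      then obtain x' y' z' where "x' \<in> carrier M" "y' \<in> carrier M" "z' \<in> carrier M"
        "x = N +>\<^bsub>M\<^esub> x'" "y = N +>\<^bsub>M\<^esub> y'" "z = N +>\<^bsub>M\<^esub> z'" using rep by metis
      thus "x \<oplus>\<^bsub>?Q\<^esub> y \<oplus>\<^bsub>?Q\<^esub> z = x \<oplus>\<^bsub>?Q\<^esub> (y \<oplus>\<^bsub>?Q\<^esub> z)"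
        by (simp only: add M.M.add.m_closed M.M.add.m_assoc)
    next
      fix x assume "x \<in> carrier ?Q"
      then obtain x' where x': "x' \<in> carrier M" "x = N +>\<^bsub>M\<^esub> x'" using rep by blast
      show "\<zero>\<^bsub>?Q\<^esub> \<oplus>\<^bsub>?Q\<^esub> x = x"
        unfolding zero x'(2) using x'(1) by (simp only: add M.M.zero_closed M.M.l_zero)
      have "(N +>\<^bsub>M\<^esub> (\<ominus>\<^bsub>M\<^esub> x')) \<oplus>\<^bsub>?Q\<^esub> x = \<zero>\<^bsub>?Q\<^esub>"
        unfolding zero x'(2) using x'(1) by (simp only: add M.M.a_inv_closed M.M.l_neg)
      thus "\<exists>y\<in>carrier ?Q. y \<oplus>\<^bsub>?Q\<^esub> x = \<zero>\<^bsub>?Q\<^esub>"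
        using cl[of "\<ominus>\<^bsub>M\<^esub> x'"] x'(1) by blast
    qed
  next
    fix a x assume a: "a \<in> carrier R" and "x \<in> carrier ?Q"
    then obtain x' where "x' \<in> carrier M" "x = N +>\<^bsub>M\<^esub> x'" using rep by blast
    thus "a \<odot>\<^bsub>?Q\<^esub> x \<in> carrier ?Q" using a cl by (simp only: sm M.smult_closed)
  next
    fix a b x assume a: "a \<in> carrier R" "b \<in> carrier R" and "x \<in> carrier ?Q"
    then obtain x' where "x' \<in> carrier M" "x = N +>\<^bsub>M\<^esub> x'" using rep by blast
    thus "(a \<oplus>\<^bsub>R\<^esub> b) \<odot>\<^bsub>?Q\<^esub> x = a \<odot>\<^bsub>?Q\<^esub> x \<oplus>\<^bsub>?Q\<^esub> b \<odot>\<^bsub>?Q\<^esub> x"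
      "(a \<otimes>\<^bsub>R\<^esub> b) \<odot>\<^bsub>?Q\<^esub> x = a \<odot>\<^bsub>?Q\<^esub> (b \<odot>\<^bsub>?Q\<^esub> x)"
      using a by (simp_all only: add sm M.R.add.m_closed M.R.m_closed M.smult_closed M.smult_l_distr M.smult_assoc1)
  next
    fix a x y assume a: "a \<in> carrier R" and "x \<in> carrier ?Q" "y \<in> carrier ?Q"
    then obtain x' y' where "x' \<in> carrier M" "y' \<in> carrier M" "x = N +>\<^bsub>M\<^esub> x'" "y = N +>\<^bsub>M\<^esub> y'"
      using rep by blast
    thus "a \<odot>\<^bsub>?Q\<^esub> (x \<oplus>\<^bsub>?Q\<^esub> y) = a \<odot>\<^bsub>?Q\<^esub> x \<oplus>\<^bsub>?Q\<^esub> a \<odot>\<^bsub>?Q\<^esub> y"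
      using a by (simp only: add sm M.M.add.m_closed M.smult_closed M.smult_r_distr)
  next
    fix x assume "x \<in> carrier ?Q"
    then obtain x' where "x' \<in> carrier M" "x = N +>\<^bsub>M\<^esub> x'" using rep by blast
    thus "\<one>\<^bsub>R\<^esub> \<odot>\<^bsub>?Q\<^esub> x = x" by (simp only: sm M.R.one_closed M.smult_one)
  qed
qed

lemma quot_mod_induced:
  assumes "module R M" "submodule N R M" "module R P" "f \<in> mod_hom R M P"
    and "\<And>x. x \<in> N \<Longrightarrow> f x = \<zero>\<^bsub>P\<^esub>"
  shows "\<exists>h\<in>mod_hom R (quot_mod M N) P. \<forall>x\<in>carrier M. h (N +>\<^bsub>M\<^esub> x) = f x"
proof -
  interpret M: module R M by fact
  interpret P: module R P by fact
  interpret N: abelian_subgroup N M by (rule submodule_abelian_subgroup) fact+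
  let ?Q = "quot_mod M N"
  note q = mod_homD[OF quot_mod_module(2)[OF assms(1,2)]]
  define h where "h K = f (SOME x. x \<in> K)" for K
  have h: "h (N +>\<^bsub>M\<^esub> x) = f x" if x: "x \<in> carrier M" for x
  proof -
    let ?y = "SOME y. y \<in> N +>\<^bsub>M\<^esub> x"
    have y: "?y \<in> N +>\<^bsub>M\<^esub> x" using N.a_rcos_self[OF x] by (rule someI)
    have yc: "?y \<in> carrier M" using y x N.a_elemrcos_carrier by blast
    have "?y \<oplus>\<^bsub>M\<^esub> \<ominus>\<^bsub>M\<^esub> x \<in> N" using y yc x N.a_rcos_module by blast
    hence "f ?y \<oplus>\<^bsub>P\<^esub> \<ominus>\<^bsub>P\<^esub> f x = \<zero>\<^bsub>P\<^esub>"
      using assms(5) mod_homD(2)[OF assms(4) yc, of "\<ominus>\<^bsub>M\<^esub> x"] mod_hom_minus[OF assms(1,3,4) x] x by simp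
    hence "f ?y = f x" using mod_homD(1)[OF assms(4)] yc x
      by (metis P.M.a_inv_closed P.M.minus_equality P.M.minus_minus P.M.add.inv_unique')
    thus ?thesis by (simp add: h_def)
  qed
  have rep: "\<exists>x\<in>carrier M. K = N +>\<^bsub>M\<^esub> x" if "K \<in> carrier ?Q" for K
    using that by (auto simp: A_RCOSETS_def')
  have "h \<in> mod_hom R ?Q P"
    unfolding mod_hom_def
  proof (intro CollectI conjI ballI Pi_I)
    fix K assume "K \<in> carrier ?Q"
    thus "h K \<in> carrier P" using rep h mod_homD(1)[OF assms(4)] by fastforce
  next
    fix K L assume "K \<in> carrier ?Q" "L \<in> carrier ?Q"
    then obtain x y where "x \<in> carrier M" "y \<in> carrier M" "K = N +>\<^bsub>M\<^esub> x" "L = N +>\<^bsub>M\<^esub> y"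
      using rep by blast
    thus "h (K \<oplus>\<^bsub>?Q\<^esub> L) = h K \<oplus>\<^bsub>P\<^esub> h L"
      by (simp only: q(2)[symmetric] h M.M.add.m_closed mod_homD(2)[OF assms(4)])
  next
    fix a K assume "a \<in> carrier R" "K \<in> carrier ?Q"
    then obtain x where "a \<in> carrier R" "x \<in> carrier M" "K = N +>\<^bsub>M\<^esub> x" using rep by blast
    thus "h (a \<odot>\<^bsub>?Q\<^esub> K) = a \<odot>\<^bsub>P\<^esub> h K"
      by (simp only: q(3)[symmetric] h M.smult_closed mod_homD(3)[OF assms(4)])
  qed
  thus ?thesis using h by blast
qed

lemma free_mod_simps [simp]:
  "carrier (free_mod R X) =
     {f. (\<forall>x. f x \<in> carrier R) \<and> finite {x. f x \<noteq> \<zero>\<^bsub>R\<^esub>} \<and> {x. f x \<noteq> \<zero>\<^bsub>R\<^esub>} \<subseteq> X}"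
  "\<zero>\<^bsub>free_mod R X\<^esub> = (\<lambda>_. \<zero>\<^bsub>R\<^esub>)"
  "f \<oplus>\<^bsub>free_mod R X\<^esub> g = (\<lambda>x. f x \<oplus>\<^bsub>R\<^esub> g x)"
  "a \<odot>\<^bsub>free_mod R X\<^esub> f = (\<lambda>x. a \<otimes>\<^bsub>R\<^esub> f x)"
  by (simp_all add: free_mod_def)

lemma free_mod_module:
  assumes "cring R"
  shows "module R (free_mod R X)"
proof -
  interpret cring R by fact
  have fin: "finite {x. h x \<noteq> \<zero>\<^bsub>R\<^esub>} \<and> {x. h x \<noteq> \<zero>\<^bsub>R\<^esub>} \<subseteq> X"
    if "finite {x. f x \<noteq> \<zero>\<^bsub>R\<^esub>}" "{x. f x \<noteq> \<zero>\<^bsub>R\<^esub>} \<subseteq> X" "finite {x. g x \<noteq> \<zero>\<^bsub>R\<^esub>}" "{x. g x \<noteq> \<zero>\<^bsub>R\<^esub>} \<subseteq> X"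
       "\<And>x. f x = \<zero>\<^bsub>R\<^esub> \<Longrightarrow> g x = \<zero>\<^bsub>R\<^esub> \<Longrightarrow> h x = \<zero>\<^bsub>R\<^esub>"
    for f g h
  proof -
    have "{x. h x \<noteq> \<zero>\<^bsub>R\<^esub>} \<subseteq> {x. f x \<noteq> \<zero>\<^bsub>R\<^esub>} \<union> {x. g x \<noteq> \<zero>\<^bsub>R\<^esub>}" using that(5) by blast
    thus ?thesis using that by (meson finite_UnI finite_subset order_trans Un_least)
  qed
  show ?thesis
  proof (rule moduleI)
    show "abelian_group (free_mod R X)"
    proof (rule abelian_groupI)
      fix f g assume "f \<in> carrier (free_mod R X)" "g \<in> carrier (free_mod R X)"
      thus "f \<oplus>\<^bsub>free_mod R X\<^esub> g \<in> carrier (free_mod R X)"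
        using fin[of f g "\<lambda>x. f x \<oplus>\<^bsub>R\<^esub> g x"] by simp
    next
      fix f assume f: "f \<in> carrier (free_mod R X)"
      hence "(\<lambda>x. \<ominus>\<^bsub>R\<^esub> f x) \<in> carrier (free_mod R X)"
        using fin[of f f "\<lambda>x. \<ominus>\<^bsub>R\<^esub> f x"] by simp
      thus "\<exists>g\<in>carrier (free_mod R X). g \<oplus>\<^bsub>free_mod R X\<^esub> f = \<zero>\<^bsub>free_mod R X\<^esub>"
        using f by (intro bexI[of _ "\<lambda>x. \<ominus>\<^bsub>R\<^esub> f x"]) (auto simp: l_neg)
    qed (auto simp: a_ac)
  next
    fix a f assume "a \<in> carrier R" "f \<in> carrier (free_mod R X)"
    thus "a \<odot>\<^bsub>free_mod R X\<^esub> f \<in> carrier (free_mod R X)"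
      using fin[of f f "\<lambda>x. a \<otimes>\<^bsub>R\<^esub> f x"] by simp
  qed (auto simp: l_distr r_distr m_assoc is_cring)
qed

lemma free_gen_closed:
  assumes "cring R" "x \<in> X"
  shows "free_gen R x \<in> carrier (free_mod R X)"
proof -
  interpret cring R by fact
  have "{y. free_gen R x y \<noteq> \<zero>\<^bsub>R\<^esub>} \<subseteq> {x}" by (auto simp: free_gen_def)
  thus ?thesis using assms(2) by (auto intro: finite_subset simp: free_gen_def)
qed

lemma free_mod_induct:
  assumes "cring R" "submodule H R (free_mod R X)" "\<And>x. x \<in> X \<Longrightarrow> free_gen R x \<in> H"
  shows "H = carrier (free_mod R X)"
proof -
  interpret R: cring R by fact
  interpret L: module R "free_mod R X" by (rule free_mod_module) fact
  note H = L.submoduleE[OF assms(2)]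
  have "f \<in> H" if "finite A" "f \<in> carrier (free_mod R X)" "{x. f x \<noteq> \<zero>\<^bsub>R\<^esub>} \<subseteq> A" for A f
    using that
  proof (induction A arbitrary: f)
    case empty
    hence "f = (\<lambda>_. \<zero>\<^bsub>R\<^esub>)" by auto
    thus ?case using assms(2) by (auto simp: submodule_def subgroup_def)
  next
    case (insert a A)
    show ?case
    proof (cases "f a = \<zero>\<^bsub>R\<^esub>")
      case True
      thus ?thesis using insert by (intro insert.IH) auto
    next
      case False
      hence aX: "a \<in> X" using insert.prems by auto
      let ?g = "f(a := \<zero>\<^bsub>R\<^esub>)"
      have "{x. ?g x \<noteq> \<zero>\<^bsub>R\<^esub>} \<subseteq> {x. f x \<noteq> \<zero>\<^bsub>R\<^esub>}" by auto
      hence "?g \<in> carrier (free_mod R X)"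
        using insert.prems by (auto intro: finite_subset)
      hence "?g \<in> H" using insert.prems by (intro insert.IH) auto
      moreover have "f a \<odot>\<^bsub>free_mod R X\<^esub> free_gen R a \<in> H"
        using assms(3)[OF aX] insert.prems by (intro H) auto
      moreover have "f = ?g \<oplus>\<^bsub>free_mod R X\<^esub> (f a \<odot>\<^bsub>free_mod R X\<^esub> free_gen R a)"
        using insert.prems by (auto simp: free_gen_def fun_eq_iff)
      ultimately show ?thesis using H(5) by metis
    qed
  qed
  moreover have "finite {x. f x \<noteq> \<zero>\<^bsub>R\<^esub>}" if "f \<in> carrier (free_mod R X)" for f
    using that by simp
  ultimately show ?thesis using H(1) by blast
qed

lemma free_mod_extend:
  assumes "module R P" "\<And>x. x \<in> X \<Longrightarrow> b x \<in> carrier P"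
  shows "\<exists>h\<in>mod_hom R (free_mod R X) P. \<forall>x\<in>X. h (free_gen R x) = b x"
proof -
  interpret P: module R P by fact
  let ?L = "free_mod R X"
  let ?s = "\<lambda>f. {x. f x \<noteq> \<zero>\<^bsub>R\<^esub>}"
  define h where "h f = (\<Oplus>\<^bsub>P\<^esub>x\<in>?s f. f x \<odot>\<^bsub>P\<^esub> b x)" for f
  have h: "h f = (\<Oplus>\<^bsub>P\<^esub>x\<in>A. f x \<odot>\<^bsub>P\<^esub> b x)"
    if "f \<in> carrier ?L" "finite A" "?s f \<subseteq> A" "A \<subseteq> X" for f A
    unfolding h_def
    using that assms(2) by (intro P.M.add.finprod_mono_neutral_cong_left) (auto intro!: P.smult_l_null)
  have "h \<in> mod_hom R ?L P"
    unfolding mod_hom_def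
  proof (intro CollectI conjI ballI Pi_I)
    fix f assume f: "f \<in> carrier ?L"
    thus "h f \<in> carrier P" unfolding h_def using assms(2) by (intro P.M.finsum_closed) auto
  next
    fix f g assume f: "f \<in> carrier ?L" and g: "g \<in> carrier ?L"
    interpret L: module R ?L by (rule free_mod_module) (rule P.R.is_cring)
    let ?A = "?s f \<union> ?s g"
    have A: "finite ?A" "?A \<subseteq> X" using f g by auto
    have fg: "f \<oplus>\<^bsub>?L\<^esub> g \<in> carrier ?L" using f g by (rule L.M.add.m_closed)
    have "h (f \<oplus>\<^bsub>?L\<^esub> g) = (\<Oplus>\<^bsub>P\<^esub>x\<in>?A. (f x \<oplus>\<^bsub>R\<^esub> g x) \<odot>\<^bsub>P\<^esub> b x)"
    proof (subst h[OF fg A(1) _ A(2)])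
      show "?s (f \<oplus>\<^bsub>?L\<^esub> g) \<subseteq> ?A" by auto
    qed simp
    also have "\<dots> = (\<Oplus>\<^bsub>P\<^esub>x\<in>?A. f x \<odot>\<^bsub>P\<^esub> b x \<oplus>\<^bsub>P\<^esub> g x \<odot>\<^bsub>P\<^esub> b x)"
      using f g A assms(2) by (intro P.M.finsum_cong') (auto simp: P.smult_l_distr subset_iff)
    also have "\<dots> = (\<Oplus>\<^bsub>P\<^esub>x\<in>?A. f x \<odot>\<^bsub>P\<^esub> b x) \<oplus>\<^bsub>P\<^esub> (\<Oplus>\<^bsub>P\<^esub>x\<in>?A. g x \<odot>\<^bsub>P\<^esub> b x)"
      using f g A assms(2) by (intro P.M.finsum_addf) (auto simp: subset_iff)
    also have "\<dots> = h f \<oplus>\<^bsub>P\<^esub> h g" using h[OF f A(1) _ A(2)] h[OF g A(1) _ A(2)] by auto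
    finally show "h (f \<oplus>\<^bsub>?L\<^esub> g) = h f \<oplus>\<^bsub>P\<^esub> h g" .
  next
    fix a f assume a: "a \<in> carrier R" and f: "f \<in> carrier ?L"
    interpret L: module R ?L by (rule free_mod_module) (rule P.R.is_cring)
    have A: "finite (?s f)" "?s f \<subseteq> X" using f by auto
    have af: "a \<odot>\<^bsub>?L\<^esub> f \<in> carrier ?L" using a f by (rule L.smult_closed)
    have "h (a \<odot>\<^bsub>?L\<^esub> f) = (\<Oplus>\<^bsub>P\<^esub>x\<in>?s f. (a \<otimes>\<^bsub>R\<^esub> f x) \<odot>\<^bsub>P\<^esub> b x)"
    proof (subst h[OF af A(1) _ A(2)])
      show "?s (a \<odot>\<^bsub>?L\<^esub> f) \<subseteq> ?s f" using a by auto
    qed simp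
    also have "\<dots> = (\<Oplus>\<^bsub>P\<^esub>x\<in>?s f. a \<odot>\<^bsub>P\<^esub> (f x \<odot>\<^bsub>P\<^esub> b x))"
      using f a A assms(2) by (intro P.M.finsum_cong') (auto simp: P.smult_assoc1 subset_iff)
    also have "\<dots> = a \<odot>\<^bsub>P\<^esub> h f"
      unfolding h_def using f a A assms(2)
      by (intro P.finsum_smult_ldistr[symmetric]) (auto simp: subset_iff)
    finally show "h (a \<odot>\<^bsub>?L\<^esub> f) = a \<odot>\<^bsub>P\<^esub> h f" .
  qed
  moreover have "h (free_gen R x) = b x" if x: "x \<in> X" for x
  proof -
    have "h (free_gen R x) = (\<Oplus>\<^bsub>P\<^esub>y\<in>{x}. free_gen R x y \<odot>\<^bsub>P\<^esub> b y)"
      using x by (intro h free_gen_closed P.R.is_cring) (auto simp: free_gen_def)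
    also have "\<dots> = b x" using assms(2)[OF x] by (simp add: free_gen_def)
    finally show ?thesis .
  qed
  ultimately show ?thesis by blast
qed

lemma tensor_rel_submodule:
  assumes "module R M" "module R N"
  shows "submodule (tensor_rel R M N) R (free_mod R (carrier M \<times> carrier N))"
proof -
  interpret M: module R M by fact
  interpret N: module R N by fact
  interpret L: module R "free_mod R (carrier M \<times> carrier N)"
    by (rule free_mod_module) (rule M.R.is_cring)
  have e: "free_gen R (x, y) \<in> carrier (free_mod R (carrier M \<times> carrier N))"
    if "x \<in> carrier M" "y \<in> carrier N" for x y
    using that by (intro free_gen_closed M.R.is_cring) auto
  show ?thesis
    unfolding tensor_rel_def Let_def
  proof (rule mod_span_submodule[OF L.module_axioms], intro Un_least subsetI)
  qed (elim CollectE exE conjE, hypsubst,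
    intro L.M.minus_closed L.M.add.m_closed L.smult_closed e M.M.add.m_closed N.M.add.m_closed
      M.smult_closed N.smult_closed; assumption)+
qed

lemma tensor_module:
  assumes "module R M" "module R N"
  shows "module R (tensor R M N)"
proof -
  interpret M: module R M by fact
  show ?thesis
    unfolding tensor_def
    by (rule quot_mod_module(1)[OF free_mod_module[OF M.R.is_cring] tensor_rel_submodule[OF assms]])
qed

lemma pure_tensor_bilinear:
  assumes "module R M" "module R N"
  shows "x \<in> carrier M \<Longrightarrow> y \<in> carrier N \<Longrightarrow> pure_tensor R M N x y \<in> carrier (tensor R M N)"
    and "x \<in> carrier M \<Longrightarrow> x' \<in> carrier M \<Longrightarrow> y \<in> carrier N \<Longrightarrow>
      pure_tensor R M N (x \<oplus>\<^bsub>M\<^esub> x') y = pure_tensor R M N x y \<oplus>\<^bsub>tensor R M N\<^esub> pure_tensor R M N x' y"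
    and "x \<in> carrier M \<Longrightarrow> y \<in> carrier N \<Longrightarrow> y' \<in> carrier N \<Longrightarrow>
      pure_tensor R M N x (y \<oplus>\<^bsub>N\<^esub> y') = pure_tensor R M N x y \<oplus>\<^bsub>tensor R M N\<^esub> pure_tensor R M N x y'"
    and "a \<in> carrier R \<Longrightarrow> x \<in> carrier M \<Longrightarrow> y \<in> carrier N \<Longrightarrow>
      pure_tensor R M N (a \<odot>\<^bsub>M\<^esub> x) y = a \<odot>\<^bsub>tensor R M N\<^esub> pure_tensor R M N x y"
    and "a \<in> carrier R \<Longrightarrow> x \<in> carrier M \<Longrightarrow> y \<in> carrier N \<Longrightarrow>
      pure_tensor R M N x (a \<odot>\<^bsub>N\<^esub> y) = a \<odot>\<^bsub>tensor R M N\<^esub> pure_tensor R M N x y"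
proof -
  interpret M: module R M by fact
  interpret N: module R N by fact
  let ?L = "free_mod R (carrier M \<times> carrier N)" and ?T = "tensor_rel R M N"
  let ?e = "\<lambda>x y. free_gen R (x, y)"
  interpret L: module R ?L
    by (rule free_mod_module) (rule M.R.is_cring)
  note T = tensor_rel_submodule[OF assms]
  note q = mod_homD[OF quot_mod_module(2)[OF L.module_axioms T]]
  note eq = coset_eq_iff[OF L.module_axioms T, THEN iffD2]
  have e: "?e x y \<in> carrier ?L" if "x \<in> carrier M" "y \<in> carrier N" for x y
    using that by (intro free_gen_closed M.R.is_cring) auto
  have sup: "
      ({?e (x \<oplus>\<^bsub>M\<^esub> x') y \<ominus>\<^bsub>?L\<^esub> (?e x y \<oplus>\<^bsub>?L\<^esub> ?e x' y) |x x' y. x \<in> carrier M \<and> x' \<in> carrier M \<and> y \<in> carrier N} \<union>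
       {?e x (y \<oplus>\<^bsub>N\<^esub> y') \<ominus>\<^bsub>?L\<^esub> (?e x y \<oplus>\<^bsub>?L\<^esub> ?e x y') |x y y'. x \<in> carrier M \<and> y \<in> carrier N \<and> y' \<in> carrier N} \<union>
       {?e (a \<odot>\<^bsub>M\<^esub> x) y \<ominus>\<^bsub>?L\<^esub> a \<odot>\<^bsub>?L\<^esub> ?e x y |a x y. a \<in> carrier R \<and> x \<in> carrier M \<and> y \<in> carrier N} \<union>
       {?e x (a \<odot>\<^bsub>N\<^esub> y) \<ominus>\<^bsub>?L\<^esub> a \<odot>\<^bsub>?L\<^esub> ?e x y |a x y. a \<in> carrier R \<and> x \<in> carrier M \<and> y \<in> carrier N})
     \<subseteq> ?T"
    unfolding tensor_rel_def Let_def by (rule mod_span_superset)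
  note d = tensor_def pure_tensor_def
  show "x \<in> carrier M \<Longrightarrow> y \<in> carrier N \<Longrightarrow> pure_tensor R M N x y \<in> carrier (tensor R M N)"
    unfolding d by (intro q e)
  show "pure_tensor R M N (x \<oplus>\<^bsub>M\<^esub> x') y = pure_tensor R M N x y \<oplus>\<^bsub>tensor R M N\<^esub> pure_tensor R M N x' y"
    if "x \<in> carrier M" "x' \<in> carrier M" "y \<in> carrier N"
    unfolding d q(2)[OF e[OF that(1,3)] e[OF that(2,3)], symmetric]
    using that by (intro eq e L.M.add.m_closed M.M.add.m_closed subsetD[OF sup]) blast+
  show "pure_tensor R M N x (y \<oplus>\<^bsub>N\<^esub> y') = pure_tensor R M N x y \<oplus>\<^bsub>tensor R M N\<^esub> pure_tensor R M N x y'"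
    if "x \<in> carrier M" "y \<in> carrier N" "y' \<in> carrier N"
    unfolding d q(2)[OF e[OF that(1,2)] e[OF that(1,3)], symmetric]
    using that by (intro eq e L.M.add.m_closed N.M.add.m_closed subsetD[OF sup]) blast+
  show "pure_tensor R M N (a \<odot>\<^bsub>M\<^esub> x) y = a \<odot>\<^bsub>tensor R M N\<^esub> pure_tensor R M N x y"
    if "a \<in> carrier R" "x \<in> carrier M" "y \<in> carrier N"
    unfolding d q(3)[OF that(1) e[OF that(2,3)], symmetric]
    using that by (intro eq e L.smult_closed M.smult_closed subsetD[OF sup]) blast+
  show "pure_tensor R M N x (a \<odot>\<^bsub>N\<^esub> y) = a \<odot>\<^bsub>tensor R M N\<^esub> pure_tensor R M N x y"
    if "a \<in> carrier R" "x \<in> carrier M" "y \<in> carrier N"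
    unfolding d q(3)[OF that(1) e[OF that(2,3)], symmetric]
    using that by (intro eq e L.smult_closed N.smult_closed subsetD[OF sup]) blast+
qed

lemma tensor_hom_eqI:
  assumes "module R M" "module R N" "module R P"
    and f: "f \<in> mod_hom R (tensor R M N) P" and g: "g \<in> mod_hom R (tensor R M N) P"
    and eq: "\<And>x y. x \<in> carrier M \<Longrightarrow> y \<in> carrier N \<Longrightarrow>
      f (pure_tensor R M N x y) = g (pure_tensor R M N x y)"
    and u: "u \<in> carrier (tensor R M N)"
  shows "f u = g u"
proof -
  interpret M: module R M by fact
  interpret N: module R N by fact
  interpret P: module R P by fact
  let ?L = "free_mod R (carrier M \<times> carrier N)" and ?T = "tensor_rel R M N"
  interpret L: module R ?L
    by (rule free_mod_module) (rule M.R.is_cring)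
  note T = tensor_rel_submodule[OF assms(1,2)]
  note q = mod_homD[OF quot_mod_module(2)[OF L.module_axioms T], folded tensor_def]
  interpret Q: module R "tensor R M N" by (rule tensor_module) fact+
  let ?H = "{l \<in> carrier ?L. f (?T +>\<^bsub>?L\<^esub> l) = g (?T +>\<^bsub>?L\<^esub> l)}"
  have "?H = carrier ?L"
  proof (rule free_mod_induct[OF M.R.is_cring])
    show "submodule ?H R ?L"
    proof (rule L.submoduleI)
      have "?T +>\<^bsub>?L\<^esub> \<zero>\<^bsub>?L\<^esub> = \<zero>\<^bsub>tensor R M N\<^esub>"
        using mod_hom_zero[OF L.module_axioms Q.module_axioms quot_mod_module(2)[OF L.module_axioms T, folded tensor_def]] .
      thus "\<zero>\<^bsub>?L\<^esub> \<in> ?H"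
        using mod_hom_zero[OF Q.module_axioms assms(3) f] mod_hom_zero[OF Q.module_axioms assms(3) g]
        by (simp del: free_mod_simps)
    next
      fix l assume l: "l \<in> ?H"
      hence lc: "l \<in> carrier ?L" by blast
      have m: "?T +>\<^bsub>?L\<^esub> (\<ominus>\<^bsub>?L\<^esub> l) = \<ominus>\<^bsub>tensor R M N\<^esub> (?T +>\<^bsub>?L\<^esub> l)"
        using mod_hom_minus[OF L.module_axioms Q.module_axioms quot_mod_module(2)[OF L.module_axioms T, folded tensor_def] lc] .
      show "\<ominus>\<^bsub>?L\<^esub> l \<in> ?H"
        using l lc q(1)[OF lc] mod_hom_minus[OF Q.module_axioms assms(3) f] mod_hom_minus[OF Q.module_axioms assms(3) g]
        by (simp del: free_mod_simps add: m)
    next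
      fix k l assume "k \<in> ?H" "l \<in> ?H"
      thus "k \<oplus>\<^bsub>?L\<^esub> l \<in> ?H"
        using q(1,2) mod_homD(2)[OF f] mod_homD(2)[OF g] by (simp del: free_mod_simps)
    next
      fix a l assume "a \<in> carrier R" "l \<in> ?H"
      thus "a \<odot>\<^bsub>?L\<^esub> l \<in> ?H"
        using q(1,3) mod_homD(3)[OF f] mod_homD(3)[OF g] by (simp del: free_mod_simps)
    qed blast
    fix z assume "z \<in> carrier M \<times> carrier N"
    thus "free_gen R z \<in> ?H"
      using eq free_gen_closed[OF M.R.is_cring, of z "carrier M \<times> carrier N"]
      by (auto simp: pure_tensor_def simp del: free_mod_simps)
  qed
  moreover have "\<exists>l\<in>carrier ?L. u = ?T +>\<^bsub>?L\<^esub> l"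
    using u by (auto simp: tensor_def A_RCOSETS_def' simp del: free_mod_simps)
  ultimately show ?thesis by blast
qed

lemma tensor_universal:
  assumes "module R M" "module R N" "module R P"
    and bc: "\<And>x y. x \<in> carrier M \<Longrightarrow> y \<in> carrier N \<Longrightarrow> b x y \<in> carrier P"
    and b1: "\<And>x x' y. x \<in> carrier M \<Longrightarrow> x' \<in> carrier M \<Longrightarrow> y \<in> carrier N \<Longrightarrow>
      b (x \<oplus>\<^bsub>M\<^esub> x') y = b x y \<oplus>\<^bsub>P\<^esub> b x' y"
    and b2: "\<And>x y y'. x \<in> carrier M \<Longrightarrow> y \<in> carrier N \<Longrightarrow> y' \<in> carrier N \<Longrightarrow>
      b x (y \<oplus>\<^bsub>N\<^esub> y') = b x y \<oplus>\<^bsub>P\<^esub> b x y'"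
    and b3: "\<And>a x y. a \<in> carrier R \<Longrightarrow> x \<in> carrier M \<Longrightarrow> y \<in> carrier N \<Longrightarrow>
      b (a \<odot>\<^bsub>M\<^esub> x) y = a \<odot>\<^bsub>P\<^esub> b x y"
    and b4: "\<And>a x y. a \<in> carrier R \<Longrightarrow> x \<in> carrier M \<Longrightarrow> y \<in> carrier N \<Longrightarrow>
      b x (a \<odot>\<^bsub>N\<^esub> y) = a \<odot>\<^bsub>P\<^esub> b x y"
  shows "\<exists>h\<in>mod_hom R (tensor R M N) P.
    \<forall>x\<in>carrier M. \<forall>y\<in>carrier N. h (pure_tensor R M N x y) = b x y"
proof -
  interpret M: module R M by fact
  interpret N: module R N by fact
  interpret P: module R P by fact
  let ?L = "free_mod R (carrier M \<times> carrier N)" and ?T = "tensor_rel R M N"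
  let ?e = "\<lambda>x y. free_gen R (x, y)"
  interpret L: module R ?L
    by (rule free_mod_module) (rule M.R.is_cring)
  note T = tensor_rel_submodule[OF assms(1,2)]
  have e: "?e x y \<in> carrier ?L" if "x \<in> carrier M" "y \<in> carrier N" for x y
    using that by (intro free_gen_closed M.R.is_cring) auto
  obtain k where k: "k \<in> mod_hom R ?L P"
    and k': "\<forall>z\<in>carrier M \<times> carrier N. k (free_gen R z) = (case z of (x, y) \<Rightarrow> b x y)"
    using free_mod_extend[OF assms(3), of "carrier M \<times> carrier N" "\<lambda>(x,y). b x y"] bc by auto
  have ke: "k (?e x y) = b x y" if "x \<in> carrier M" "y \<in> carrier N" for x y
    using k' that by auto
  have km: "k (u \<ominus>\<^bsub>?L\<^esub> v) = k u \<ominus>\<^bsub>P\<^esub> k v" if "u \<in> carrier ?L" "v \<in> carrier ?L" for u v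
    unfolding a_minus_def
    using mod_homD(2)[OF k that(1), of "\<ominus>\<^bsub>?L\<^esub> v"] mod_hom_minus[OF L.module_axioms assms(3) k that(2)]
      L.M.a_inv_closed[OF that(2)] by (simp del: free_mod_simps)
  let ?K = "{l \<in> carrier ?L. k l = \<zero>\<^bsub>P\<^esub>}"
  have "submodule ?K R ?L"
  proof (rule L.submoduleI)
    show "\<zero>\<^bsub>?L\<^esub> \<in> ?K"
      using mod_hom_zero[OF L.module_axioms assms(3) k] by (simp del: free_mod_simps)
  qed (use mod_homD[OF k] mod_hom_minus[OF L.module_axioms assms(3) k] in \<open>auto simp del: free_mod_simps\<close>)
  moreover have "
      ({?e (x \<oplus>\<^bsub>M\<^esub> x') y \<ominus>\<^bsub>?L\<^esub> (?e x y \<oplus>\<^bsub>?L\<^esub> ?e x' y) |x x' y. x \<in> carrier M \<and> x' \<in> carrier M \<and> y \<in> carrier N} \<union>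
       {?e x (y \<oplus>\<^bsub>N\<^esub> y') \<ominus>\<^bsub>?L\<^esub> (?e x y \<oplus>\<^bsub>?L\<^esub> ?e x y') |x y y'. x \<in> carrier M \<and> y \<in> carrier N \<and> y' \<in> carrier N} \<union>
       {?e (a \<odot>\<^bsub>M\<^esub> x) y \<ominus>\<^bsub>?L\<^esub> a \<odot>\<^bsub>?L\<^esub> ?e x y |a x y. a \<in> carrier R \<and> x \<in> carrier M \<and> y \<in> carrier N} \<union>
       {?e x (a \<odot>\<^bsub>N\<^esub> y) \<ominus>\<^bsub>?L\<^esub> a \<odot>\<^bsub>?L\<^esub> ?e x y |a x y. a \<in> carrier R \<and> x \<in> carrier M \<and> y \<in> carrier N})
     \<subseteq> ?K" (is "?A \<union> ?B \<union> ?C \<union> ?D \<subseteq> ?K")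
  proof (intro Un_least subsetI)
    note cl = L.M.minus_closed L.M.add.m_closed L.smult_closed e M.M.add.m_closed N.M.add.m_closed
      M.smult_closed N.smult_closed
    note sms = km ke mod_homD(2,3)[OF k] cl bc P.M.r_neg[folded a_minus_def]
    {
      fix u assume "u \<in> ?A"
      then obtain x x' y where "x \<in> carrier M" "x' \<in> carrier M" "y \<in> carrier N"
        "u = ?e (x \<oplus>\<^bsub>M\<^esub> x') y \<ominus>\<^bsub>?L\<^esub> (?e x y \<oplus>\<^bsub>?L\<^esub> ?e x' y)" by blast
      thus "u \<in> ?K" by (simp del: free_mod_simps add: sms b1)
    next
      fix u assume "u \<in> ?B"
      then obtain x y y' where "x \<in> carrier M" "y \<in> carrier N" "y' \<in> carrier N"
        "u = ?e x (y \<oplus>\<^bsub>N\<^esub> y') \<ominus>\<^bsub>?L\<^esub> (?e x y \<oplus>\<^bsub>?L\<^esub> ?e x y')" by blast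
      thus "u \<in> ?K" by (simp del: free_mod_simps add: sms b2)
    next
      fix u assume "u \<in> ?C"
      then obtain a x y where "a \<in> carrier R" "x \<in> carrier M" "y \<in> carrier N"
        "u = ?e (a \<odot>\<^bsub>M\<^esub> x) y \<ominus>\<^bsub>?L\<^esub> a \<odot>\<^bsub>?L\<^esub> ?e x y" by blast
      thus "u \<in> ?K" by (simp del: free_mod_simps add: sms b3)
    next
      fix u assume "u \<in> ?D"
      then obtain a x y where "a \<in> carrier R" "x \<in> carrier M" "y \<in> carrier N"
        "u = ?e x (a \<odot>\<^bsub>N\<^esub> y) \<ominus>\<^bsub>?L\<^esub> a \<odot>\<^bsub>?L\<^esub> ?e x y" by blast
      thus "u \<in> ?K" by (simp del: free_mod_simps add: sms b4)
    }
  qed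
  ultimately have "?T \<subseteq> ?K"
    unfolding tensor_rel_def Let_def by (rule mod_span_least)
  then obtain h where "h \<in> mod_hom R (tensor R M N) P" "\<forall>l\<in>carrier ?L. h (?T +>\<^bsub>?L\<^esub> l) = k l"
    using quot_mod_induced[OF L.module_axioms T assms(3) k] unfolding tensor_def by blast
  thus ?thesis using e ke unfolding pure_tensor_def by metis
qed

lemma tensor_map_unique:
  assumes "module R M" "module R N" "module R M'" "module R N'"
    and f: "f \<in> mod_hom R M M'" and g: "g \<in> mod_hom R N N'"
  shows "\<exists>!h. h \<in> mod_hom R (tensor R M N) (tensor R M' N') \<and>
        h \<in> extensional (carrier (tensor R M N)) \<and>
        (\<forall>x \<in> carrier M. \<forall>y \<in> carrier N.
           h (pure_tensor R M N x y) = pure_tensor R M' N' (f x) (g y))"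
proof -
  interpret T: module R "tensor R M N" by (rule tensor_module) fact+
  note T' = tensor_module[OF assms(3,4)]
  note p = pure_tensor_bilinear[OF assms(3,4)]
  obtain h where h: "h \<in> mod_hom R (tensor R M N) (tensor R M' N')"
    "\<forall>x \<in> carrier M. \<forall>y \<in> carrier N. h (pure_tensor R M N x y) = pure_tensor R M' N' (f x) (g y)"
    using tensor_universal[OF assms(1,2) T', of "\<lambda>x y. pure_tensor R M' N' (f x) (g y)"]
      p mod_homD[OF f] mod_homD[OF g] by auto
  show ?thesis
  proof (rule ex1I[of _ "restrict h (carrier (tensor R M N))"], intro conjI)
    show "restrict h (carrier (tensor R M N)) \<in> mod_hom R (tensor R M N) (tensor R M' N')"
      using h(1) by (auto simp: mod_hom_def)
    show "\<forall>x \<in> carrier M. \<forall>y \<in> carrier N. restrict h (carrier (tensor R M N)) (pure_tensor R M N x y)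
        = pure_tensor R M' N' (f x) (g y)"
      using h(2) pure_tensor_bilinear(1)[OF assms(1,2)] by auto
  next
    fix k assume k: "k \<in> mod_hom R (tensor R M N) (tensor R M' N') \<and>
        k \<in> extensional (carrier (tensor R M N)) \<and>
        (\<forall>x \<in> carrier M. \<forall>y \<in> carrier N.
           k (pure_tensor R M N x y) = pure_tensor R M' N' (f x) (g y))"
    show "k = restrict h (carrier (tensor R M N))"
      using k h tensor_hom_eqI[OF assms(1,2) T', of k h]
      by (intro extensionalityI[of _ "carrier (tensor R M N)"]) auto
  qed simp
qed

lemma regular_module_simps [simp]:
  "carrier (regular_module R) = carrier R"
  "\<zero>\<^bsub>regular_module R\<^esub> = \<zero>\<^bsub>R\<^esub>"
  "a \<oplus>\<^bsub>regular_module R\<^esub> b = a \<oplus>\<^bsub>R\<^esub> b"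
  "a \<odot>\<^bsub>regular_module R\<^esub> b = a \<otimes>\<^bsub>R\<^esub> b"
  by (simp_all add: regular_module_def)

lemma regular_module_module:
  assumes "cring R"
  shows "module R (regular_module R)"
proof -
  interpret cring R by fact
  show ?thesis
  proof (rule moduleI)
    show "abelian_group (regular_module R)"
    proof (rule abelian_groupI)
      fix x assume "x \<in> carrier (regular_module R)"
      thus "\<exists>y\<in>carrier (regular_module R). y \<oplus>\<^bsub>regular_module R\<^esub> x = \<zero>\<^bsub>regular_module R\<^esub>"
        by (intro bexI[of _ "\<ominus>\<^bsub>R\<^esub> x"]) (auto simp: l_neg)
    qed (auto simp: a_ac)
  qed (auto simp: l_distr r_distr m_assoc is_cring)
qed

lemma regular_coset: "N +>\<^bsub>regular_module R\<^esub> x = N +>\<^bsub>R\<^esub> x"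
  by (simp add: a_r_coset_def')

lemma ideal_regular_submodule:
  assumes "cring R" "ideal I R"
  shows "submodule I R (regular_module R)"
proof -
  interpret cring R by fact
  interpret I: ideal I R by fact
  interpret Q: module R "regular_module R" by (rule regular_module_module) fact
  show ?thesis
  proof (rule Q.submoduleI)
    fix a assume a: "a \<in> I"
    have "\<ominus>\<^bsub>regular_module R\<^esub> a = \<ominus>\<^bsub>R\<^esub> a"
      using a I.Icarr by (intro Q.M.minus_equality) (auto simp: l_neg)
    thus "\<ominus>\<^bsub>regular_module R\<^esub> a \<in> I" using a by simp
  qed (use I.Icarr I.I_l_closed in auto)
qed

lemma quot_to_tensor_iso:
  assumes "module R M" "ideal I R"
  defines "Q \<equiv> quot_mod M (ideal_smult R I M)" and "T \<equiv> tensor R M (quot_ring_mod R I)"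
  shows "quot_to_tensor R M I \<in> mod_hom R Q T"
    and "bij_betw (quot_to_tensor R M I) (carrier Q) (carrier T)"
    and "x \<in> carrier M \<Longrightarrow> quot_to_tensor R M I (ideal_smult R I M +>\<^bsub>M\<^esub> x) =
      pure_tensor R M (quot_ring_mod R I) x (I +>\<^bsub>R\<^esub> \<one>\<^bsub>R\<^esub>)"
proof -
  interpret M: module R M by fact
  interpret I: ideal I R by fact
  note Rm = regular_module_module[OF M.R.is_cring]
  note Is = ideal_regular_submodule[OF M.R.is_cring assms(2)]
  note RI = quot_mod_module[OF Rm Is]
  note q = mod_homD[OF RI(2), unfolded regular_module_simps regular_coset]
  note Tm = tensor_module[OF assms(1) RI(1), folded T_def]
  interpret T: module R T by (rule Tm)
  note p = pure_tensor_bilinear[OF assms(1) RI(1), folded T_def]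
  let ?p = "pure_tensor R M (quot_ring_mod R I)" and ?o = "I +>\<^bsub>R\<^esub> \<one>\<^bsub>R\<^esub>"
  let ?N = "ideal_smult R I M" and ?\<theta> = "quot_to_tensor R M I"
  have one: "?o \<in> carrier (quot_ring_mod R I)" using q(1) by simp
  have sub: "{a \<odot>\<^bsub>M\<^esub> x |a x. a \<in> I \<and> x \<in> carrier M} \<subseteq> carrier M" using I.Icarr by auto
  have Ns: "submodule ?N R M" unfolding ideal_smult_def by (rule mod_span_submodule[OF assms(1) sub])
  note Qm = quot_mod_module[OF assms(1) Ns, folded Q_def]
  interpret N: abelian_subgroup ?N M by (rule submodule_abelian_subgroup) fact+
  define f where "f x = ?p x ?o" for x
  have f: "f \<in> mod_hom R M T"
    using p one by (auto simp: mod_hom_def f_def)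
  have f0: "f x = \<zero>\<^bsub>T\<^esub>" if "x \<in> ?N" for x
  proof -
    let ?K = "{l \<in> carrier M. f l = \<zero>\<^bsub>T\<^esub>}"
    have "submodule ?K R M"
    proof (rule M.submoduleI)
      show "\<zero>\<^bsub>M\<^esub> \<in> ?K" using mod_hom_zero[OF assms(1) Tm f] by simp
    qed (use mod_homD[OF f] mod_hom_minus[OF assms(1) Tm f] in auto)
    moreover have "{a \<odot>\<^bsub>M\<^esub> x |a x. a \<in> I \<and> x \<in> carrier M} \<subseteq> ?K"
    proof clarify
      fix a x assume a: "a \<in> I" and x: "x \<in> carrier M"
      have ac: "a \<in> carrier R" using a I.Icarr by blast
      have "f (a \<odot>\<^bsub>M\<^esub> x) = ?p x (a \<odot>\<^bsub>quot_ring_mod R I\<^esub> ?o)"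
        unfolding f_def using p(4)[OF ac x one] p(5)[OF ac x one] by simp
      also have "a \<odot>\<^bsub>quot_ring_mod R I\<^esub> ?o = I +>\<^bsub>R\<^esub> a"
        using q(3)[OF ac M.R.one_closed] ac by simp
      also have "I +>\<^bsub>R\<^esub> a = \<zero>\<^bsub>R\<^esub> \<odot>\<^bsub>quot_ring_mod R I\<^esub> ?o"
        using q(3)[OF M.R.zero_closed M.R.one_closed] I.a_rcos_const[OF I.zero_closed]
          I.a_rcos_const[OF a] by simp
      also have "?p x \<dots> = \<zero>\<^bsub>T\<^esub>"
        using p(5)[OF M.R.zero_closed x one] p(1)[OF x one] by simp
      finally show "a \<odot>\<^bsub>M\<^esub> x \<in> carrier M \<and> f (a \<odot>\<^bsub>M\<^esub> x) = \<zero>\<^bsub>T\<^esub>" using ac x by simp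
    qed
    ultimately have "?N \<subseteq> ?K" unfolding ideal_smult_def by (rule mod_span_least)
    thus ?thesis using that by blast
  qed
  have \<theta>: "?\<theta> (?N +>\<^bsub>M\<^esub> x) = f x" if x: "x \<in> carrier M" for x
  proof -
    have "f y = f x" if y: "y \<in> ?N +>\<^bsub>M\<^esub> x" for y
    proof -
      have yc: "y \<in> carrier M" using y x N.a_elemrcos_carrier by blast
      have "y \<oplus>\<^bsub>M\<^esub> \<ominus>\<^bsub>M\<^esub> x \<in> ?N" using y yc x N.a_rcos_module by blast
      hence "f y \<oplus>\<^bsub>T\<^esub> \<ominus>\<^bsub>T\<^esub> f x = \<zero>\<^bsub>T\<^esub>"
        using f0 mod_homD(2)[OF f yc, of "\<ominus>\<^bsub>M\<^esub> x"] mod_hom_minus[OF assms(1) Tm f x] x by simp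
      thus ?thesis using mod_homD(1)[OF f] yc x
        by (metis T.M.a_inv_closed T.M.minus_equality T.M.minus_minus T.M.add.inv_unique')
    qed
    thus ?thesis using N.a_rcos_self[OF x] unfolding quot_to_tensor_def f_def by blast
  qed
  show "x \<in> carrier M \<Longrightarrow> ?\<theta> (?N +>\<^bsub>M\<^esub> x) = ?p x ?o" using \<theta> by (simp add: f_def)
  obtain h where h: "h \<in> mod_hom R Q T" "\<forall>x\<in>carrier M. h (?N +>\<^bsub>M\<^esub> x) = f x"
    using quot_mod_induced[OF assms(1) Ns Tm f f0] unfolding Q_def by blast
  have rep: "\<exists>x\<in>carrier M. K = ?N +>\<^bsub>M\<^esub> x" if "K \<in> carrier Q" for K
    using that by (auto simp: Q_def A_RCOSETS_def')
  interpret Q: module R Q by (rule Qm)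
  have h\<theta>: "?\<theta> K = h K" if "K \<in> carrier Q" for K using rep[OF that] \<theta> h(2) by auto
  show \<theta>hom: "?\<theta> \<in> mod_hom R Q T"
    unfolding mod_hom_def
    using h\<theta> mod_homD[OF h(1)] Q.M.add.m_closed Q.smult_closed by (auto simp: Pi_def)
  note qM = mod_homD[OF Qm(2)]
  text \<open>the inverse, induced by \<open>(x, r + I) \<mapsto> r x + I M\<close>\<close>
  have ex: "\<exists>b\<in>mod_hom R (quot_ring_mod R I) Q. \<forall>r\<in>carrier (regular_module R).
      b (I +>\<^bsub>regular_module R\<^esub> r) = ?N +>\<^bsub>M\<^esub> (r \<odot>\<^bsub>M\<^esub> x)" if x: "x \<in> carrier M" for x
  proof (rule quot_mod_induced[OF Rm Is Qm(1)])
    show "(\<lambda>r. ?N +>\<^bsub>M\<^esub> (r \<odot>\<^bsub>M\<^esub> x)) \<in> mod_hom R (regular_module R) Q"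
      using x qM M.smult_closed by (simp add: mod_hom_def Pi_def M.smult_l_distr M.smult_assoc1)
    fix a assume a: "a \<in> I"
    hence "a \<odot>\<^bsub>M\<^esub> x \<in> ?N" 
      unfolding ideal_smult_def using x by (intro subsetD[OF mod_span_superset]) blast
    thus "?N +>\<^bsub>M\<^esub> (a \<odot>\<^bsub>M\<^esub> x) = \<zero>\<^bsub>Q\<^esub>" unfolding Q_def by (simp add: N.a_rcos_const)
  qed
  define b where "b x = (SOME b. b \<in> mod_hom R (quot_ring_mod R I) Q \<and>
      (\<forall>r\<in>carrier R. b (I +>\<^bsub>R\<^esub> r) = ?N +>\<^bsub>M\<^esub> (r \<odot>\<^bsub>M\<^esub> x)))" for x
  have "b x \<in> mod_hom R (quot_ring_mod R I) Q \<and>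
      (\<forall>r\<in>carrier R. b x (I +>\<^bsub>R\<^esub> r) = ?N +>\<^bsub>M\<^esub> (r \<odot>\<^bsub>M\<^esub> x))" if "x \<in> carrier M" for x
    unfolding b_def
    by (rule someI_ex[OF ex[OF that, unfolded regular_module_simps regular_coset Bex_def]])
  hence b: "\<And>x. x \<in> carrier M \<Longrightarrow> b x \<in> mod_hom R (quot_ring_mod R I) Q"
    and br: "\<And>x r. x \<in> carrier M \<Longrightarrow> r \<in> carrier R \<Longrightarrow> b x (I +>\<^bsub>R\<^esub> r) = ?N +>\<^bsub>M\<^esub> (r \<odot>\<^bsub>M\<^esub> x)"
    by blast+
  have repR: "\<exists>r\<in>carrier R. K = I +>\<^bsub>R\<^esub> r" if "K \<in> carrier (quot_ring_mod R I)" for K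
    using that by (auto simp: A_RCOSETS_def' regular_coset)
  have "\<exists>g\<in>mod_hom R T Q. \<forall>x\<in>carrier M. \<forall>y\<in>carrier (quot_ring_mod R I). g (?p x y) = b x y"
    unfolding T_def
  proof (rule tensor_universal[OF assms(1) RI(1) Qm(1)])
    fix x x' y assume x: "x \<in> carrier M" "x' \<in> carrier M" and "y \<in> carrier (quot_ring_mod R I)"
    then obtain r where r: "r \<in> carrier R" "y = I +>\<^bsub>R\<^esub> r" using repR by blast
    show "b (x \<oplus>\<^bsub>M\<^esub> x') y = b x y \<oplus>\<^bsub>Q\<^esub> b x' y"
      using x r by (simp add: br qM(2) M.smult_r_distr)
  next
    fix a x y assume a: "a \<in> carrier R" and x: "x \<in> carrier M" and "y \<in> carrier (quot_ring_mod R I)"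
    then obtain r where r: "r \<in> carrier R" "y = I +>\<^bsub>R\<^esub> r" using repR by blast
    show "b (a \<odot>\<^bsub>M\<^esub> x) y = a \<odot>\<^bsub>Q\<^esub> b x y"
      using a x r by (simp add: br qM(3)[symmetric] M.smult_assoc1[symmetric] M.R.m_comm)
  qed (use mod_homD[OF b] in auto)
  then obtain g where g: "g \<in> mod_hom R T Q"
    and gp: "\<And>x y. x \<in> carrier M \<Longrightarrow> y \<in> carrier (quot_ring_mod R I) \<Longrightarrow> g (?p x y) = b x y" by blast
  have g\<theta>: "g (?\<theta> K) = K" if K: "K \<in> carrier Q" for K
  proof -
    obtain x where x: "x \<in> carrier M" "K = ?N +>\<^bsub>M\<^esub> x" using rep[OF K] by blast
    show ?thesis using x \<theta>[OF x(1)] gp[OF x(1) one] br[OF x(1) M.R.one_closed] by (simp add: f_def)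
  qed
  have \<theta>g: "?\<theta> (g u) = u" if u: "u \<in> carrier T" for u
  proof -
    have "(\<lambda>u. ?\<theta> (g u)) u = (\<lambda>u. u) u"
    proof (rule tensor_hom_eqI[OF assms(1) RI(1) Tm])
      show "(\<lambda>u. ?\<theta> (g u)) \<in> mod_hom R (tensor R M (quot_ring_mod R I)) T"
        using mod_homD[OF g] mod_homD[OF \<theta>hom] unfolding T_def by (simp add: mod_hom_def Pi_def)
      show "(\<lambda>u. u) \<in> mod_hom R (tensor R M (quot_ring_mod R I)) T"
        unfolding T_def by (simp add: mod_hom_def)
      show "u \<in> carrier (tensor R M (quot_ring_mod R I))" using u unfolding T_def .
      fix x y assume x: "x \<in> carrier M" and y: "y \<in> carrier (quot_ring_mod R I)"
      then obtain r where r: "r \<in> carrier R" "y = I +>\<^bsub>R\<^esub> r" using repR by blast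
      have "?\<theta> (g (?p x y)) = ?p (r \<odot>\<^bsub>M\<^esub> x) ?o"
        using x y r gp br \<theta> by (simp add: f_def)
      also have "\<dots> = ?p x (r \<odot>\<^bsub>quot_ring_mod R I\<^esub> ?o)"
        using p(4)[OF r(1) x one] p(5)[OF r(1) x one] by simp
      also have "r \<odot>\<^bsub>quot_ring_mod R I\<^esub> ?o = y"
        using q(3)[OF r(1) M.R.one_closed] r by simp
      finally show "?\<theta> (g (?p x y)) = ?p x y" .
    qed
    thus ?thesis .
  qed
  show "bij_betw ?\<theta> (carrier Q) (carrier T)"
    by (rule bij_betwI[where g = g]) (use g\<theta> \<theta>g mod_homD(1)[OF g] mod_homD(1)[OF \<theta>hom] in auto)
qed

end

theory Submission
  imports Defs
begin

text \<open>
  Let \<open>K = \<mm> J\<close> and let the class of \<open>v = \<phi>\<^sub>t x\<close> modulo \<open>I\<close> be a socle element. For \<open>a \<in> \<mm>\<close> the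
  class of \<open>a x\<close> is then a cycle of \<open>F \<otimes> R/I\<close>, so each \<open>c \<in> J\<close> turns it into a boundary:
  \<open>c a x\<close> lies in \<open>\<phi>\<^sub>t\<^sub>+\<^sub>1 F\<^sub>t\<^sub>+\<^sub>1 + I F\<^sub>t\<close>. Applying \<open>\<phi>\<^sub>t\<close> kills the first summand, and the hypothesis on
  the image of \<open>\<phi>\<^sub>t\<close> puts \<open>c a v\<close> into \<open>I E F\<^sub>t\<^sub>-\<^sub>1\<close>, where \<open>E\<close> is the ideal generated by the
  integral closure of \<open>K\<close>. Hence every coordinate \<open>r\<close> of \<open>v\<close> satisfies \<open>K r \<subseteq> I E\<close>. The heart of the proof
  is the cancellation law \<open>integral_closure_cancel\<close>, which says that such an \<open>r\<close> is integral over
  \<open>I\<close>. As \<open>I\<close> is integrally closed, \<open>v \<in> I F\<^sub>t\<^sub>-\<^sub>1\<close>, and so the class of \<open>v\<close> is zero.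
  For \<open>I = R\<close> this is trivial; otherwise \<open>I \<subseteq> \<mm>\<close>, and \<open>I \<subseteq> J\<close> because \<open>I\<close> annihilates \<open>R/I\<close>.

  The cancellation law rests on three ideas. First, elements integral over \<open>K\<close> can be absorbed:
  there is an ideal \<open>N\<close> with \<open>E N \<subseteq> K N\<close> which lies in no prime ideal not containing \<open>K\<close>
  (\<open>integral_closure_ideal_multiplier\<close>). Then \<open>r (K N) \<subseteq> I E N \<subseteq> I (K N)\<close>. Second, the determinant
  trick (\<open>determinant_trick\<close>) produces from this a polynomial expression
  \<open>p = r\<^sup>n + a\<^sub>1 r\<^sup>n\<^sup>-\<^sup>1 + \<dots> + a\<^sub>n\<close> with \<open>a\<^sub>i \<in> I\<^sup>i\<close> that annihilates \<open>K N\<close>. Third, \<open>p\<close> is nilpotent: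
  otherwise some minimal prime ideal \<open>Q\<close> avoids \<open>p\<close> (\<open>minimal_prime_avoiding\<close>); since \<open>p K N = 0\<close>, it
  contains \<open>K\<close>, hence \<open>I\<close>, because \<open>K\<close> contains \<open>I\<^sup>2\<close>; but an ideal of positive height lies
  in no minimal prime. A power of \<open>p\<close> that vanishes is again
  such a polynomial expression, that is, an equation of integral dependence for \<open>r\<close>.

  Integral dependence is used throughout in a form without coefficients: \<open>x\<close> is integral over \<open>A\<close> if and
  only if \<open>x\<^sup>n\<^sup>+\<^sup>1 \<in> A (A + (x))\<^sup>n\<close> for some \<open>n\<close> (\<open>integral_closure_iff\<close>).
\<close>

section \<open>Arithmetic of ideals\<close>

context cring
begin

abbreviation ideal_pow :: "'a set \<Rightarrow> nat \<Rightarrow> 'a set" (infixr "\<up>" 85) where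
  "A \<up> n \<equiv> A [^]\<^bsub>ideals_set R\<^esub> n"

lemma ideals_set_sel [simp]:
  "carrier (ideals_set R) = {A. ideal A R}" "monoid.mult (ideals_set R) = ideal_prod R"
  "one (ideals_set R) = carrier R"
  by (simp_all add: ideals_set_def)

lemma ideal_pow_ideal: "ideal A R \<Longrightarrow> ideal (A \<up> n) R"
  using monoid.nat_pow_closed[OF comm_monoid.axioms(1)[OF ideals_set_is_comm_monoid], of A n]
  by (simp add: ideals_set_sel)

lemma ideal_pow_0: "A \<up> 0 = carrier R"
  using monoid.nat_pow_0[OF comm_monoid.axioms(1)[OF ideals_set_is_comm_monoid], of A]
  by (simp add: ideals_set_sel)

lemma ideal_pow_Suc: "A \<up> Suc n = (A \<up> n) \<cdot> A"
  using monoid.nat_pow_Suc[OF comm_monoid.axioms(1)[OF ideals_set_is_comm_monoid], of A n]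
  by (simp add: ideals_set_sel)

lemma ideal_pow_add: "ideal A R \<Longrightarrow> (A \<up> m) \<cdot> (A \<up> n) = A \<up> (m + n)"
  using monoid.nat_pow_mult[OF comm_monoid.axioms(1)[OF ideals_set_is_comm_monoid], of A m n]
  by (simp add: ideals_set_sel)

lemma ideal_prod_lcomm:
  "ideal A R \<Longrightarrow> ideal B R \<Longrightarrow> ideal C R \<Longrightarrow> A \<cdot> (B \<cdot> C) = B \<cdot> (A \<cdot> C)"
  by (metis ideal_prod_assoc ideal_prod_commute)

lemma ideal_prod_mono: "A \<subseteq> A' \<Longrightarrow> B \<subseteq> B' \<Longrightarrow> A \<cdot> B \<subseteq> A' \<cdot> B'"
proof
  fix z assume *: "A \<subseteq> A'" "B \<subseteq> B'" "z \<in> A \<cdot> B"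
  from this(3) show "z \<in> A' \<cdot> B'"
    by (induct rule: ideal_prod.induct) (use * in \<open>auto intro: ideal_prod.intros\<close>)
qed

lemma ideal_pow_mono: "A \<subseteq> B \<Longrightarrow> A \<up> n \<subseteq> B \<up> n"
  by (induct n) (simp_all add: ideal_pow_0 ideal_pow_Suc ideal_prod_mono)

lemma ideal_prod_least:
  assumes "ideal C R" "\<And>a b. a \<in> A \<Longrightarrow> b \<in> B \<Longrightarrow> a \<otimes> b \<in> C"
  shows "A \<cdot> B \<subseteq> C"
proof
  fix z assume "z \<in> A \<cdot> B"
  thus "z \<in> C"
    by (induct rule: ideal_prod.induct)
      (use assms in \<open>auto intro: additive_subgroup.a_closed[OF ideal.axioms(1)]\<close>)
qed

lemma elem_pow_in_ideal_pow: "ideal A R \<Longrightarrow> x \<in> A \<Longrightarrow> x [^] n \<in> A \<up> n"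
  by (induct n) (auto simp: ideal_pow_0 ideal_pow_Suc intro: ideal_prod.intros)

lemma ideal_minus_closed: "ideal A R \<Longrightarrow> x \<in> A \<Longrightarrow> \<ominus> x \<in> A"
  by (simp add: additive_subgroup.a_inv_closed ideal.axioms(1))

lemmas ideal_add_closed = additive_subgroup.a_closed[OF ideal.axioms(1)]
lemmas ideal_zero_closed = additive_subgroup.zero_closed[OF ideal.axioms(1)]

lemma colon_ideal:
  assumes "ideal A R" "ideal B R"
  shows "ideal {x \<in> carrier R. \<forall>b\<in>B. x \<otimes> b \<in> A} R"
proof (rule idealI)
  show "subgroup {x \<in> carrier R. \<forall>b\<in>B. x \<otimes> b \<in> A} (add_monoid R)"
    using assms ideal.Icarr[OF assms(2)]
    by (intro subgroup.intro)
      (auto simp: l_distr l_minus ideal_zero_closed ideal_minus_closed intro: ideal_add_closed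
        simp flip: a_inv_def)
next
  fix x r assume x: "x \<in> {x \<in> carrier R. \<forall>b\<in>B. x \<otimes> b \<in> A}" and r: "r \<in> carrier R"
  have "(r \<otimes> x) \<otimes> b \<in> A" if "b \<in> B" for b
    using x r that ideal.Icarr[OF assms(2) that] ideal.I_l_closed[OF assms(1)]
    by (simp add: m_assoc)
  thus "r \<otimes> x \<in> {x \<in> carrier R. \<forall>b\<in>B. x \<otimes> b \<in> A}"
    "x \<otimes> r \<in> {x \<in> carrier R. \<forall>b\<in>B. x \<otimes> b \<in> A}"
    using x r by (auto simp: m_comm[of x r])
qed (rule ring_axioms)

lemma sum_ideal_superset:
  assumes "ideal A R" "ideal B R"
  shows "A \<subseteq> A <+>\<^bsub>R\<^esub> B" "B \<subseteq> A <+>\<^bsub>R\<^esub> B"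
proof -
  have "a \<in> A <+>\<^bsub>R\<^esub> B" if "a \<in> A" for a
    using that ideal_zero_closed[OF assms(2)] ideal.Icarr[OF assms(1) that]
    by (force simp: set_add_def')
  moreover have "b \<in> A <+>\<^bsub>R\<^esub> B" if "b \<in> B" for b
    using that ideal_zero_closed[OF assms(1)] ideal.Icarr[OF assms(2) that]
    by (force simp: set_add_def')
  ultimately show "A \<subseteq> A <+>\<^bsub>R\<^esub> B" "B \<subseteq> A <+>\<^bsub>R\<^esub> B" by blast+
qed

lemma ideal_prod_cgenideal:
  assumes "ideal B R" "k \<in> carrier R" "z \<in> B \<cdot> (PIdl k)"
  shows "\<exists>b\<in>B. z = b \<otimes> k"
  using assms(3)
proof (induct rule: ideal_prod.induct)
  case (prod b j)
  then obtain r where r: "r \<in> carrier R" "j = r \<otimes> k" by (auto simp: cgenideal_def)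
  hence "b \<otimes> j = (b \<otimes> r) \<otimes> k"
    using assms(2) ideal.Icarr[OF assms(1) prod(1)] by (simp add: m_assoc)
  thus ?case using ideal.I_r_closed[OF assms(1) prod(1) r(1)] by blast
next
  case (sum z1 z2)
  then obtain b1 b2 where "b1 \<in> B" "b2 \<in> B" "z1 = b1 \<otimes> k" "z2 = b2 \<otimes> k" by blast
  thus ?case using assms(2) ideal.Icarr[OF assms(1)]
    by (intro bexI[of _ "b1 \<oplus> b2"]) (auto simp: l_distr intro: ideal_add_closed[OF assms(1)])
qed

text \<open>One generator can be split off an ideal. This is the step by which the elimination in
  \<open>monic_annihilator\<close> isolates a single unknown of a linear system.\<close>

lemma ideal_prod_genideal_insert:
  assumes "ideal B R" "k \<in> carrier R" "A \<subseteq> carrier R" "z \<in> B \<cdot> (Idl (insert k A))"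
  shows "\<exists>y\<in>B \<cdot> (Idl A). \<exists>b\<in>B. z = y \<oplus> b \<otimes> k"
proof -
  have k: "ideal (PIdl k) R" by (rule cgenideal_ideal) fact
  have A: "ideal (Idl A) R" by (rule genideal_ideal) fact
  have "insert k A \<subseteq> Idl A <+>\<^bsub>R\<^esub> PIdl k"
    using sum_ideal_superset[OF A k] genideal_self[OF assms(3)] cgenideal_self[OF assms(2)] by blast
  hence "Idl (insert k A) \<subseteq> Idl A <+>\<^bsub>R\<^esub> PIdl k"
    by (rule genideal_minimal[OF add_ideals[OF A k]])
  hence "z \<in> B \<cdot> (Idl A) <+>\<^bsub>R\<^esub> B \<cdot> (PIdl k)"
    using assms(4) ideal_prod_mono[OF subset_refl, of "Idl (insert k A)" "Idl A <+>\<^bsub>R\<^esub> PIdl k" B]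
    by (simp add: ideal_prod_distr(1)[OF assms(1) A k, symmetric]) blast
  then obtain y u where "y \<in> B \<cdot> (Idl A)" "u \<in> B \<cdot> (PIdl k)" "z = y \<oplus> u"
    by (auto simp: set_add_def')
  thus ?thesis using ideal_prod_cgenideal[OF assms(1,2)] by blast
qed

end

section \<open>Integral dependence without explicit coefficients\<close>

text \<open>The sums \<open>a\<^sub>1 x\<^sup>n\<^sup>-\<^sup>1 + a\<^sub>2 x\<^sup>n\<^sup>-\<^sup>2 + \<dots> + a\<^sub>n\<close> with \<open>a\<^sub>i \<in> A\<^sup>i\<close>, which are the lower terms of an equation of
  integral dependence of degree \<open>n\<close>. The recursion is Horner's scheme, so that closure properties can be
  proved by induction without handling families of coefficients.\<close>

primrec lower_forms :: "('a, 'r) ring_scheme \<Rightarrow> 'a set \<Rightarrow> 'a \<Rightarrow> nat \<Rightarrow> 'a set" where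
  "lower_forms R A x 0 = {\<zero>\<^bsub>R\<^esub>}"
| "lower_forms R A x (Suc n) =
     {b \<oplus>\<^bsub>R\<^esub> x \<otimes>\<^bsub>R\<^esub> s |b s. b \<in> A [^]\<^bsub>ideals_set R\<^esub> Suc n \<and> s \<in> lower_forms R A x n}"

context cring
begin

lemma finsum_Horner:
  assumes "\<And>i. i \<in> {1..Suc n} \<Longrightarrow> a i \<in> carrier R" "x \<in> carrier R"
  shows "(\<Oplus>i\<in>{1..Suc n}. a i \<otimes> x [^] (Suc n - i))
       = a (Suc n) \<oplus> x \<otimes> (\<Oplus>i\<in>{1..n}. a i \<otimes> x [^] (n - i))"
proof -
  have "(\<Oplus>i\<in>{1..n}. a i \<otimes> x [^] (Suc n - i)) = (\<Oplus>i\<in>{1..n}. x \<otimes> (a i \<otimes> x [^] (n - i)))"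
    using assms by (intro finsum_cong') (auto simp: Suc_diff_le m_ac)
  also have "\<dots> = x \<otimes> (\<Oplus>i\<in>{1..n}. a i \<otimes> x [^] (n - i))"
    using assms by (intro finsum_rdistr[symmetric]) auto
  moreover have "{1..Suc n} = insert (Suc n) {1..n}" by auto
  ultimately show ?thesis
    using assms by (simp add: finsum_insert Pi_def)
qed

lemma lower_forms_iff:
  assumes "ideal A R" "x \<in> carrier R"
  shows "s \<in> lower_forms R A x n \<longleftrightarrow>
    (\<exists>a. (\<forall>i\<in>{1..n}. a i \<in> A \<up> i) \<and> s = (\<Oplus>i\<in>{1..n}. a i \<otimes> x [^] (n - i)))"
proof (induct n arbitrary: s)
  case (Suc n)
  have carr: "a i \<in> carrier R" if "a i \<in> A \<up> i" for a :: "nat \<Rightarrow> 'a" and i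
    using ideal.Icarr[OF ideal_pow_ideal[OF assms(1)] that] .
  show ?case
  proof
    assume "s \<in> lower_forms R A x (Suc n)"
    then obtain b a where b: "b \<in> A \<up> Suc n" and a: "\<forall>i\<in>{1..n}. a i \<in> A \<up> i"
      and s: "s = b \<oplus> x \<otimes> (\<Oplus>i\<in>{1..n}. a i \<otimes> x [^] (n - i))"
      using Suc by auto
    define a' where "a' = a(Suc n := b)"
    have a': "\<forall>i\<in>{1..Suc n}. a' i \<in> A \<up> i" using a b by (auto simp: a'_def le_Suc_eq)
    have "(\<Oplus>i\<in>{1..n}. a' i \<otimes> x [^] (n - i)) = (\<Oplus>i\<in>{1..n}. a i \<otimes> x [^] (n - i))"
      using a carr assms(2) by (intro finsum_cong') (auto simp: a'_def)
    hence "s = (\<Oplus>i\<in>{1..Suc n}. a' i \<otimes> x [^] (Suc n - i))"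
      using finsum_Horner[of n a' x] a' carr assms(2) by (simp only: s) (simp add: a'_def)
    thus "\<exists>a. (\<forall>i\<in>{1..Suc n}. a i \<in> A \<up> i) \<and> s = (\<Oplus>i\<in>{1..Suc n}. a i \<otimes> x [^] (Suc n - i))"
      using a' by blast
  next
    assume "\<exists>a. (\<forall>i\<in>{1..Suc n}. a i \<in> A \<up> i) \<and> s = (\<Oplus>i\<in>{1..Suc n}. a i \<otimes> x [^] (Suc n - i))"
    then obtain a where a: "\<forall>i\<in>{1..Suc n}. a i \<in> A \<up> i"
      and s: "s = (\<Oplus>i\<in>{1..Suc n}. a i \<otimes> x [^] (Suc n - i))" by blast
    have "(\<Oplus>i\<in>{1..n}. a i \<otimes> x [^] (n - i)) \<in> lower_forms R A x n"
      using a by (subst Suc, intro exI[of _ a]) auto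
    moreover have "s = a (Suc n) \<oplus> x \<otimes> (\<Oplus>i\<in>{1..n}. a i \<otimes> x [^] (n - i))"
      unfolding s using a carr assms(2) by (intro finsum_Horner) auto
    moreover have "a (Suc n) \<in> A \<up> Suc n" using bspec[OF a, of "Suc n"] by simp
    ultimately show "s \<in> lower_forms R A x (Suc n)" unfolding lower_forms.simps by blast
  qed
qed simp

context
  fixes A x
  assumes A: "ideal A R" and x: "x \<in> carrier R"
begin

abbreviation (input) W where "W \<equiv> A <+>\<^bsub>R\<^esub> PIdl x"

lemma adjoin_ideal: "ideal W R"
  by (intro add_ideals A cgenideal_ideal x)

lemma adjoin_superset: "A \<subseteq> W" "x \<in> W"
  using sum_ideal_superset[OF A cgenideal_ideal[OF x]] cgenideal_self[OF x] by auto

lemma adjoin_elem: "w \<in> W \<Longrightarrow> \<exists>a\<in>A. \<exists>r\<in>carrier R. w = a \<oplus> r \<otimes> x"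
  by (auto simp: set_add_def' cgenideal_def)

lemma lower_forms_carrier: "s \<in> lower_forms R A x n \<Longrightarrow> s \<in> carrier R"
  using x ideal.Icarr[OF ideal_pow_ideal[OF A, of "Suc _"]]
  by (induct n arbitrary: s) (auto simp del: monoid.nat_pow_Suc)

lemma lower_forms_add:
  "s \<in> lower_forms R A x n \<Longrightarrow> s' \<in> lower_forms R A x n \<Longrightarrow> s \<oplus> s' \<in> lower_forms R A x n"
proof (induct n arbitrary: s s')
  case (Suc n)
  note P = ideal_pow_ideal[OF A, of "Suc n"]
  obtain b t b' t' where *: "b \<in> A \<up> Suc n" "b' \<in> A \<up> Suc n" "t \<in> lower_forms R A x n"
    "t' \<in> lower_forms R A x n" "s = b \<oplus> x \<otimes> t" "s' = b' \<oplus> x \<otimes> t'"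
    using Suc.prems by auto
  note c = lower_forms_carrier[OF *(3)] lower_forms_carrier[OF *(4)]
    ideal.Icarr[OF P *(1)] ideal.Icarr[OF P *(2)]
  have "s \<oplus> s' = (b \<oplus> b') \<oplus> x \<otimes> (t \<oplus> t')"
    using c x *(5,6) by (simp add: r_distr a_ac)
  thus ?case using Suc.hyps[OF *(3,4)] ideal_add_closed[OF P *(1,2)]
    unfolding lower_forms.simps by blast
qed simp

lemma lower_forms_shift: "s \<in> lower_forms R A x n \<Longrightarrow> x \<otimes> s \<in> lower_forms R A x (Suc n)"
  using ideal_zero_closed[OF ideal_pow_ideal[OF A, of "Suc n"]] x lower_forms_carrier[of s n]
  unfolding lower_forms.simps by (force simp del: monoid.nat_pow_Suc)

lemma lower_forms_scale: "s \<in> lower_forms R A x n \<Longrightarrow> r \<in> carrier R \<Longrightarrow> r \<otimes> s \<in> lower_forms R A x n"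
proof (induct n arbitrary: s)
  case (Suc n)
  note P = ideal_pow_ideal[OF A, of "Suc n"]
  obtain b t where *: "b \<in> A \<up> Suc n" "t \<in> lower_forms R A x n" "s = b \<oplus> x \<otimes> t"
    using Suc.prems by auto
  note c = lower_forms_carrier[OF *(2)] ideal.Icarr[OF P *(1)]
  have "r \<otimes> s = (r \<otimes> b) \<oplus> x \<otimes> (r \<otimes> t)"
    using c x *(3) Suc.prems(2) by (simp add: r_distr m_ac)
  thus ?case using Suc.hyps[OF *(2) Suc.prems(2)] ideal.I_l_closed[OF P *(1) Suc.prems(2)]
    unfolding lower_forms.simps by blast
qed simp

lemma lower_forms_mult_ideal:
  "s \<in> lower_forms R A x n \<Longrightarrow> a \<in> A \<Longrightarrow> s \<otimes> a \<in> lower_forms R A x (Suc n)"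
proof (induct n arbitrary: s)
  case 0
  have "a \<in> carrier R" using 0(2) by (rule ideal.Icarr[OF A])
  thus ?case using ideal_zero_closed[OF A] 0 x
    by (auto simp: ideal_prod_commute[OF oneideal A] ideal_prod_one[OF A] intro!: exI[of _ "\<zero>"])
next
  case (Suc n)
  note P = ideal_pow_ideal[OF A, of "Suc n"]
  obtain b t where *: "b \<in> A \<up> Suc n" "t \<in> lower_forms R A x n" "s = b \<oplus> x \<otimes> t"
    using Suc.prems by auto
  note c = lower_forms_carrier[OF *(2)] ideal.Icarr[OF P *(1)] ideal.Icarr[OF A Suc.prems(2)]
  have "s \<otimes> a = (b \<otimes> a) \<oplus> x \<otimes> (t \<otimes> a)"
    using c x *(3) by (simp add: l_distr m_assoc)
  moreover have "b \<otimes> a \<in> A \<up> Suc (Suc n)"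
    using *(1) Suc.prems(2) unfolding ideal_pow_Suc[of A "Suc n"] by (rule ideal_prod.prod)
  ultimately show ?case using Suc.hyps[OF *(2) Suc.prems(2)]
    unfolding lower_forms.simps(2)[of R A x "Suc n"] by blast
qed

text \<open>Multiplying a lower form of degree \<open>n\<close> by \<open>a + r x\<close> with \<open>a \<in> A\<close> gives a lower form of degree
  \<open>n + 1\<close>: the part with \<open>a\<close> raises the power of \<open>A\<close> in each coefficient, the part with \<open>x\<close> raises the power of \<open>x\<close>.\<close>

lemma prod_pow_subset_lower_forms: "A \<cdot> (W \<up> n) \<subseteq> lower_forms R A x (Suc n)"
proof (induct n)
  case 0
  show ?case using x
    by (force simp: ideal_prod_commute[OF oneideal A] ideal_prod_one[OF A] dest: ideal.Icarr[OF A])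
next
  case (Suc n)
  have "A \<cdot> (W \<up> Suc n) = (A \<cdot> (W \<up> n)) \<cdot> W"
    unfolding ideal_pow_Suc by (intro ideal_prod_assoc[symmetric] A adjoin_ideal ideal_pow_ideal)
  moreover have "z \<in> lower_forms R A x (Suc (Suc n))" if "z \<in> (A \<cdot> (W \<up> n)) \<cdot> W" for z
    using that
  proof (induct rule: ideal_prod.induct)
    case (prod s w)
    obtain a r where w: "a \<in> A" "r \<in> carrier R" "w = a \<oplus> r \<otimes> x" using adjoin_elem[OF prod(2)] by blast
    have s: "s \<in> lower_forms R A x (Suc n)" using prod(1) Suc by blast
    have "s \<otimes> w = s \<otimes> a \<oplus> x \<otimes> (r \<otimes> s)"
      using w lower_forms_carrier[OF s] x ideal.Icarr[OF A w(1)] by (simp add: r_distr m_ac)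
    thus ?case
      using lower_forms_add[OF lower_forms_mult_ideal[OF s w(1)]
          lower_forms_shift[OF lower_forms_scale[OF s w(2)]]] by (simp del: lower_forms.simps)
  qed (rule lower_forms_add)
  ultimately show ?case by blast
qed

lemma lower_forms_subset_prod_pow: "lower_forms R A x (Suc n) \<subseteq> A \<cdot> (W \<up> n)"
proof (induct n)
  case 0
  show ?case using x
    by (auto simp: ideal_prod_commute[OF oneideal A] ideal_prod_one[OF A] simp: ideal.Icarr[OF A])
next
  case (Suc n)
  note P = ideal_prod_is_ideal[OF A ideal_pow_ideal[OF adjoin_ideal, of "Suc n"]]
  show ?case
  proof
    fix z assume "z \<in> lower_forms R A x (Suc (Suc n))"
    then obtain b s where *: "b \<in> A \<up> Suc (Suc n)" "s \<in> lower_forms R A x (Suc n)" "z = b \<oplus> x \<otimes> s"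
      unfolding lower_forms.simps(2)[of R A x "Suc n"] by blast
    have "A \<up> Suc (Suc n) = A \<cdot> (A \<up> Suc n)"
      unfolding ideal_pow_Suc[of A "Suc n"]
      by (intro ideal_prod_commute ideal_pow_ideal A)
    hence b: "b \<in> A \<cdot> (W \<up> Suc n)"
      using *(1) ideal_prod_mono[OF subset_refl ideal_pow_mono[OF adjoin_superset(1), of "Suc n"], of A] by blast
    have "s \<otimes> x \<in> (A \<cdot> (W \<up> n)) \<cdot> W"
      using *(2) Suc adjoin_superset(2) by (intro ideal_prod.prod) auto
    hence "x \<otimes> s \<in> A \<cdot> (W \<up> Suc n)"
      using x lower_forms_carrier[OF *(2)]
      by (simp add: m_comm[of s x] ideal_prod_assoc[OF A ideal_pow_ideal[OF adjoin_ideal] adjoin_ideal])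
    thus "z \<in> A \<cdot> (W \<up> Suc n)" unfolding *(3) by (rule ideal_add_closed[OF P b])
  qed
qed

text \<open>By the two inclusions above, the lower forms of degree \<open>n + 1\<close> are exactly the elements of the ideal
  \<open>A (A + (x))\<^sup>n\<close>; an equation of integral dependence says that \<open>x\<^sup>n\<^sup>+\<^sup>1\<close> is minus such an element.\<close>

lemma integral_closure_iff:
  "x \<in> integral_closure R A \<longleftrightarrow> (\<exists>n. x [^] Suc n \<in> A \<cdot> (W \<up> n))"
proof -
  have "x \<in> integral_closure R A \<longleftrightarrow> (\<exists>n\<ge>1. \<exists>s\<in>lower_forms R A x n. x [^] n \<oplus> s = \<zero>)"
    unfolding integral_closure_def Bex_def lower_forms_iff[OF A x] mem_Collect_eq
    by (intro iffI conjI x; elim conjE exE; blast)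
  also have "\<dots> \<longleftrightarrow> (\<exists>n. \<exists>s\<in>lower_forms R A x (Suc n). x [^] Suc n \<oplus> s = \<zero>)"
    by (metis One_nat_def Suc_le_D le_add1 plus_1_eq_Suc)
  also have "\<dots> \<longleftrightarrow> (\<exists>n. x [^] Suc n \<in> A \<cdot> (W \<up> n))"
  proof (intro ex_cong1)
    fix n
    note P = ideal_prod_is_ideal[OF A ideal_pow_ideal[OF adjoin_ideal, of n]]
    have eq: "lower_forms R A x (Suc n) = A \<cdot> (W \<up> n)"
      using lower_forms_subset_prod_pow prod_pow_subset_lower_forms by blast
    have "x [^] Suc n \<oplus> s = \<zero> \<longleftrightarrow> x [^] Suc n = \<ominus> s" if "s \<in> carrier R" for s
      using that x by (metis minus_equality nat_pow_closed l_neg)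
    thus "(\<exists>s\<in>lower_forms R A x (Suc n). x [^] Suc n \<oplus> s = \<zero>) \<longleftrightarrow> x [^] Suc n \<in> A \<cdot> (W \<up> n)"
      unfolding eq using ideal.Icarr[OF P] ideal_minus_closed[OF P] x
      by (metis minus_minus nat_pow_closed)
  qed
  finally show ?thesis .
qed

end

end

section \<open>Absorbing integral elements into an ideal\<close>

context cring
begin

lemma prime_contains_prod:
  assumes "primeideal Q R" "ideal A R" "ideal B R" "A \<cdot> B \<subseteq> Q"
  shows "A \<subseteq> Q \<or> B \<subseteq> Q"
proof (rule ccontr)
  assume "\<not> (A \<subseteq> Q \<or> B \<subseteq> Q)"
  then obtain a b where "a \<in> A" "b \<in> B" "a \<notin> Q" "b \<notin> Q" by blast
  thus False
    using primeideal.I_prime[OF assms(1)] ideal.Icarr[OF assms(2)] ideal.Icarr[OF assms(3)]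
      subsetD[OF assms(4) ideal_prod.prod] by blast
qed

lemma prime_contains_pow:
  assumes "primeideal Q R" "ideal A R" "A \<up> n \<subseteq> Q"
  shows "A \<subseteq> Q"
  using assms(3)
proof (induct n)
  case 0
  thus ?case using ideal.Icarr[OF assms(2)] by (auto simp: ideal_pow_0)
next
  case (Suc n)
  thus ?case
    using prime_contains_prod[OF assms(1) ideal_pow_ideal[OF assms(2)] assms(2)]
    by (auto simp: ideal_pow_Suc)
qed

text \<open>The witness is \<open>N = W\<^sup>n\<close> for \<open>W = K + (x)\<close> and \<open>x\<^sup>n\<^sup>+\<^sup>1 \<in> K W\<^sup>n\<close>. Expanding products shows that
  \<open>W\<^sup>m\<^sup>+\<^sup>1 \<subseteq> (x\<^sup>m\<^sup>+\<^sup>1) + K W\<^sup>m\<close> for every \<open>m\<close>; for \<open>m = n\<close> the right-hand side is \<open>K W\<^sup>n\<close>, so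
  \<open>x W\<^sup>n \<subseteq> W\<^sup>n\<^sup>+\<^sup>1 \<subseteq> K W\<^sup>n\<close>.\<close>

lemma integral_closure_multiplier:
  assumes K: "ideal K R" and x: "x \<in> integral_closure R K"
  shows "\<exists>N. ideal N R \<and> (\<forall>u\<in>N. x \<otimes> u \<in> K \<cdot> N) \<and> (\<forall>Q. primeideal Q R \<longrightarrow> N \<subseteq> Q \<longrightarrow> K \<subseteq> Q)"
proof -
  have xc: "x \<in> carrier R" using x by (auto simp: integral_closure_def)
  define W where "W = K <+>\<^bsub>R\<^esub> PIdl x"
  have W: "ideal W R" unfolding W_def by (rule adjoin_ideal[OF K xc])
  have KW: "K \<subseteq> W" and xW: "x \<in> W" unfolding W_def using adjoin_superset[OF K xc] by blast+
  obtain n where n: "x [^] Suc n \<in> K \<cdot> (W \<up> n)"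
    using x integral_closure_iff[OF K xc] unfolding W_def by blast
  have P: "ideal (K \<cdot> (W \<up> m)) R" for m
    by (intro ideal_prod_is_ideal K ideal_pow_ideal W)
  \<comment> \<open>only the leading term \<open>x\<^sup>m\<^sup>+\<^sup>1\<close> of an element of \<open>W\<^sup>m\<^sup>+\<^sup>1\<close> can escape \<open>K W\<^sup>m\<close>\<close>
  have dec: "\<exists>r\<in>carrier R. \<exists>z\<in>K \<cdot> (W \<up> m). u = r \<otimes> x [^] Suc m \<oplus> z" if "u \<in> W \<up> Suc m" for m u
    using that
  proof (induct m arbitrary: u)
    case 0
    hence "u \<in> W" using W by (simp add: ideal_prod_commute[OF oneideal] ideal_prod_one)
    then obtain a r where "a \<in> K" "r \<in> carrier R" "u = a \<oplus> r \<otimes> x"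
      using adjoin_elem[OF K xc] unfolding W_def by blast
    thus ?case using ideal.Icarr[OF K] xc
      by (auto simp: ideal_prod_one[OF K] a_comm)
  next
    case (Suc m)
    from Suc.prems have "u \<in> (W \<up> Suc m) \<cdot> W" by (simp only: ideal_pow_Suc[of W "Suc m"])
    thus ?case
    proof (induct rule: ideal_prod.induct)
      case (prod u w)
      obtain r z where u: "r \<in> carrier R" "z \<in> K \<cdot> (W \<up> m)" "u = r \<otimes> x [^] Suc m \<oplus> z"
        using Suc.hyps[OF prod(1)] by blast
      obtain a t where w: "a \<in> K" "t \<in> carrier R" "w = a \<oplus> t \<otimes> x"
        using adjoin_elem[OF K xc] prod(2) unfolding W_def by blast
      have uc: "u \<in> carrier R" by (rule ideal.Icarr[OF ideal_pow_ideal[OF W] prod(1)])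
      have ac: "a \<in> carrier R" by (rule ideal.Icarr[OF K w(1)])
      have zc: "z \<in> carrier R" by (rule ideal.Icarr[OF P u(2)])
      have "a \<otimes> u \<in> K \<cdot> (W \<up> Suc m)" using w(1) prod(1) by (rule ideal_prod.prod)
      moreover have "z \<otimes> x \<in> K \<cdot> (W \<up> Suc m)"
        unfolding ideal_pow_Suc ideal_prod_assoc[OF K ideal_pow_ideal[OF W] W, symmetric]
        using u(2) xW by (rule ideal_prod.prod)
      hence "t \<otimes> (z \<otimes> x) \<in> K \<cdot> (W \<up> Suc m)" by (rule ideal.I_l_closed[OF P _ w(2)])
      ultimately have "a \<otimes> u \<oplus> t \<otimes> (z \<otimes> x) \<in> K \<cdot> (W \<up> Suc m)"
        by (rule ideal_add_closed[OF P])
      moreover have "u \<otimes> w = (r \<otimes> t) \<otimes> x [^] Suc (Suc m) \<oplus> (a \<otimes> u \<oplus> t \<otimes> (z \<otimes> x))"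
      proof -
        have "u \<otimes> w = a \<otimes> u \<oplus> (t \<otimes> x) \<otimes> u"
          unfolding w(3) using uc ac w(2) xc by (simp add: r_distr m_comm)
        also have "(t \<otimes> x) \<otimes> u = (r \<otimes> t) \<otimes> x [^] Suc (Suc m) \<oplus> t \<otimes> (z \<otimes> x)"
          unfolding u(3) using u(1) w(2) xc zc by (simp add: r_distr m_ac)
        finally show ?thesis using uc ac u(1) w(2) xc zc by (simp add: a_ac)
      qed
      ultimately show ?case using u(1) w(2) by blast
    next
      case (sum u1 u2)
      then obtain r1 z1 r2 z2 where *: "r1 \<in> carrier R" "z1 \<in> K \<cdot> (W \<up> Suc m)"
        "u1 = r1 \<otimes> x [^] Suc (Suc m) \<oplus> z1" "r2 \<in> carrier R" "z2 \<in> K \<cdot> (W \<up> Suc m)"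
        "u2 = r2 \<otimes> x [^] Suc (Suc m) \<oplus> z2" by blast
      define y where "y = x [^] Suc (Suc m)"
      have "y \<in> carrier R" using xc unfolding y_def by (rule nat_pow_closed)
      hence "u1 \<oplus> u2 = (r1 \<oplus> r2) \<otimes> y \<oplus> (z1 \<oplus> z2)"
        using *(1,4) ideal.Icarr[OF P *(2)] ideal.Icarr[OF P *(5)]
        unfolding *(3,6) y_def[symmetric] by (simp add: l_distr a_ac)
      thus ?case unfolding y_def using ideal_add_closed[OF P *(2,5)] *(1,4) by blast
    qed
  qed
  have "x \<otimes> u \<in> K \<cdot> (W \<up> n)" if u: "u \<in> W \<up> n" for u
  proof -
    have "u \<otimes> x \<in> W \<up> Suc n" unfolding ideal_pow_Suc using u xW by (rule ideal_prod.prod)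
    then obtain r z where "r \<in> carrier R" "z \<in> K \<cdot> (W \<up> n)" "u \<otimes> x = r \<otimes> x [^] Suc n \<oplus> z"
      using dec by blast
    hence "u \<otimes> x \<in> K \<cdot> (W \<up> n)"
      using ideal_add_closed[OF P ideal.I_l_closed[OF P n]] by simp
    thus ?thesis using m_comm[OF xc ideal.Icarr[OF ideal_pow_ideal[OF W] u]] by simp
  qed
  moreover have "K \<subseteq> Q" if "primeideal Q R" "W \<up> n \<subseteq> Q" for Q
    using prime_contains_pow[OF that(1) W that(2)] KW by blast
  ultimately show ?thesis using ideal_pow_ideal[OF W] by blast
qed

text \<open>The condition on prime ideals keeps \<open>N\<close> from being too small; \<open>N = 0\<close> would satisfy the rest.
  It is formulated with primes because in this form it passes to products.\<close>

definition multiplier :: "'a set \<Rightarrow> 'a set \<Rightarrow> 'a set \<Rightarrow> bool" where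
  "multiplier K X N \<longleftrightarrow> ideal N R \<and> (\<forall>x\<in>X. \<forall>u\<in>N. x \<otimes> u \<in> K \<cdot> N) \<and>
     (\<forall>Q. primeideal Q R \<longrightarrow> N \<subseteq> Q \<longrightarrow> K \<subseteq> Q)"

lemma multiplier_union:
  assumes K: "ideal K R" and X: "X \<subseteq> carrier R" "Y \<subseteq> carrier R"
    and N: "multiplier K X N" and N': "multiplier K Y N'"
  shows "multiplier K (X \<union> Y) (N \<cdot> N')"
proof -
  have id: "ideal N R" "ideal N' R" using N N' by (auto simp: multiplier_def)
  note NN = ideal_prod_is_ideal[OF id]
  note P = ideal_prod_is_ideal[OF K NN]
  have xc: "x \<in> carrier R" if "x \<in> X \<union> Y" for x using that X by blast
  have xN: "x \<otimes> u \<in> K \<cdot> N" if "x \<in> X" "u \<in> N" for x u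
    using N that by (simp add: multiplier_def)
  have yN': "y \<otimes> u \<in> K \<cdot> N'" if "y \<in> Y" "u \<in> N'" for y u
    using N' that by (simp add: multiplier_def)
  have *: "u \<otimes> x \<in> K \<cdot> (N \<cdot> N')" if "u \<in> N \<cdot> N'" "x \<in> X \<union> Y" for u x
    using that(1)
  proof (induct rule: ideal_prod.induct)
    case (prod a b)
    have c: "a \<in> carrier R" "b \<in> carrier R" "x \<in> carrier R"
      using ideal.Icarr[OF id(1) prod(1)] ideal.Icarr[OF id(2) prod(2)] xc[OF that(2)]
      by simp_all
    show ?case
    proof (cases "x \<in> X")
      case True
      have "(x \<otimes> a) \<otimes> b \<in> (K \<cdot> N) \<cdot> N'"
        by (rule ideal_prod.prod[OF xN[OF True prod(1)] prod(2)])
      thus ?thesis using c by (simp add: ideal_prod_assoc[OF K id] m_ac)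
    next
      case False
      hence "a \<otimes> (x \<otimes> b) \<in> N \<cdot> (K \<cdot> N')"
        using that(2) by (intro ideal_prod.prod[OF prod(1) yN'[OF _ prod(2)]]) simp
      thus ?thesis using c by (simp add: ideal_prod_lcomm[OF id(1) K id(2)] m_ac)
    qed
  next
    case (sum u1 u2)
    thus ?case
      using ideal_add_closed[OF P sum(2,4)] ideal.Icarr[OF NN sum(1)] ideal.Icarr[OF NN sum(3)]
        xc[OF that(2)] by (simp add: l_distr)
  qed
  have "x \<otimes> u \<in> K \<cdot> (N \<cdot> N')" if "x \<in> X \<union> Y" "u \<in> N \<cdot> N'" for x u
    using *[OF that(2,1)] m_comm[OF xc[OF that(1)] ideal.Icarr[OF NN that(2)]] by simp
  moreover have "K \<subseteq> Q" if Q: "primeideal Q R" "N \<cdot> N' \<subseteq> Q" for Q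
    using prime_contains_prod[OF Q(1) id Q(2)] N N' Q(1) by (auto simp: multiplier_def)
  ultimately show ?thesis using NN by (simp add: multiplier_def)
qed

lemma multiplier_finite:
  assumes K: "ideal K R" and "finite X" "X \<subseteq> carrier R" "\<And>x. x \<in> X \<Longrightarrow> \<exists>N. multiplier K {x} N"
  shows "\<exists>N. multiplier K X N"
  using assms(2-)
proof (induct rule: finite_induct)
  case empty
  have "multiplier K {} (carrier R)"
    using oneideal ideal.Icarr[OF K] by (auto simp: multiplier_def)
  thus ?case by blast
next
  case (insert x X)
  then obtain N N' where "multiplier K {x} N" "multiplier K X N'" by (metis insertCI insert_subset)
  thus ?case using multiplier_union[OF K, of "{x}" X] insert.prems(1) by auto
qed

lemma multiplier_genideal:
  assumes K: "ideal K R" and X: "X \<subseteq> carrier R" and N: "multiplier K X N"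
  shows "multiplier K (Idl X) N"
proof -
  have id: "ideal N R" using N by (simp add: multiplier_def)
  have "Idl X \<subseteq> {x \<in> carrier R. \<forall>u\<in>N. x \<otimes> u \<in> K \<cdot> N}"
  proof (intro genideal_minimal colon_ideal ideal_prod_is_ideal K id subsetI)
    fix x assume "x \<in> X"
    thus "x \<in> {x \<in> carrier R. \<forall>u\<in>N. x \<otimes> u \<in> K \<cdot> N}"
      using N X by (simp add: multiplier_def subset_iff)
  qed
  hence "\<forall>x\<in>Idl X. \<forall>u\<in>N. x \<otimes> u \<in> K \<cdot> N" by blast
  thus ?thesis using N by (simp add: multiplier_def)
qed

text \<open>The elements that admit a multiplier of their own form an ideal, since the product of two multipliers
  serves both elements and all their combinations. In a Noetherian ring that ideal is generated
  by finitely many of them, and the product of the corresponding multipliers serves all of it.\<close>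

lemma integral_closure_ideal_multiplier:
  assumes "noetherian_ring R" and K: "ideal K R"
  shows "\<exists>N. multiplier K (Idl (integral_closure R K)) N"
proof -
  let ?C = "integral_closure R K"
  have C: "?C \<subseteq> carrier R" by (auto simp: integral_closure_def)
  let ?S = "{x \<in> carrier R. \<exists>N. multiplier K {x} N}"
  have CS: "?C \<subseteq> ?S"
  proof
    fix x assume x: "x \<in> ?C"
    then obtain N where "multiplier K {x} N"
      using integral_closure_multiplier[OF K x] unfolding multiplier_def by auto
    thus "x \<in> ?S" using x C by blast
  qed
  have gen: "x \<in> ?S" if g: "X \<subseteq> ?S" "finite X" "x \<in> Idl X" for x X
  proof -
    have Xc: "X \<subseteq> carrier R" using g(1) by blast
    obtain N where "multiplier K X N" using multiplier_finite[OF K g(2) Xc] g(1) by blast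
    hence "multiplier K (Idl X) N" by (rule multiplier_genideal[OF K Xc])
    hence "multiplier K {x} N" using g(3) by (simp add: multiplier_def)
    thus ?thesis using ideal.Icarr[OF genideal_ideal[OF Xc] g(3)] by blast
  qed
  have "ideal ?S R"
  proof (rule idealI)
    show "subgroup ?S (add_monoid R)"
    proof (rule add.subgroupI)
      show "?S \<noteq> {}" using gen[of "{}" "\<zero>"] ideal_zero_closed[OF genideal_ideal, of "{}"] by blast
    next
      fix a assume a: "a \<in> ?S"
      have "\<ominus> a \<in> Idl {a}" using a by (intro ideal_minus_closed genideal_ideal genideal_self') auto
      thus "\<ominus> a \<in> ?S" using gen[of "{a}"] a by blast
    next
      fix a b assume ab: "a \<in> ?S" "b \<in> ?S"
      have "a \<oplus> b \<in> Idl {a, b}"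
        using ab genideal_self[of "{a, b}"] by (intro ideal_add_closed genideal_ideal) auto
      thus "a \<oplus> b \<in> ?S" using gen[of "{a, b}"] ab by blast
    qed blast
  next
    fix a r assume a: "a \<in> ?S" and r: "r \<in> carrier R"
    have "r \<otimes> a \<in> Idl {a}" using a r by (intro ideal.I_l_closed genideal_ideal genideal_self') auto
    thus "r \<otimes> a \<in> ?S" using gen[of "{a}"] a by blast
    thus "a \<otimes> r \<in> ?S" using a r by (simp add: m_comm)
  qed (rule ring_axioms)
  moreover from this obtain X where X: "X \<subseteq> carrier R" "finite X" "?S = Idl X"
    using noetherian_ring.finetely_gen[OF assms(1)] by blast
  moreover have "X \<subseteq> ?S" using X(3) genideal_self[OF X(1)] by blast
  ultimately obtain N where "multiplier K X N" using multiplier_finite[OF K X(2,1)] by blast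
  hence N: "multiplier K ?S N" unfolding X(3) by (rule multiplier_genideal[OF K X(1)])
  have "Idl ?C \<subseteq> ?S" using \<open>ideal ?S R\<close> CS by (rule genideal_minimal)
  hence "multiplier K (Idl ?C) N" using N by (simp add: multiplier_def subset_iff)
  thus ?thesis by blast
qed

end

section \<open>A determinant trick by elimination\<close>

context cring
begin

context
  fixes I :: "'a set" and v :: 'a
  assumes I: "ideal I R" and v: "v \<in> carrier R"
begin

text \<open>\<open>lower d\<close> is the ideal of lower forms of degree \<open>d + 1\<close> in \<open>v\<close> over \<open>I\<close>, so that \<open>v\<close> is integral over \<open>I\<close> if and
  only if 0 lies in some \<open>monic d\<close>. The index is one less than the degree because a monic
  expression of degree 0 would be 1, which carries no information about \<open>v\<close>.\<close>

definition lower :: "nat \<Rightarrow> 'a set" where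
  "lower d = I \<cdot> ((I <+>\<^bsub>R\<^esub> PIdl v) \<up> d)"

definition monic :: "nat \<Rightarrow> 'a set" where
  "monic d = {v [^] Suc d \<oplus> g |g. g \<in> lower d}"

abbreviation (input) V where "V \<equiv> I <+>\<^bsub>R\<^esub> PIdl v"

lemma V_ideal: "ideal V R" by (rule adjoin_ideal[OF I v])

lemma V_pow_ideal: "ideal (V \<up> d) R" by (rule ideal_pow_ideal[OF V_ideal])

lemma lower_ideal: "ideal (lower d) R"
  unfolding lower_def by (intro ideal_prod_is_ideal I V_pow_ideal)

lemma lower_subset_pow: "lower d \<subseteq> V \<up> Suc d"
  unfolding lower_def ideal_pow_Suc ideal_prod_commute[OF V_pow_ideal V_ideal]
  by (intro ideal_prod_mono adjoin_superset[OF I v] subset_refl)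

lemma pow_prod_lower: "(V \<up> d) \<cdot> lower e = lower (d + e)"
  unfolding lower_def ideal_prod_lcomm[OF V_pow_ideal I V_pow_ideal] ideal_pow_add[OF V_ideal] ..

lemma pow_mult_lower:
  assumes "u \<in> V \<up> d" "h \<in> lower e"
  shows "u \<otimes> h \<in> lower (d + e)"
  unfolding pow_prod_lower[symmetric] using assms by (rule ideal_prod.prod)

lemma pow_mult_lower_prod:
  assumes "ideal C R" "u \<in> V \<up> d" "y \<in> lower e \<cdot> C"
  shows "u \<otimes> y \<in> lower (d + e) \<cdot> C"
  unfolding pow_prod_lower[symmetric] ideal_prod_assoc[OF V_pow_ideal lower_ideal assms(1)]
  using assms(2,3) by (rule ideal_prod.prod)

lemma v_pow_in_pow: "v [^] d \<in> V \<up> d"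
  by (rule elem_pow_in_ideal_pow[OF V_ideal adjoin_superset(2)[OF I v]])

lemma monic_subset_pow: "monic d \<subseteq> V \<up> Suc d"
proof
  fix p assume "p \<in> monic d"
  then obtain g where "g \<in> lower d" "p = v [^] Suc d \<oplus> g" unfolding monic_def by blast
  thus "p \<in> V \<up> Suc d"
    using ideal_add_closed[OF V_pow_ideal v_pow_in_pow subsetD[OF lower_subset_pow]] by blast
qed

lemma monic_carrier: "p \<in> monic d \<Longrightarrow> p \<in> carrier R"
  using monic_subset_pow ideal.Icarr[OF V_pow_ideal] by blast

lemma monic_add_lower:
  assumes "p \<in> monic d" "g \<in> lower d"
  shows "p \<oplus> g \<in> monic d"
proof -
  obtain h where h: "h \<in> lower d" "p = v [^] Suc d \<oplus> h" using assms(1) by (auto simp: monic_def)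
  have "p \<oplus> g = v [^] Suc d \<oplus> (h \<oplus> g)"
    using ideal.Icarr[OF lower_ideal h(1)] ideal.Icarr[OF lower_ideal assms(2)] v
    unfolding h(2) by (intro a_assoc) auto
  thus ?thesis using ideal_add_closed[OF lower_ideal h(1) assms(2)] unfolding monic_def by blast
qed

lemma monic_mult:
  assumes "p \<in> monic d" "q \<in> monic e"
  shows "p \<otimes> q \<in> monic (Suc (d + e))"
proof -
  obtain g where g: "g \<in> lower d" "p = v [^] Suc d \<oplus> g" using assms(1) by (auto simp: monic_def)
  obtain h where h: "h \<in> lower e" "q = v [^] Suc e \<oplus> h" using assms(2) by (auto simp: monic_def)
  have c: "g \<in> carrier R" "h \<in> carrier R" "v [^] Suc d \<in> carrier R" "v [^] Suc e \<in> carrier R"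
    using ideal.Icarr[OF lower_ideal] g(1) h(1) v by (blast intro: nat_pow_closed)+
  have "p \<otimes> q = v [^] Suc d \<otimes> v [^] Suc e \<oplus> (p \<otimes> h \<oplus> v [^] Suc e \<otimes> g)"
    unfolding g(2) h(2) using c by (simp add: l_distr r_distr a_ac m_ac del: nat_pow_Suc)
  also have "v [^] Suc d \<otimes> v [^] Suc e = v [^] Suc (Suc (d + e))"
    using v by (subst nat_pow_mult) auto
  finally have eq: "p \<otimes> q = v [^] Suc (Suc (d + e)) \<oplus> (p \<otimes> h \<oplus> v [^] Suc e \<otimes> g)" .
  have "p \<otimes> h \<in> lower (Suc (d + e))"
    using pow_mult_lower[OF subsetD[OF monic_subset_pow assms(1)] h(1)] by simp
  moreover have "v [^] Suc e \<otimes> g \<in> lower (Suc (d + e))"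
    using pow_mult_lower[OF v_pow_in_pow g(1), of "Suc e"] by (simp add: add.commute del: nat_pow_Suc)
  ultimately have "p \<otimes> h \<oplus> v [^] Suc e \<otimes> g \<in> lower (Suc (d + e))"
    by (rule ideal_add_closed[OF lower_ideal])
  thus ?thesis using eq unfolding monic_def by blast
qed

lemma annihilator_of_element_ideal: "p \<in> carrier R \<Longrightarrow> ideal {x \<in> carrier R. p \<otimes> x = \<zero>} R"
  using ideal.helper_max_prime[OF zeroideal is_cring] by simp

text \<open>Gaussian elimination in place of a determinant. The hypothesis is a linear system
  \<open>p\<^sub>c c = \<Sum> b\<^sub>c\<^sub>,\<^sub>c\<^sub>' c'\<close>, summed over \<open>c' \<noteq> c\<close>, with monic diagonal entries \<open>p\<^sub>c\<close> and lower off-diagonal entries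
  \<open>b\<^sub>c\<^sub>,\<^sub>c\<^sub>'\<close> of the same degree as \<open>p\<^sub>c\<close>. To eliminate \<open>k\<close>, multiply row \<open>c\<close> by \<open>p\<^sub>k\<close> and substitute row \<open>k\<close>; the new
  diagonal entry \<open>p\<^sub>k p\<^sub>c - b\<^sub>c\<^sub>,\<^sub>k b\<^sub>k\<^sub>,\<^sub>c\<close> is again monic and the new off-diagonal entries are again lower.
  If \<open>p\<close> annihilates the remaining unknowns, then \<open>p p\<^sub>k\<close> annihilates all, by row \<open>k\<close>.\<close>

lemma monic_annihilator:
  assumes "finite A" "A \<subseteq> carrier R"
    and "\<And>c. c \<in> A \<Longrightarrow> \<exists>d. \<exists>p\<in>monic d. p \<otimes> c \<in> lower d \<cdot> (Idl (A - {c}))"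
  shows "\<exists>d. \<exists>p\<in>monic d. \<forall>c\<in>A. p \<otimes> c = \<zero>"
  using assms
proof (induct rule: finite_induct)
  case empty
  have "v [^] Suc 0 \<oplus> \<zero> \<in> monic 0"
    using ideal_zero_closed[OF lower_ideal] unfolding monic_def by blast
  thus ?case by blast
next
  case (insert k A)
  have k: "k \<in> carrier R" and A: "A \<subseteq> carrier R" using insert.prems(1) by auto
  have "insert k A - {k} = A" using insert.hyps(2) by auto
  then obtain e q where q: "q \<in> monic e" "q \<otimes> k \<in> lower e \<cdot> (Idl A)"
    using insert.prems(2)[of k] by auto
  have qc: "q \<in> carrier R" by (rule monic_carrier[OF q(1)])
  have "\<exists>d. \<exists>p\<in>monic d. p \<otimes> c \<in> lower d \<cdot> (Idl (A - {c}))" if c: "c \<in> A" for c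
  proof -
    let ?C = "Idl (A - {c})"
    have cc: "c \<in> carrier R" and Ac: "A - {c} \<subseteq> carrier R" using A c by auto
    have C: "ideal ?C R" by (rule genideal_ideal[OF Ac])
    have P: "ideal (lower d \<cdot> ?C) R" for d by (intro ideal_prod_is_ideal lower_ideal C)
    obtain d p where p: "p \<in> monic d" "p \<otimes> c \<in> lower d \<cdot> (Idl (insert k A - {c}))"
      using insert.prems(2)[of c] c by auto
    have "insert k A - {c} = insert k (A - {c})" using c insert.hyps(2) by auto
    then obtain y b where y: "y \<in> lower d \<cdot> ?C" "b \<in> lower d" "p \<otimes> c = y \<oplus> b \<otimes> k"
      using ideal_prod_genideal_insert[OF lower_ideal k Ac, of "p \<otimes> c" d] p(2) by auto
    have "insert c (A - {c}) = A" using c by auto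
    then obtain y' b' where y': "y' \<in> lower e \<cdot> ?C" "b' \<in> lower e" "q \<otimes> k = y' \<oplus> b' \<otimes> c"
      using ideal_prod_genideal_insert[OF lower_ideal cc Ac, of "q \<otimes> k" e] q(2) by auto
    have pc: "p \<in> carrier R" by (rule monic_carrier[OF p(1)])
    have carr: "y \<in> carrier R" "y' \<in> carrier R" "b \<in> carrier R" "b' \<in> carrier R"
      using ideal.Icarr[OF P y(1)] ideal.Icarr[OF P y'(1)] ideal.Icarr[OF lower_ideal y(2)]
        ideal.Icarr[OF lower_ideal y'(2)] by auto
    \<comment> \<open>the diagonal entry for \<open>c\<close> after elimination of \<open>k\<close>\<close>
    let ?p = "q \<otimes> p \<oplus> \<ominus> (b \<otimes> b')" and ?n = "Suc (e + d)"
    have "b \<otimes> b' \<in> lower ?n"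
      using pow_mult_lower[OF subsetD[OF lower_subset_pow y(2)] y'(2)] by (simp add: add.commute)
    hence "?p \<in> monic ?n"
      by (intro monic_add_lower monic_mult q(1) p(1) ideal_minus_closed lower_ideal)
    moreover have "?p \<otimes> c = q \<otimes> y \<oplus> b \<otimes> y'"
    proof -
      have "(q \<otimes> p) \<otimes> c = q \<otimes> y \<oplus> b \<otimes> (q \<otimes> k)"
        using y(3) pc qc cc carr k by (simp add: m_assoc r_distr) (simp add: m_lcomm)
      also have "\<dots> = q \<otimes> y \<oplus> b \<otimes> y' \<oplus> (b \<otimes> b') \<otimes> c"
        unfolding y'(3) using qc cc carr by (simp add: r_distr m_assoc a_assoc)
      finally show ?thesis using qc pc cc carr by (simp add: l_distr l_minus a_assoc r_neg)
    qed
    moreover have "q \<otimes> y \<in> lower ?n \<cdot> ?C"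
      using pow_mult_lower_prod[OF C subsetD[OF monic_subset_pow q(1)] y(1)] by simp
    moreover have "b \<otimes> y' \<in> lower ?n \<cdot> ?C"
      using pow_mult_lower_prod[OF C subsetD[OF lower_subset_pow y(2)] y'(1)] by (simp add: add.commute)
    ultimately show ?thesis using ideal_add_closed[OF P] by metis
  qed
  then obtain d p where p: "p \<in> monic d" "\<forall>c\<in>A. p \<otimes> c = \<zero>"
    using insert.hyps(3)[OF A] by blast
  have pc: "p \<in> carrier R" by (rule monic_carrier[OF p(1)])
  have "Idl A \<subseteq> {x \<in> carrier R. p \<otimes> x = \<zero>}"
    using p(2) A by (intro genideal_minimal annihilator_of_element_ideal pc) auto
  moreover have "q \<otimes> k \<in> Idl A"
    using ideal_prod_inter[OF lower_ideal genideal_ideal[OF A]] q(2) by blast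
  ultimately have "p \<otimes> (q \<otimes> k) = \<zero>" by blast
  hence "(p \<otimes> q) \<otimes> k = \<zero>" using pc qc k by (simp add: m_assoc)
  moreover have "(p \<otimes> q) \<otimes> c = \<zero>" if "c \<in> A" for c
  proof -
    have "c \<in> carrier R" using A that by blast
    hence "(p \<otimes> q) \<otimes> c = q \<otimes> (p \<otimes> c)" using pc qc by (simp add: m_ac)
    thus ?thesis using p(2) that qc by simp
  qed
  ultimately have all: "\<forall>c\<in>insert k A. (p \<otimes> q) \<otimes> c = \<zero>" by simp
  show ?case
    by (rule exI[of _ "Suc (d + e)"], rule bexI[of _ "p \<otimes> q"]) (fact all, fact monic_mult[OF p(1) q(1)])
qed

text \<open>A finite generating set \<open>A\<close> of \<open>N\<close> satisfies a system as in the previous lemma: writing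
  \<open>v c = b c + y\<close> with \<open>b \<in> I\<close> and \<open>y\<close> in \<open>I\<close> times the ideal of the other generators, the
  diagonal entry for \<open>c\<close> is \<open>v - b\<close>.\<close>

lemma determinant_trick:
  assumes "noetherian_ring R" and N: "ideal N R" and vN: "\<And>u. u \<in> N \<Longrightarrow> v \<otimes> u \<in> I \<cdot> N"
  shows "\<exists>d. \<exists>p\<in>monic d. \<forall>u\<in>N. p \<otimes> u = \<zero>"
proof -
  obtain A where A: "A \<subseteq> carrier R" "finite A" "N = Idl A"
    using noetherian_ring.finetely_gen[OF assms(1) N] by metis
  have l0: "lower 0 = I" unfolding lower_def by (simp add: ideal_pow_0 ideal_prod_one[OF I])
  have "\<exists>d. \<exists>p\<in>monic d. p \<otimes> c \<in> lower d \<cdot> (Idl (A - {c}))" if c: "c \<in> A" for c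
  proof -
    have cc: "c \<in> carrier R" and Ac: "A - {c} \<subseteq> carrier R" using A c by auto
    have "c \<in> N" using genideal_self[OF A(1)] A(3) c by blast
    hence "v \<otimes> c \<in> I \<cdot> (Idl (insert c (A - {c})))" using vN[of c] A(3) c by (simp add: insert_absorb)
    from ideal_prod_genideal_insert[OF I cc Ac this] obtain y b
      where y: "y \<in> I \<cdot> (Idl (A - {c}))" "b \<in> I" "v \<otimes> c = y \<oplus> b \<otimes> c" by blast
    have carr: "y \<in> carrier R" "b \<in> carrier R"
      by (rule ideal.Icarr[OF ideal_prod_is_ideal[OF I genideal_ideal[OF Ac]] y(1)],
          rule ideal.Icarr[OF I y(2)])
    have "\<ominus> b \<in> lower 0" using ideal_minus_closed[OF I y(2)] l0 by simp
    hence "v [^] Suc 0 \<oplus> \<ominus> b \<in> monic 0" unfolding monic_def by blast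
    moreover have "(v [^] Suc 0 \<oplus> \<ominus> b) \<otimes> c = y"
      using y(3) carr cc v by (simp add: l_distr l_minus a_assoc r_neg)
    moreover have "y \<in> lower 0 \<cdot> (Idl (A - {c}))" using y(1) l0 by simp
    ultimately show ?thesis by (intro exI[of _ 0] bexI[of _ "v [^] Suc 0 \<oplus> \<ominus> b"]) simp_all
  qed
  then obtain d p where p: "p \<in> monic d" "\<forall>c\<in>A. p \<otimes> c = \<zero>"
    using monic_annihilator[OF A(2,1)] by metis
  have "Idl A \<subseteq> {x \<in> carrier R. p \<otimes> x = \<zero>}"
    using p(2) A(1) by (intro genideal_minimal annihilator_of_element_ideal monic_carrier[OF p(1)]) auto
  thus ?thesis using p(1) A(3) by blast
qed

lemma nilpotent_monic_imp_integral:
  assumes p: "p \<in> monic d" and nil: "p [^] (n::nat) = \<zero>"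
  shows "v \<in> integral_closure R I"
proof -
  have "\<exists>e. p [^] Suc n \<in> monic e"
  proof (induct n)
    case 0
    have "p [^] Suc 0 = p" using monic_carrier[OF p] by simp
    thus ?case using p by metis
  next
    case (Suc n)
    then obtain e where "p [^] Suc n \<in> monic e" by blast
    thus ?case unfolding nat_pow_Suc[of p "Suc n"] using monic_mult[OF _ p] by blast
  qed
  moreover have "p [^] Suc n = \<zero>" using nil monic_carrier[OF p] by simp
  ultimately have "\<exists>e. \<zero> \<in> monic e" by simp
  then obtain e where "\<zero> \<in> monic e" by blast
  then obtain g where g: "g \<in> lower e" "v [^] Suc e \<oplus> g = \<zero>"
    unfolding monic_def mem_Collect_eq by metis
  have "v [^] Suc e = \<ominus> g"
    using minus_equality[OF g(2) ideal.Icarr[OF lower_ideal g(1)]] v by simp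
  hence "v [^] Suc e \<in> lower e" using ideal_minus_closed[OF lower_ideal g(1)] by simp
  thus ?thesis unfolding integral_closure_iff[OF I v] lower_def by blast
qed

end

section \<open>Minimal primes and height\<close>

text \<open>The additive step in showing that the complement of a maximal multiplicative set is an ideal. If
  \<open>w x\<^sup>j\<^sup>+\<^sup>1 = 0\<close>, then \<open>x + y\<close> acts on \<open>w x\<^sup>j\<close> as \<open>y\<close>, so \<open>w (x + y)\<^sup>m x\<^sup>j = w x\<^sup>j y\<^sup>m = 0\<close>. Replacing
  \<open>w\<close> by \<open>w (x + y)\<^sup>m\<close>, which is still in \<open>S\<close>, lowers the exponent of \<open>x\<close>, until \<open>w = 0\<close>.\<close>

lemma mult_closed_add_absorb:
  assumes S: "S \<subseteq> carrier R" "\<zero> \<notin> S" "\<And>a b. a \<in> S \<Longrightarrow> b \<in> S \<Longrightarrow> a \<otimes> b \<in> S"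
    and x: "x \<in> carrier R" and y: "y \<in> carrier R" and xy: "x \<oplus> y \<in> S"
    and w: "w \<in> S" "w \<otimes> x [^] (j::nat) = \<zero>" "w \<otimes> y [^] (m::nat) = \<zero>"
  shows False
  using w
proof (induct j arbitrary: w)
  case 0
  thus False using S by auto
next
  case (Suc j)
  let ?z = "x \<oplus> y"
  have wc: "w \<in> carrier R" using Suc.prems(1) S(1) by blast
  define u where "u = w \<otimes> x [^] j"
  have uc: "u \<in> carrier R" using wc x unfolding u_def by simp
  have ux: "u \<otimes> x = \<zero>" using Suc.prems(2) wc x unfolding u_def by (simp add: m_assoc)
  have uz: "u \<otimes> ?z [^] i = u \<otimes> y [^] i" for i :: nat
  proof (induct i)
    case (Suc i)
    have "u \<otimes> ?z [^] Suc i = (u \<otimes> ?z [^] i) \<otimes> ?z" using uc x y by (simp add: m_assoc)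
    also have "\<dots> = (u \<otimes> x) \<otimes> y [^] i \<oplus> u \<otimes> (y [^] i \<otimes> y)"
      unfolding Suc using uc x y by (simp add: r_distr m_ac)
    finally show ?case using uc y ux by simp
  qed simp
  have zS: "w \<otimes> ?z [^] i \<in> S" for i :: nat
  proof (induct i)
    case (Suc i)
    thus ?case using S(3)[OF Suc xy] wc x y by (simp add: m_assoc)
  qed (use Suc.prems(1) wc in simp)
  have "(w \<otimes> ?z [^] m) \<otimes> x [^] j = u \<otimes> ?z [^] m" using wc x y unfolding u_def by (simp add: m_ac)
  also have "\<dots> = x [^] j \<otimes> (w \<otimes> y [^] m)" unfolding uz unfolding u_def using wc x y by (simp add: m_ac)
  finally have 1: "(w \<otimes> ?z [^] m) \<otimes> x [^] j = \<zero>" using Suc.prems(3) x by simp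
  have "(w \<otimes> ?z [^] m) \<otimes> y [^] m = ?z [^] m \<otimes> (w \<otimes> y [^] m)" using wc x y by (simp add: m_ac)
  hence 2: "(w \<otimes> ?z [^] m) \<otimes> y [^] m = \<zero>" using Suc.prems(3) x y by simp
  show False by (rule Suc.hyps[OF zS 1 2])
qed

text \<open>By Zorn's lemma, the powers of \<open>p\<close> lie in a maximal multiplicative set \<open>S\<close> without 0. Its complement
  is prime: by maximality, adjoining some \<open>x \<notin> S\<close> to \<open>S\<close> yields 0, so the complement consists of the \<open>x\<close>
  some power of which is annihilated by an element of \<open>S\<close>. It is a minimal prime because
  the complement of a smaller prime would be a larger multiplicative set.\<close>

lemma minimal_prime_avoiding:
  assumes p: "p \<in> carrier R" and nil: "\<And>n::nat. p [^] n \<noteq> \<zero>"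
  shows "\<exists>Q. primeideal Q R \<and> p \<notin> Q \<and> (\<forall>Q'. primeideal Q' R \<longrightarrow> Q' \<subseteq> Q \<longrightarrow> Q' = Q)"
proof -
  define \<S> where "\<S> = {S. S \<subseteq> carrier R \<and> \<one> \<in> S \<and> p \<in> S \<and> \<zero> \<notin> S \<and> (\<forall>a\<in>S. \<forall>b\<in>S. a \<otimes> b \<in> S)}"
  have "range (\<lambda>n::nat. p [^] n) \<in> \<S>"
    unfolding \<S>_def
  proof (intro CollectI conjI ballI)
    show "\<one> \<in> range (\<lambda>n::nat. p [^] n)" using nat_pow_0 by (metis rangeI)
    show "p \<in> range (\<lambda>n::nat. p [^] n)" using nat_pow_eone[OF p] by (metis rangeI)
    show "\<zero> \<notin> range (\<lambda>n::nat. p [^] n)" using nil by (metis rangeE)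
    fix a b assume "a \<in> range (\<lambda>n::nat. p [^] n)" "b \<in> range (\<lambda>n::nat. p [^] n)"
    thus "a \<otimes> b \<in> range (\<lambda>n::nat. p [^] n)" using nat_pow_mult[OF p] by auto
  qed (use p in auto)
  moreover have "\<Union>\<C> \<in> \<S>" if \<C>: "\<C> \<noteq> {}" "subset.chain \<S> \<C>" for \<C>
  proof -
    have sub: "\<C> \<subseteq> \<S>" and lin: "\<And>X Y. X \<in> \<C> \<Longrightarrow> Y \<in> \<C> \<Longrightarrow> X \<subseteq> Y \<or> Y \<subseteq> X"
      using \<C>(2) by (auto simp: subset_chain_def)
    have "a \<otimes> b \<in> \<Union>\<C>" if XY: "X \<in> \<C>" "Y \<in> \<C>" "a \<in> X" "b \<in> Y" for X Y a b
    proof -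
      obtain Z where "Z \<in> \<C>" "a \<in> Z" "b \<in> Z" using lin[OF XY(1,2)] XY by blast
      thus ?thesis using sub unfolding \<S>_def by blast
    qed
    thus ?thesis using sub \<C>(1) unfolding \<S>_def by blast
  qed
  ultimately obtain S where SS: "S \<in> \<S>" and max: "\<And>T. T \<in> \<S> \<Longrightarrow> S \<subseteq> T \<Longrightarrow> T = S"
    using subset_Zorn_nonempty[of \<S>] by blast
  have S: "S \<subseteq> carrier R" "\<one> \<in> S" "p \<in> S" "\<zero> \<notin> S" "\<And>a b. a \<in> S \<Longrightarrow> b \<in> S \<Longrightarrow> a \<otimes> b \<in> S"
    using SS by (auto simp: \<S>_def)
  have kill: "\<exists>s\<in>S. \<exists>n::nat. s \<otimes> x [^] n = \<zero>" if x: "x \<in> carrier R" "x \<notin> S" for x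
  proof (rule ccontr)
    assume no: "\<not> ?thesis"
    \<comment> \<open>the multiplicative set generated by \<open>S\<close> and \<open>x\<close>\<close>
    define T where "T = {s \<otimes> x [^] n |s n. s \<in> S \<and> (n::nat) \<in> UNIV}"
    have ST: "s \<in> T" if "s \<in> S" for s
    proof -
      have "s = s \<otimes> x [^] (0::nat)" using that S(1) by auto
      thus ?thesis using that unfolding T_def by blast
    qed
    have "T \<in> \<S>"
      unfolding \<S>_def
    proof (intro CollectI conjI ballI)
      show "T \<subseteq> carrier R" using S(1) x(1) unfolding T_def by auto
      show "\<zero> \<notin> T" using no unfolding T_def by force
      fix a b assume "a \<in> T" "b \<in> T"
      then obtain s n s' n' where *: "s \<in> S" "s' \<in> S" "a = s \<otimes> x [^] (n::nat)" "b = s' \<otimes> x [^] (n'::nat)"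
        unfolding T_def by blast
      have "s \<in> carrier R" "s' \<in> carrier R" using * S(1) by auto
      hence "a \<otimes> b = (s \<otimes> s') \<otimes> x [^] (n + n')"
        using x(1) unfolding *(3,4) by (simp add: m_ac flip: nat_pow_mult)
      thus "a \<otimes> b \<in> T" using S(5)[OF *(1,2)] unfolding T_def by blast
    qed (use S ST in auto)
    hence "T = S" using max ST by blast
    moreover have "x = \<one> \<otimes> x [^] (1::nat)" using x(1) by simp
    hence "x \<in> T" using S(2) unfolding T_def by blast
    ultimately show False using x(2) by blast
  qed
  have powS: "x [^] n \<in> S" if "x \<in> S" for x and n :: nat
    using that S by (induct n) auto
  have unkill: "x \<notin> S" if "s \<in> S" "s \<otimes> x [^] (n::nat) = \<zero>" for s x n
    using S(4) S(5)[OF that(1) powS[of x n]] that(2) by auto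
  let ?Q = "carrier R - S"
  have "primeideal ?Q R"
  proof (rule primeidealI2[OF _ is_cring])
    show "additive_subgroup ?Q R"
    proof (rule additive_subgroup.intro, rule add.subgroupI)
      show "?Q \<noteq> {}" using S(4) by auto
    next
      fix a assume a: "a \<in> ?Q"
      then obtain s and n :: nat where s: "s \<in> S" "s \<otimes> a [^] n = \<zero>" using kill by blast
      have "(\<ominus> \<one> \<otimes> a) [^] n = (\<ominus> \<one>) [^] n \<otimes> a [^] n" using a by (intro nat_pow_distrib) auto
      hence "s \<otimes> (\<ominus> a) [^] n = (\<ominus> \<one>) [^] n \<otimes> (s \<otimes> a [^] n)"
        using a s(1) S(1) by (simp add: l_minus m_lcomm subset_iff)
      hence "s \<otimes> (\<ominus> a) [^] n = \<zero>" using s(2) by simp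
      thus "\<ominus> a \<in> ?Q" using unkill[OF s(1)] a by blast
    next
      fix a b assume a: "a \<in> ?Q" and b: "b \<in> ?Q"
      then obtain s t and n m :: nat where s: "s \<in> S" "s \<otimes> a [^] n = \<zero>"
        and t: "t \<in> S" "t \<otimes> b [^] m = \<zero>" using kill by (metis DiffE)
      have c: "s \<in> carrier R" "t \<in> carrier R" "a \<in> carrier R" "b \<in> carrier R"
        using s t a b S(1) by auto
      have "(s \<otimes> t) \<otimes> a [^] n = t \<otimes> (s \<otimes> a [^] n)" "(s \<otimes> t) \<otimes> b [^] m = s \<otimes> (t \<otimes> b [^] m)"
        using c by (simp_all add: m_ac)
      hence "a \<oplus> b \<notin> S"
        using mult_closed_add_absorb[OF S(1,4,5) c(3,4) _ S(5)[OF s(1) t(1)], of n m] s(2) t(2) c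
        by auto
      thus "a \<oplus> b \<in> ?Q" using c by blast
    qed blast
  next
    fix a x assume a: "a \<in> ?Q" and x: "x \<in> carrier R"
    then obtain s and n :: nat where s: "s \<in> S" "s \<otimes> a [^] n = \<zero>" using kill by blast
    have "s \<otimes> (x \<otimes> a) [^] n = x [^] n \<otimes> (s \<otimes> a [^] n)"
      using a x s(1) S(1) by (simp add: nat_pow_distrib m_lcomm subset_iff)
    hence "s \<otimes> (x \<otimes> a) [^] n = \<zero>" using s(2) x by simp
    thus "x \<otimes> a \<in> ?Q" using unkill[OF s(1)] a x by blast
    thus "a \<otimes> x \<in> ?Q" using a x by (simp add: m_comm)
  qed (use S in auto)
  moreover have "Q' = ?Q" if Q': "primeideal Q' R" "Q' \<subseteq> ?Q" for Q'
  proof -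
    interpret Q': primeideal Q' R by fact
    have "carrier R - Q' \<in> \<S>"
      unfolding \<S>_def using S(2,3) Q'(2) p Q'.I_prime by auto
    hence "carrier R - Q' = S" using Q'(2) S(1) by (intro max) auto
    thus ?thesis using Q'.a_subset by auto
  qed
  ultimately show ?thesis using S(3) by blast
qed

lemma smaller_prime_if_ideal_height_pos:
  assumes "ideal_height R I > 0" "primeideal Q R" "I \<subseteq> Q"
  shows "\<exists>Q'. primeideal Q' R \<and> Q' \<subset> Q"
proof (rule ccontr)
  assume no: "\<not> ?thesis"
  have "ideal_height R I \<le> prime_height R Q"
    unfolding ideal_height_def using assms(2,3) by (intro INF_lower) auto
  also have "prime_height R Q \<le> 0"
    unfolding prime_height_def
  proof (rule SUP_least)
    fix n assume "n \<in> {n. \<exists>c :: nat \<Rightarrow> 'a set. (\<forall>i\<le>n. primeideal (c i) R) \<and> (\<forall>i<n. c i \<subset> c (Suc i)) \<and> c n = Q}"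
    then obtain c :: "nat \<Rightarrow> 'a set" where c: "\<forall>i\<le>n. primeideal (c i) R" "\<forall>i<n. c i \<subset> c (Suc i)" "c n = Q"
      by blast
    have "n = 0"
    proof (rule ccontr)
      assume "n \<noteq> 0"
      then obtain m where "n = Suc m" by (cases n) auto
      thus False using c no by (metis le_SucI lessI order_refl)
    qed
    thus "enat n \<le> 0" by (simp add: zero_enat_def)
  qed
  finally show False using assms(1) by simp
qed

text \<open>The determinant trick only gives a monic expression \<open>p\<close> in \<open>v\<close> that annihilates a multiple of \<open>K\<close>. The
  conditions on height and on primes turn this into \<open>p\<^sup>n = 0\<close>: as \<open>I\<close> lies in the radical of \<open>K\<close>,
  no minimal prime contains \<open>K\<close>.\<close>

theorem integral_closure_cancel:
  assumes noeth: "noetherian_ring R" and I: "ideal I R" and K: "ideal K R"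
    and ht: "ideal_height R I > 0"
    and rad: "\<And>Q. primeideal Q R \<Longrightarrow> K \<subseteq> Q \<Longrightarrow> I \<subseteq> Q"
    and v: "v \<in> carrier R" and Kv: "\<And>k. k \<in> K \<Longrightarrow> k \<otimes> v \<in> I \<cdot> (Idl (integral_closure R K))"
  shows "v \<in> integral_closure R I"
proof -
  define E where "E = Idl (integral_closure R K)"
  have E: "ideal E R"
    unfolding E_def by (rule genideal_ideal) (auto simp: integral_closure_def)
  obtain N where "multiplier K E N"
    using integral_closure_ideal_multiplier[OF noeth K] unfolding E_def by blast
  hence N: "ideal N R" and EN: "\<And>x u. x \<in> E \<Longrightarrow> u \<in> N \<Longrightarrow> x \<otimes> u \<in> K \<cdot> N"
    and NQ: "\<And>Q. primeideal Q R \<Longrightarrow> N \<subseteq> Q \<Longrightarrow> K \<subseteq> Q"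
    by (auto simp: multiplier_def)
  note KN = ideal_prod_is_ideal[OF K N]
  note IKN = ideal_prod_is_ideal[OF I KN]
  have EN': "E \<cdot> N \<subseteq> K \<cdot> N" by (rule ideal_prod_least[OF KN EN])
  have "v \<otimes> u \<in> I \<cdot> (K \<cdot> N)" if "u \<in> K \<cdot> N" for u
    using that
  proof (induct rule: ideal_prod.induct)
    case (prod k n)
    have c: "k \<in> carrier R" "n \<in> carrier R" using ideal.Icarr[OF K prod(1)] ideal.Icarr[OF N prod(2)] .
    have "(k \<otimes> v) \<otimes> n \<in> (I \<cdot> E) \<cdot> N" using Kv[OF prod(1)] prod(2) unfolding E_def by (rule ideal_prod.prod)
    also have "(I \<cdot> E) \<cdot> N = I \<cdot> (E \<cdot> N)" by (rule ideal_prod_assoc[OF I E N])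
    also have "\<dots> \<subseteq> I \<cdot> (K \<cdot> N)" by (rule ideal_prod_mono[OF subset_refl EN'])
    finally show ?case using c v by (simp add: m_ac)
  next
    case (sum u1 u2)
    thus ?case
      using ideal_add_closed[OF IKN sum(2,4)] ideal.Icarr[OF KN sum(1)] ideal.Icarr[OF KN sum(3)] v
      by (simp add: r_distr)
  qed
  then obtain d p where p: "p \<in> monic I v d" "\<forall>u\<in>K \<cdot> N. p \<otimes> u = \<zero>"
    using determinant_trick[OF I v noeth KN] by blast
  have pc: "p \<in> carrier R" by (rule monic_carrier[OF I v p(1)])
  have "\<exists>n::nat. p [^] n = \<zero>"
  proof (rule ccontr)
    assume "\<nexists>n::nat. p [^] n = \<zero>"
    then obtain Q where Q: "primeideal Q R" "p \<notin> Q" "\<And>Q'. primeideal Q' R \<Longrightarrow> Q' \<subseteq> Q \<Longrightarrow> Q' = Q"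
      using minimal_prime_avoiding[OF pc] by blast
    interpret Q: primeideal Q R by (rule Q(1))
    have "K \<cdot> N \<subseteq> Q"
    proof
      fix u assume u: "u \<in> K \<cdot> N"
      hence "p \<otimes> u \<in> Q" using p(2) by simp
      thus "u \<in> Q" using Q.I_prime[OF pc ideal.Icarr[OF KN u]] Q(2) by blast
    qed
    hence "K \<subseteq> Q" using prime_contains_prod[OF Q(1) K N] NQ[OF Q(1)] by blast
    hence "I \<subseteq> Q" by (rule rad[OF Q(1)])
    thus False using smaller_prime_if_ideal_height_pos[OF ht Q(1)] Q(3) by blast
  qed
  thus ?thesis using nilpotent_monic_imp_integral[OF I v p(1)] by blast
qed

lemma maximal_ideal_above:
  assumes "noetherian_ring R" "ideal I R" "I \<noteq> carrier R"
  shows "\<exists>P. maximalideal P R \<and> I \<subseteq> P"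
proof -
  define \<S> where "\<S> = {J. ideal J R \<and> I \<subseteq> J \<and> J \<noteq> carrier R}"
  have "\<Union>C \<in> \<S>" if "C \<noteq> {}" "subset.chain \<S> C" for C
  proof -
    have "subset.chain {J. ideal J R} C" using that(2) by (auto simp: subset_chain_def \<S>_def)
    hence "\<Union>C \<in> C" by (rule noetherian_ring.ideal_chain_is_trivial[OF assms(1) that(1)])
    thus ?thesis using that(2) unfolding subset_chain_def by blast
  qed
  moreover have "\<S> \<noteq> {}" using assms(2,3) unfolding \<S>_def by blast
  ultimately obtain P where P: "P \<in> \<S>" "\<forall>J\<in>\<S>. P \<subseteq> J \<longrightarrow> J = P"
    using subset_Zorn_nonempty[of \<S>] by auto
  have P': "ideal P R" "I \<subseteq> P" "P \<noteq> carrier R" using P(1) by (auto simp: \<S>_def)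
  have "maximalideal P R"
  proof (rule maximalidealI)
    fix J assume J: "ideal J R" "P \<subseteq> J" "J \<subseteq> carrier R"
    show "J = P \<or> J = carrier R"
    proof (rule disjCI)
      assume "J \<noteq> carrier R"
      hence "J \<in> \<S>" using J P'(2) unfolding \<S>_def by auto
      thus "J = P" using P(2) J(2) by simp
    qed
  qed (use P' in simp_all)
  thus ?thesis using P'(2) by blast
qed

end

section \<open>Coordinates on free modules\<close>

lemma fin_free_coordinates:
  assumes "fin_free_module R F"
  shows "\<exists>B \<pi>. finite B \<and> B \<subseteq> carrier F \<and> (\<forall>b\<in>B. \<pi> b \<in> mod_hom R F (regular_module R)) \<and>
    (\<forall>x\<in>carrier F. x = (\<Oplus>\<^bsub>F\<^esub>b\<in>B. \<pi> b x \<odot>\<^bsub>F\<^esub> b))"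
proof -
  have "module R F" using assms by (simp add: fin_free_module_def)
  then interpret F: module R F .
  from assms obtain B where B: "finite B" "B \<subseteq> carrier F"
    and unique: "\<forall>x\<in>carrier F. \<exists>!c. c \<in> B \<rightarrow>\<^sub>E carrier R \<and> x = (\<Oplus>\<^bsub>F\<^esub>b\<in>B. c b \<odot>\<^bsub>F\<^esub> b)"
    unfolding fin_free_module_def by (elim exE conjE)
  note ex1 = bspec[OF unique]
  define c where "c x = (THE c. c \<in> B \<rightarrow>\<^sub>E carrier R \<and> x = (\<Oplus>\<^bsub>F\<^esub>b\<in>B. c b \<odot>\<^bsub>F\<^esub> b))" for x
  have c: "c x \<in> B \<rightarrow>\<^sub>E carrier R" "x = (\<Oplus>\<^bsub>F\<^esub>b\<in>B. c x b \<odot>\<^bsub>F\<^esub> b)" if "x \<in> carrier F" for x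
    using theI'[OF ex1[OF that]] unfolding c_def by blast+
  have uniq: "c x b = k b" if "x \<in> carrier F" "\<And>b. b \<in> B \<Longrightarrow> k b \<in> carrier R"
    "x = (\<Oplus>\<^bsub>F\<^esub>b\<in>B. k b \<odot>\<^bsub>F\<^esub> b)" "b \<in> B" for x k b
  proof -
    have "(\<Oplus>\<^bsub>F\<^esub>b\<in>B. restrict k B b \<odot>\<^bsub>F\<^esub> b) = (\<Oplus>\<^bsub>F\<^esub>b\<in>B. k b \<odot>\<^bsub>F\<^esub> b)"
      using that(2) B by (intro F.M.finsum_cong') (auto simp: subset_iff)
    hence "restrict k B \<in> B \<rightarrow>\<^sub>E carrier R \<and> x = (\<Oplus>\<^bsub>F\<^esub>b\<in>B. restrict k B b \<odot>\<^bsub>F\<^esub> b)"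
      using that(2,3) by auto
    hence "c x = restrict k B" using ex1[OF that(1)] c[OF that(1)] by blast
    thus ?thesis using that(4) by simp
  qed
  have cR: "c x b \<in> carrier R" if "x \<in> carrier F" "b \<in> B" for x b
    using c(1)[OF that(1)] that(2) by (auto simp: PiE_def)
  have BF: "b \<in> carrier F" if "b \<in> B" for b using B(2) that by blast
  have "(\<lambda>x. c x b) \<in> mod_hom R F (regular_module R)" if b: "b \<in> B" for b
    unfolding mod_hom_def
  proof (intro CollectI conjI ballI Pi_I)
    fix x assume x: "x \<in> carrier F"
    show "c x b \<in> carrier (regular_module R)" using cR[OF x b] by simp
    fix y assume y: "y \<in> carrier F"
    have "x \<oplus>\<^bsub>F\<^esub> y = (\<Oplus>\<^bsub>F\<^esub>b\<in>B. c x b \<odot>\<^bsub>F\<^esub> b) \<oplus>\<^bsub>F\<^esub> (\<Oplus>\<^bsub>F\<^esub>b\<in>B. c y b \<odot>\<^bsub>F\<^esub> b)"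
      using c(2)[OF x] c(2)[OF y] by simp
    also have "\<dots> = (\<Oplus>\<^bsub>F\<^esub>b\<in>B. c x b \<odot>\<^bsub>F\<^esub> b \<oplus>\<^bsub>F\<^esub> c y b \<odot>\<^bsub>F\<^esub> b)"
      using cR x y BF by (intro F.M.finsum_addf[symmetric]) auto
    also have "\<dots> = (\<Oplus>\<^bsub>F\<^esub>b\<in>B. (c x b \<oplus>\<^bsub>R\<^esub> c y b) \<odot>\<^bsub>F\<^esub> b)"
      using cR x y BF by (intro F.M.finsum_cong') (auto simp: F.smult_l_distr)
    finally have e: "x \<oplus>\<^bsub>F\<^esub> y = (\<Oplus>\<^bsub>F\<^esub>b\<in>B. (c x b \<oplus>\<^bsub>R\<^esub> c y b) \<odot>\<^bsub>F\<^esub> b)" .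
    show "c (x \<oplus>\<^bsub>F\<^esub> y) b = c x b \<oplus>\<^bsub>regular_module R\<^esub> c y b"
      using uniq[OF F.M.add.m_closed[OF x y] _ e b] cR x y by simp
  next
    fix a x assume a: "a \<in> carrier R" and x: "x \<in> carrier F"
    have "a \<odot>\<^bsub>F\<^esub> x = a \<odot>\<^bsub>F\<^esub> (\<Oplus>\<^bsub>F\<^esub>b\<in>B. c x b \<odot>\<^bsub>F\<^esub> b)" using c(2)[OF x] by simp
    also have "\<dots> = (\<Oplus>\<^bsub>F\<^esub>b\<in>B. a \<odot>\<^bsub>F\<^esub> (c x b \<odot>\<^bsub>F\<^esub> b))"
      using cR[OF x] BF a B(1) by (intro F.finsum_smult_ldistr) auto
    also have "\<dots> = (\<Oplus>\<^bsub>F\<^esub>b\<in>B. (a \<otimes>\<^bsub>R\<^esub> c x b) \<odot>\<^bsub>F\<^esub> b)"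
      using cR[OF x] BF a by (intro F.M.finsum_cong') (auto simp: F.smult_assoc1)
    finally have e: "a \<odot>\<^bsub>F\<^esub> x = (\<Oplus>\<^bsub>F\<^esub>b\<in>B. (a \<otimes>\<^bsub>R\<^esub> c x b) \<odot>\<^bsub>F\<^esub> b)" .
    show "c (a \<odot>\<^bsub>F\<^esub> x) b = a \<odot>\<^bsub>regular_module R\<^esub> c x b"
      using uniq[OF F.smult_closed[OF a x] _ e b] cR[OF x] a by simp
  qed
  thus ?thesis using B c(2) by (intro exI[of _ B] exI[of _ "\<lambda>b x. c x b"]) auto
qed

lemma preimage_submodule:
  assumes "module R M" "module R N" "f \<in> mod_hom R M N" "submodule H R N"
  shows "submodule {x \<in> carrier M. f x \<in> H} R M"
proof -
  interpret M: module R M by fact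
  interpret N: module R N by fact
  note H = N.submoduleE[OF assms(4)] and f = mod_homD[OF assms(3)]
  show ?thesis
  proof (rule M.submoduleI)
    have "\<zero>\<^bsub>N\<^esub> \<in> H" using assms(4) by (auto simp: submodule_def subgroup_def)
    thus "\<zero>\<^bsub>M\<^esub> \<in> {x \<in> carrier M. f x \<in> H}" using mod_hom_zero[OF assms(1-3)] by simp
  qed (use H f mod_hom_minus[OF assms(1-3)] in auto)
qed

lemma mod_hom_comp:
  "f \<in> mod_hom R M N \<Longrightarrow> g \<in> mod_hom R N P \<Longrightarrow> (\<lambda>x. g (f x)) \<in> mod_hom R M P"
  by (auto simp: mod_hom_def Pi_def)

lemma ideal_smult_submodule:
  assumes "module R M" "K \<subseteq> carrier R"
  shows "submodule (ideal_smult R K M) R M"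
proof -
  interpret M: module R M by fact
  show ?thesis unfolding ideal_smult_def
    using assms(2) by (intro mod_span_submodule[OF assms(1)]) auto
qed

lemma ideal_smult_mem: "a \<in> K \<Longrightarrow> x \<in> carrier M \<Longrightarrow> a \<odot>\<^bsub>M\<^esub> x \<in> ideal_smult R K M"
  unfolding ideal_smult_def by (rule subsetD[OF mod_span_superset]) blast

lemma ideal_smult_mono:
  assumes "module R M" "L \<subseteq> carrier R" "K \<subseteq> L"
  shows "ideal_smult R K M \<subseteq> ideal_smult R L M"
  unfolding ideal_smult_def[of R K]
  using assms(3) by (intro mod_span_least ideal_smult_submodule[OF assms(1,2)]) (auto intro: ideal_smult_mem)

text \<open>Coordinates are linear functionals. This lemma converts membership in \<open>I M\<close> into membership of
  coordinates in an ideal, and records the gain when the functional already takes values in \<open>E\<close>.\<close>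

lemma functional_ideal_smult:
  assumes "module R M" "ideal I R" "ideal E R" "g \<in> mod_hom R M (regular_module R)"
    and gE: "\<And>x. x \<in> carrier M \<Longrightarrow> g x \<in> E" and y: "y \<in> ideal_smult R I M"
  shows "g y \<in> I \<cdot>\<^bsub>R\<^esub> E"
proof -
  interpret M: module R M by fact
  interpret I: ideal I R by fact
  have "ideal (I \<cdot>\<^bsub>R\<^esub> E) R" by (rule M.R.ideal_prod_is_ideal[OF assms(2,3)])
  hence "submodule (I \<cdot>\<^bsub>R\<^esub> E) R (regular_module R)"
    by (rule ideal_regular_submodule[OF M.R.is_cring])
  hence "submodule {x \<in> carrier M. g x \<in> I \<cdot>\<^bsub>R\<^esub> E} R M"
    by (rule preimage_submodule[OF assms(1) regular_module_module[OF M.R.is_cring] assms(4)])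
  moreover have "{a \<odot>\<^bsub>M\<^esub> x |a x. a \<in> I \<and> x \<in> carrier M} \<subseteq> {x \<in> carrier M. g x \<in> I \<cdot>\<^bsub>R\<^esub> E}"
  proof clarify
    fix a x assume a: "a \<in> I" and x: "x \<in> carrier M"
    have "a \<otimes>\<^bsub>R\<^esub> g x \<in> I \<cdot>\<^bsub>R\<^esub> E" using a gE[OF x] by (rule ideal_prod.prod)
    thus "a \<odot>\<^bsub>M\<^esub> x \<in> carrier M \<and> g (a \<odot>\<^bsub>M\<^esub> x) \<in> I \<cdot>\<^bsub>R\<^esub> E"
      using mod_homD(3)[OF assms(4) I.Icarr[OF a] x] I.Icarr[OF a] x by simp
  qed
  ultimately show ?thesis
    using y mod_span_least unfolding ideal_smult_def by blast
qed

lemma functional_ideal_smult':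
  assumes "module R M" "ideal I R" "g \<in> mod_hom R M (regular_module R)" "y \<in> ideal_smult R I M"
  shows "g y \<in> I"
proof -
  interpret M: module R M by fact
  have "g y \<in> I \<cdot>\<^bsub>R\<^esub> carrier R"
    using assms(3) M.R.oneideal mod_homD(1)[OF assms(3)]
    by (intro functional_ideal_smult[OF assms(1,2) _ assms(3) _ assms(4)]) auto
  thus ?thesis using M.R.ideal_prod_one[OF assms(2)] by simp
qed

lemma finsum_in_ideal_smult:
  assumes "module R M" "K \<subseteq> carrier R" "finite B" "B \<subseteq> carrier M" "\<And>b. b \<in> B \<Longrightarrow> c b \<in> K"
  shows "(\<Oplus>\<^bsub>M\<^esub>b\<in>B. c b \<odot>\<^bsub>M\<^esub> b) \<in> ideal_smult R K M"
proof -
  interpret M: module R M by fact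
  note S = ideal_smult_submodule[OF assms(1,2)]
  show ?thesis using assms(3-5)
  proof (induct rule: finite_induct)
    case empty
    show ?case using S by (simp add: submodule_def subgroup_def)
  next
    case (insert b B)
    have "(\<Oplus>\<^bsub>M\<^esub>b\<in>insert b B. c b \<odot>\<^bsub>M\<^esub> b) = c b \<odot>\<^bsub>M\<^esub> b \<oplus>\<^bsub>M\<^esub> (\<Oplus>\<^bsub>M\<^esub>b\<in>B. c b \<odot>\<^bsub>M\<^esub> b)"
      using insert assms(2) by (intro M.M.finsum_insert) (auto simp: subset_iff)
    thus ?case using insert ideal_smult_mem[of "c b" K b M R] M.submoduleE(5)[OF S] by simp
  qed
qed

section \<open>Annihilators\<close>

lemma annihilator_ideal:
  assumes "module R M"
  shows "ideal (annihilator R M) R"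
proof -
  interpret M: module R M by fact
  show ?thesis
  proof (rule idealI)
    show "subgroup (annihilator R M) (add_monoid R)"
      by (rule M.R.add.subgroupI) (auto simp: annihilator_def M.smult_l_distr M.smult_l_minus)
  qed (auto simp: annihilator_def M.smult_assoc1 M.R.ring_axioms)
qed

lemma annihilator_quot_mod:
  assumes "module R M" "submodule N R M"
  shows "a \<in> annihilator R (quot_mod M N) \<longleftrightarrow> a \<in> carrier R \<and> (\<forall>x\<in>carrier M. a \<odot>\<^bsub>M\<^esub> x \<in> N)"
proof -
  interpret M: module R M by fact
  interpret N: abelian_subgroup N M by (rule submodule_abelian_subgroup) fact+
  have "a \<odot>\<^bsub>quot_mod M N\<^esub> (N +>\<^bsub>M\<^esub> x) = N \<longleftrightarrow> a \<odot>\<^bsub>M\<^esub> x \<in> N" if "a \<in> carrier R" "x \<in> carrier M" for x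
  proof -
    have "a \<odot>\<^bsub>quot_mod M N\<^esub> (N +>\<^bsub>M\<^esub> x) = N +>\<^bsub>M\<^esub> (a \<odot>\<^bsub>M\<^esub> x)"
      using mod_homD(3)[OF quot_mod_module(2)[OF assms]] that by simp
    moreover have "N +>\<^bsub>M\<^esub> (a \<odot>\<^bsub>M\<^esub> x) = N \<longleftrightarrow> a \<odot>\<^bsub>M\<^esub> x \<in> N"
      using N.a_rcos_const N.a_rcos_self[of "a \<odot>\<^bsub>M\<^esub> x"] that by auto
    ultimately show ?thesis by simp
  qed
  thus ?thesis unfolding annihilator_def by (auto simp: A_RCOSETS_def' simp del: quot_mod_simps(4))
qed

lemma kernel_submodule:
  assumes "module R M" "module R N" "f \<in> mod_hom R M N"
  shows "submodule (a_kernel M N f) R M"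
proof -
  interpret N: module R N by fact
  have "submodule {\<zero>\<^bsub>N\<^esub>} R N" by (rule N.submoduleI) auto
  from preimage_submodule[OF assms this] show ?thesis by (simp add: a_kernel_def' )
qed

text \<open>The boundaries have to be a submodule of the module of cycles, whose record differs from the
  ambient module in its carrier only; negatives are therefore obtained as multiples by \<open>-1\<close>.\<close>

lemma image_submodule_of:
  assumes "module R L" "module R M" "f \<in> mod_hom R L M" "submodule Z R M" "f ` carrier L \<subseteq> Z"
  shows "submodule (f ` carrier L) R (M\<lparr>carrier := Z\<rparr>)"
proof -
  interpret L: module R L by fact
  interpret Z: module R "M\<lparr>carrier := Z\<rparr>" by (rule submodule.submodule_is_module) fact+
  note f = mod_homD[OF assms(3)]
  have sm: "a \<odot>\<^bsub>M\<^esub> y \<in> f ` carrier L" if "a \<in> carrier R" "y \<in> f ` carrier L" for a y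
    using that f(3)[of a] by (auto intro!: rev_image_eqI[of "a \<odot>\<^bsub>L\<^esub> _"])
  show ?thesis
  proof (rule Z.submoduleI)
    show "\<zero>\<^bsub>M\<lparr>carrier := Z\<rparr>\<^esub> \<in> f ` carrier L"
      using mod_hom_zero[OF assms(1-3)] by (auto intro!: rev_image_eqI[of "\<zero>\<^bsub>L\<^esub>"])
  next
    fix y assume y: "y \<in> f ` carrier L"
    hence "y \<in> carrier (M\<lparr>carrier := Z\<rparr>)" using assms(5) by auto
    hence "\<ominus>\<^bsub>M\<lparr>carrier := Z\<rparr>\<^esub> y = (\<ominus>\<^bsub>R\<^esub> \<one>\<^bsub>R\<^esub>) \<odot>\<^bsub>M\<lparr>carrier := Z\<rparr>\<^esub> y"
      using Z.smult_l_minus[of "\<one>\<^bsub>R\<^esub>" y] Z.smult_one[of y] by simp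
    thus "\<ominus>\<^bsub>M\<lparr>carrier := Z\<rparr>\<^esub> y \<in> f ` carrier L" using sm[OF _ y] by simp
  next
    fix a b assume "a \<in> f ` carrier L" "b \<in> f ` carrier L"
    thus "a \<oplus>\<^bsub>M\<lparr>carrier := Z\<rparr>\<^esub> b \<in> f ` carrier L"
      by (auto simp flip: f(2))
  qed (use sm assms(5) in auto)
qed

section \<open>Reduction modulo an ideal as a tensor product\<close>

text \<open>The map \<open>x \<mapsto> x \<otimes> 1\<close>. By \<open>quot_to_tensor_iso\<close> it is onto \<open>M \<otimes> R/I\<close> with kernel \<open>I M\<close>, so statements about the
  tensor product become congruences in \<open>M\<close> modulo \<open>I M\<close>.\<close>

definition reduce :: "('a, 'r) ring_scheme \<Rightarrow> 'a set \<Rightarrow> ('a, 'b, 'm) module_scheme \<Rightarrow> 'b \<Rightarrow> ('b \<times> 'a set \<Rightarrow> 'a) set" where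
  "reduce R I M x = pure_tensor R M (quot_ring_mod R I) x (I +>\<^bsub>R\<^esub> \<one>\<^bsub>R\<^esub>)"

context
  fixes R :: "('a, 'r) ring_scheme" and I :: "'a set"
  assumes R: "cring R" and I: "ideal I R"
begin

interpretation cring R by (rule R)

lemma quot_ring_module: "module R (quot_ring_mod R I)"
  by (rule quot_mod_module(1)[OF regular_module_module[OF R] ideal_regular_submodule[OF R I]])

lemma one_coset_closed: "I +>\<^bsub>R\<^esub> \<one>\<^bsub>R\<^esub> \<in> carrier (quot_ring_mod R I)"
  using mod_homD(1)[OF quot_mod_module(2)[OF regular_module_module[OF R] ideal_regular_submodule[OF R I]],
      of "\<one>\<^bsub>R\<^esub>"] by (simp add: regular_coset)

lemma tensor_quot_module: "module R M \<Longrightarrow> module R (tensor R M (quot_ring_mod R I))"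
  by (rule tensor_module[OF _ quot_ring_module])

lemma reduce_hom:
  assumes "module R M"
  shows "reduce R I M \<in> mod_hom R M (tensor R M (quot_ring_mod R I))"
proof -
  note p = pure_tensor_bilinear[OF assms quot_ring_module]
  show ?thesis
    unfolding mod_hom_def reduce_def
    by (intro CollectI conjI ballI Pi_I p(1) p(2) p(4) one_coset_closed)
qed

lemma I_submodule: "module R M \<Longrightarrow> submodule (ideal_smult R I M) R M"
  using ideal.Icarr[OF I] by (intro ideal_smult_submodule) auto

lemma coset_hom:
  "module R M \<Longrightarrow> (\<lambda>x. ideal_smult R I M +>\<^bsub>M\<^esub> x) \<in> mod_hom R M (quot_mod M (ideal_smult R I M))"
  by (intro quot_mod_module(2) I_submodule)

lemma quot_to_tensor_coset:
  "module R M \<Longrightarrow> x \<in> carrier M \<Longrightarrow> quot_to_tensor R M I (ideal_smult R I M +>\<^bsub>M\<^esub> x) = reduce R I M x"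
  unfolding reduce_def by (rule quot_to_tensor_iso(3)[OF _ I])

lemma reduce_surj:
  assumes M: "module R M" and u: "u \<in> carrier (tensor R M (quot_ring_mod R I))"
  shows "\<exists>x\<in>carrier M. u = reduce R I M x"
proof -
  obtain X where "X \<in> carrier (quot_mod M (ideal_smult R I M))" "u = quot_to_tensor R M I X"
    using quot_to_tensor_iso(2)[OF M I] u unfolding bij_betw_def by blast
  thus ?thesis using quot_to_tensor_coset[OF M] by (auto simp: A_RCOSETS_def')
qed

lemma reduce_eq_iff:
  assumes M: "module R M" and x: "x \<in> carrier M" and y: "y \<in> carrier M"
  shows "reduce R I M x = reduce R I M y \<longleftrightarrow> x \<ominus>\<^bsub>M\<^esub> y \<in> ideal_smult R I M"
proof -
  have "reduce R I M x = reduce R I M y \<longleftrightarrow> ideal_smult R I M +>\<^bsub>M\<^esub> x = ideal_smult R I M +>\<^bsub>M\<^esub> y"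
    using quot_to_tensor_iso(2)[OF M I] mod_homD(1)[OF coset_hom[OF M]] x y
    unfolding bij_betw_def quot_to_tensor_coset[OF M x, symmetric] quot_to_tensor_coset[OF M y, symmetric]
    by (metis inj_onD)
  thus ?thesis using coset_eq_iff[OF M I_submodule[OF M] x y] by simp
qed

lemma reduce_eq_zero_iff:
  assumes M: "module R M" and x: "x \<in> carrier M"
  shows "reduce R I M x = \<zero>\<^bsub>tensor R M (quot_ring_mod R I)\<^esub> \<longleftrightarrow> x \<in> ideal_smult R I M"
proof -
  interpret M: module R M by fact
  have "reduce R I M \<zero>\<^bsub>M\<^esub> = \<zero>\<^bsub>tensor R M (quot_ring_mod R I)\<^esub>"
    by (rule mod_hom_zero[OF M tensor_quot_module[OF M] reduce_hom[OF M]])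
  moreover have "\<ominus>\<^bsub>M\<^esub> \<zero>\<^bsub>M\<^esub> = \<zero>\<^bsub>M\<^esub>"
    using M.M.minus_equality[of "\<zero>\<^bsub>M\<^esub>" "\<zero>\<^bsub>M\<^esub>"] by simp
  hence "x \<ominus>\<^bsub>M\<^esub> \<zero>\<^bsub>M\<^esub> = x" using x unfolding a_minus_def by (simp only: M.r_zero)
  ultimately show ?thesis using reduce_eq_iff[OF M x M.zero_closed] by simp
qed

lemma tensor_map_props:
  assumes M: "module R M" and N: "module R N" and f: "f \<in> mod_hom R M N"
  defines "d \<equiv> tensor_map R M (quot_ring_mod R I) N (quot_ring_mod R I) f (\<lambda>y. y)"
  shows "d \<in> mod_hom R (tensor R M (quot_ring_mod R I)) (tensor R N (quot_ring_mod R I))"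
    and "x \<in> carrier M \<Longrightarrow> d (reduce R I M x) = reduce R I N (f x)"
proof -
  have id: "(\<lambda>y. y) \<in> mod_hom R (quot_ring_mod R I) (quot_ring_mod R I)"
    by (auto simp: mod_hom_def)
  note d = theI'[OF tensor_map_unique[OF M quot_ring_module N quot_ring_module f id],
      folded tensor_map_def, folded d_def]
  show "d \<in> mod_hom R (tensor R M (quot_ring_mod R I)) (tensor R N (quot_ring_mod R I))"
    using d by blast
  show "x \<in> carrier M \<Longrightarrow> d (reduce R I M x) = reduce R I N (f x)"
    using d one_coset_closed unfolding reduce_def by blast
qed

text \<open>Pulling cycles and boundaries of \<open>F \<otimes> R/I\<close> back to \<open>F\<close>: a class is a cycle if \<open>\<phi>\<^sub>t x \<in> I F\<^sub>t\<^sub>-\<^sub>1\<close>, and \<open>a\<close>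
  annihilates the homology if it moves all such \<open>x\<close> into \<open>\<phi>\<^sub>t\<^sub>+\<^sub>1 F\<^sub>t\<^sub>+\<^sub>1 + I F\<^sub>t\<close>.\<close>

lemma annihilator_tor:
  assumes F: "\<And>i. module R (F i)" and \<phi>: "\<And>i. i \<ge> 1 \<Longrightarrow> \<phi> i \<in> mod_hom R (F i) (F (i - 1))"
    and t: "t \<ge> 1" and comp: "\<And>h. h \<in> carrier (F (Suc t)) \<Longrightarrow> \<phi> t (\<phi> (Suc t) h) = \<zero>\<^bsub>F (t - 1)\<^esub>"
  shows "ideal (annihilator R (tor R F \<phi> (quot_ring_mod R I) t)) R"
    and "a \<in> annihilator R (tor R F \<phi> (quot_ring_mod R I) t) \<longleftrightarrow> a \<in> carrier R \<and>
      (\<forall>x\<in>carrier (F t). \<phi> t x \<in> ideal_smult R I (F (t - 1)) \<longrightarrow>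
         (\<exists>h\<in>carrier (F (Suc t)). a \<odot>\<^bsub>F t\<^esub> x \<ominus>\<^bsub>F t\<^esub> \<phi> (Suc t) h \<in> ideal_smult R I (F t)))"
proof -
  let ?Q = "quot_ring_mod R I"
  let ?T = "\<lambda>i. tensor R (F i) ?Q"
  let ?d = "\<lambda>i. tensor_map R (F i) ?Q (F (i - 1)) ?Q (\<phi> i) (\<lambda>y. y)"
  let ?Z = "a_kernel (?T t) (?T (t - 1)) (?d t)"
  let ?B = "?d (Suc t) ` carrier (?T (Suc t))"
  interpret Ft: module R "F t" by (rule F)
  interpret Fs: module R "F (t - 1)" by (rule F)
  have \<phi>t: "\<phi> t \<in> mod_hom R (F t) (F (t - 1))" by (rule \<phi>[OF t])
  have \<phi>s: "\<phi> (Suc t) \<in> mod_hom R (F (Suc t)) (F t)" using \<phi>[of "Suc t"] by simp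
  note T = tensor_quot_module[OF F]
  have dt: "?d t \<in> mod_hom R (?T t) (?T (t - 1))" by (rule tensor_map_props(1)[OF F F \<phi>t])
  have dtx: "?d t (reduce R I (F t) x) = reduce R I (F (t - 1)) (\<phi> t x)" if "x \<in> carrier (F t)" for x
    by (rule tensor_map_props(2)[OF F F \<phi>t that])
  have ds: "?d (Suc t) \<in> mod_hom R (?T (Suc t)) (?T t)"
    using tensor_map_props(1)[OF F F \<phi>s] by simp
  have dsx: "?d (Suc t) (reduce R I (F (Suc t)) h) = reduce R I (F t) (\<phi> (Suc t) h)"
    if "h \<in> carrier (F (Suc t))" for h
    using tensor_map_props(2)[OF F F \<phi>s that] by simp
  have Z: "submodule ?Z R (?T t)" by (rule kernel_submodule[OF T T dt])
  have Zx: "reduce R I (F t) x \<in> ?Z \<longleftrightarrow> \<phi> t x \<in> ideal_smult R I (F (t - 1))" if "x \<in> carrier (F t)" for x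
    using dtx[OF that] reduce_eq_zero_iff[OF F mod_homD(1)[OF \<phi>t that]]
      mod_homD(1)[OF reduce_hom[OF F] that] by (simp add: a_kernel_def')
  have Bx: "reduce R I (F t) x \<in> ?B \<longleftrightarrow>
      (\<exists>h\<in>carrier (F (Suc t)). x \<ominus>\<^bsub>F t\<^esub> \<phi> (Suc t) h \<in> ideal_smult R I (F t))"
    if x: "x \<in> carrier (F t)" for x
  proof -
    have "carrier (?T (Suc t)) = reduce R I (F (Suc t)) ` carrier (F (Suc t))"
      using reduce_surj[OF F] mod_homD(1)[OF reduce_hom[OF F]] by blast
    hence "reduce R I (F t) x \<in> ?B \<longleftrightarrow>
        (\<exists>h\<in>carrier (F (Suc t)). reduce R I (F t) x = reduce R I (F t) (\<phi> (Suc t) h))"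
      using dsx by (auto simp: image_iff)
    thus ?thesis using reduce_eq_iff[OF F x mod_homD(1)[OF \<phi>s]] by auto
  qed
  have "?B \<subseteq> ?Z"
  proof
    fix u assume "u \<in> ?B"
    then obtain h where h: "h \<in> carrier (F (Suc t))" "u = reduce R I (F t) (\<phi> (Suc t) h)"
      using reduce_surj[OF F, of _ "Suc t"] dsx by blast
    have "\<phi> t (\<phi> (Suc t) h) \<in> ideal_smult R I (F (t - 1))"
      using comp[OF h(1)] I_submodule[OF F, of "t - 1"] by (simp add: submodule_def subgroup_def)
    thus "u \<in> ?Z" unfolding h(2) using Zx[OF mod_homD(1)[OF \<phi>s h(1)]] by simp
  qed
  hence B: "submodule ?B R (?T t\<lparr>carrier := ?Z\<rparr>)" by (rule image_submodule_of[OF T T ds Z])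
  have Zm: "module R (?T t\<lparr>carrier := ?Z\<rparr>)" by (rule submodule.submodule_is_module[OF Z T])
  have tor: "tor R F \<phi> ?Q t = quot_mod (?T t\<lparr>carrier := ?Z\<rparr>) ?B"
    using t by (simp add: tor_def Let_def)
  show "ideal (annihilator R (tor R F \<phi> ?Q t)) R"
    unfolding tor by (rule annihilator_ideal[OF quot_mod_module(1)[OF Zm B]])
  have "a \<in> annihilator R (tor R F \<phi> ?Q t) \<longleftrightarrow>
      a \<in> carrier R \<and> (\<forall>z\<in>?Z. a \<odot>\<^bsub>?T t\<^esub> z \<in> ?B)"
    unfolding tor annihilator_quot_mod[OF Zm B] by simp
  also have "\<dots> \<longleftrightarrow> a \<in> carrier R \<and>
      (\<forall>x\<in>carrier (F t). reduce R I (F t) x \<in> ?Z \<longrightarrow> a \<odot>\<^bsub>?T t\<^esub> reduce R I (F t) x \<in> ?B)"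
    using reduce_surj[OF F, of _ t] by (auto simp: a_kernel_def' ) blast+
  also have "\<dots> \<longleftrightarrow> a \<in> carrier R \<and>
      (\<forall>x\<in>carrier (F t). reduce R I (F t) x \<in> ?Z \<longrightarrow> reduce R I (F t) (a \<odot>\<^bsub>F t\<^esub> x) \<in> ?B)"
    using mod_homD(3)[OF reduce_hom[OF F], of a _ t] by auto
  also have "\<dots> \<longleftrightarrow> a \<in> carrier R \<and>
      (\<forall>x\<in>carrier (F t). \<phi> t x \<in> ideal_smult R I (F (t - 1)) \<longrightarrow>
         (\<exists>h\<in>carrier (F (Suc t)). a \<odot>\<^bsub>F t\<^esub> x \<ominus>\<^bsub>F t\<^esub> \<phi> (Suc t) h \<in> ideal_smult R I (F t)))"
    using Zx Bx Ft.smult_closed by auto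
  finally show "a \<in> annihilator R (tor R F \<phi> ?Q t) \<longleftrightarrow> a \<in> carrier R \<and>
      (\<forall>x\<in>carrier (F t). \<phi> t x \<in> ideal_smult R I (F (t - 1)) \<longrightarrow>
         (\<exists>h\<in>carrier (F (Suc t)). a \<odot>\<^bsub>F t\<^esub> x \<ominus>\<^bsub>F t\<^esub> \<phi> (Suc t) h \<in> ideal_smult R I (F t)))" .
qed

end

section \<open>Socle elements in the image of the differential\<close>

theorem theorem3p1:
  fixes R :: "('a, 'r) ring_scheme"
    and M :: "('a, 'b, 'm) module_scheme"
    and F :: "nat \<Rightarrow> ('a, 'c, 'n) module_scheme"
    and \<phi> :: "nat \<Rightarrow> 'c \<Rightarrow> 'c"
    and \<epsilon> :: "'c \<Rightarrow> 'b"
    and \<mm> I J :: "'a set"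
    and t :: nat
  assumes "noetherian_ring R"
    and "local_ring R \<mm>"
    and "ideal I R"
    and "integral_closure R I = I"
    and "ideal_height R I > 0"
    and "fin_gen_module R M"
    and "minimal_free_resolution R \<mm> M F \<phi> \<epsilon>"
    and "t \<ge> 1"
    and "J = annihilator R (tor R F \<phi> (quot_ring_mod R I) t)"
    and "\<phi> t ` carrier (F t) \<subseteq>
           ideal_smult R (integral_closure R (\<mm> \<cdot>\<^bsub>R\<^esub> J)) (F (t - 1))"
  shows "tensor_map R (F t) (quot_ring_mod R I) (F (t - 1)) (quot_ring_mod R I) (\<phi> t) (\<lambda>y. y)
           ` carrier (tensor R (F t) (quot_ring_mod R I))
         \<inter> quot_to_tensor R (F (t - 1)) I
             ` socle \<mm> (quot_mod (F (t - 1)) (ideal_smult R I (F (t - 1))))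
         = {\<zero>\<^bsub>tensor R (F (t - 1)) (quot_ring_mod R I)\<^esub>}"
proof -
  \<comment> \<open>keeps \<open>t - 1\<close> from being rewritten to \<open>t - Suc 0\<close>\<close>
  note One_nat_def [simp del]
  have R: "cring R" and max: "{P. maximalideal P R} = {\<mm>}"
    using assms(2) by (simp_all add: local_ring_def)
  interpret cring R by (rule R)
  have I: "ideal I R" by (rule assms(3))
  have \<mm>: "maximalideal \<mm> R" using max by blast
  hence \<mm>': "ideal \<mm> R" by (rule maximalideal.axioms(1))
  have res: "free_resolution R M F \<phi> \<epsilon>" using assms(7) by (simp add: minimal_free_resolution_def)
  have free: "fin_free_module R (F i)" for i using res by (simp add: free_resolution_def)
  have F: "module R (F i)" for i using free[of i] by (simp add: fin_free_module_def)
  have \<phi>: "\<phi> i \<in> mod_hom R (F i) (F (i - 1))" if "i \<ge> 1" for i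
    using res that by (simp add: free_resolution_def)
  have exact: "\<phi> (Suc t) ` carrier (F (Suc t)) = a_kernel (F t) (F (t - 1)) (\<phi> t)"
    using res assms(8) by (simp add: free_resolution_def)
  have comp: "\<phi> t (\<phi> (Suc t) h) = \<zero>\<^bsub>F (t - 1)\<^esub>" if "h \<in> carrier (F (Suc t))" for h
  proof -
    have "\<phi> (Suc t) h \<in> a_kernel (F t) (F (t - 1)) (\<phi> t)" using exact that by blast
    thus ?thesis by (simp add: a_kernel_def')
  qed
  let ?G = "F (t - 1)" and ?N = "quot_ring_mod R I"
  let ?d = "tensor_map R (F t) ?N ?G ?N (\<phi> t) (\<lambda>y. y)"
  let ?IG = "ideal_smult R I ?G"
  interpret Ft: module R "F t" by (rule F)
  interpret G: module R ?G by (rule F)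
  have \<phi>t: "\<phi> t \<in> mod_hom R (F t) ?G" by (rule \<phi>[OF assms(8)])
  have \<phi>s: "\<phi> (Suc t) \<in> mod_hom R (F (Suc t)) (F t)" using \<phi>[of "Suc t"] by simp
  note d = tensor_map_props[OF R I F F \<phi>t]
  note tor = annihilator_tor[OF R I F \<phi> assms(8) comp, folded assms(9)]
  have J: "ideal J R" by (rule tor(1))
  have K: "ideal (\<mm> \<cdot>\<^bsub>R\<^esub> J) R" by (rule ideal_prod_is_ideal[OF \<mm>' J])
  define E where "E = Idl\<^bsub>R\<^esub> (integral_closure R (\<mm> \<cdot>\<^bsub>R\<^esub> J))"
  have cl: "integral_closure R (\<mm> \<cdot>\<^bsub>R\<^esub> J) \<subseteq> carrier R" by (auto simp: integral_closure_def)
  have E: "ideal E R" unfolding E_def by (rule genideal_ideal[OF cl])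
  have ImE: "\<phi> t x \<in> ideal_smult R E ?G" if "x \<in> carrier (F t)" for x
  proof -
    have "E \<subseteq> carrier R" using ideal.Icarr[OF E] by blast
    hence "ideal_smult R (integral_closure R (\<mm> \<cdot>\<^bsub>R\<^esub> J)) ?G \<subseteq> ideal_smult R E ?G"
      using genideal_self[OF cl] unfolding E_def by (intro ideal_smult_mono F)
    thus ?thesis using assms(10) that by blast
  qed
  \<comment> \<open>\<open>I\<close> annihilates \<open>R/I\<close>, hence the homology; the boundary needed is that of 0\<close>
  have IJ: "I \<subseteq> J"
  proof
    fix a assume a: "a \<in> I"
    have ac: "a \<in> carrier R" by (rule ideal.Icarr[OF I a])
    have z: "\<zero>\<^bsub>F (Suc t)\<^esub> \<in> carrier (F (Suc t))"
      using F[of "Suc t"] by (simp add: module_def abelian_group_def abelian_monoid.zero_closed)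
    have z': "\<phi> (Suc t) \<zero>\<^bsub>F (Suc t)\<^esub> = \<zero>\<^bsub>F t\<^esub>" by (rule mod_hom_zero[OF F F \<phi>s])
    have "a \<odot>\<^bsub>F t\<^esub> x \<ominus>\<^bsub>F t\<^esub> \<phi> (Suc t) \<zero>\<^bsub>F (Suc t)\<^esub> \<in> ideal_smult R I (F t)"
      if x: "x \<in> carrier (F t)" for x
    proof -
      have "\<ominus>\<^bsub>F t\<^esub> \<zero>\<^bsub>F t\<^esub> = \<zero>\<^bsub>F t\<^esub>"
        using Ft.M.minus_equality[of "\<zero>\<^bsub>F t\<^esub>" "\<zero>\<^bsub>F t\<^esub>"] by simp
      hence "a \<odot>\<^bsub>F t\<^esub> x \<ominus>\<^bsub>F t\<^esub> \<phi> (Suc t) \<zero>\<^bsub>F (Suc t)\<^esub> = a \<odot>\<^bsub>F t\<^esub> x"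
        unfolding z' a_minus_def using Ft.smult_closed[OF ac x] by (simp only: Ft.M.r_zero)
      thus ?thesis using ideal_smult_mem[OF a x] by simp
    qed
    thus "a \<in> J" by (intro iffD2[OF tor(2)] conjI ballI impI bexI[OF _ z] ac)
  qed
  \<comment> \<open>the theorem in terms of representatives\<close>
  have key: "\<phi> t x \<in> ?IG"
    if x: "x \<in> carrier (F t)" and soc: "\<And>a. a \<in> \<mm> \<Longrightarrow> a \<odot>\<^bsub>?G\<^esub> \<phi> t x \<in> ?IG" for x
  proof (cases "I = carrier R")
    case True
    have "\<one>\<^bsub>R\<^esub> \<odot>\<^bsub>?G\<^esub> \<phi> t x \<in> ?IG"
      using True mod_homD(1)[OF \<phi>t x] by (intro ideal_smult_mem) auto
    thus ?thesis using mod_homD(1)[OF \<phi>t x] by simp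
  next
    case False
    then obtain P where P: "maximalideal P R" "I \<subseteq> P"
      using maximal_ideal_above[OF assms(1) I] by blast
    hence I\<mm>: "I \<subseteq> \<mm>" using max by blast
    obtain B \<pi> where B: "finite B" "B \<subseteq> carrier ?G"
      and \<pi>: "\<And>b. b \<in> B \<Longrightarrow> \<pi> b \<in> mod_hom R ?G (regular_module R)"
      and expand: "\<And>y. y \<in> carrier ?G \<Longrightarrow> y = (\<Oplus>\<^bsub>?G\<^esub>b\<in>B. \<pi> b y \<odot>\<^bsub>?G\<^esub> b)"
      using fin_free_coordinates[OF free[of "t - 1"]] by blast
    have "\<pi> b (\<phi> t x) \<in> I" if b: "b \<in> B" for b
    proof -
      define g where "g x = \<pi> b (\<phi> t x)" for x
      have g: "g \<in> mod_hom R (F t) (regular_module R)"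
        unfolding g_def by (rule mod_hom_comp[OF \<phi>t \<pi>[OF b]])
      have gE: "g y \<in> E" if "y \<in> carrier (F t)" for y
        unfolding g_def by (rule functional_ideal_smult'[OF F E \<pi>[OF b] ImE[OF that]])
      have gx: "g x \<in> carrier R" using mod_homD(1)[OF g x] by simp
      have IE: "ideal (I \<cdot>\<^bsub>R\<^esub> E) R" by (rule ideal_prod_is_ideal[OF I E])
      \<comment> \<open>\<open>a x\<close> is a cycle, so \<open>c a x\<close> is congruent to a boundary modulo \<open>I F\<^sub>t\<close>; apply \<open>g\<close>\<close>
      have prod: "(a \<otimes>\<^bsub>R\<^esub> c) \<otimes>\<^bsub>R\<^esub> g x \<in> I \<cdot>\<^bsub>R\<^esub> E" if a: "a \<in> \<mm>" and c: "c \<in> J" for a c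
      proof -
        have ac: "a \<in> carrier R" and cc: "c \<in> carrier R"
          using ideal.Icarr[OF \<mm>' a] ideal.Icarr[OF J c] by auto
        have ax: "a \<odot>\<^bsub>F t\<^esub> x \<in> carrier (F t)" using ac x by simp
        have "\<phi> t (a \<odot>\<^bsub>F t\<^esub> x) \<in> ?IG" using soc[OF a] mod_homD(3)[OF \<phi>t ac x] by simp
        then obtain h where h: "h \<in> carrier (F (Suc t))"
          "c \<odot>\<^bsub>F t\<^esub> (a \<odot>\<^bsub>F t\<^esub> x) \<ominus>\<^bsub>F t\<^esub> \<phi> (Suc t) h \<in> ideal_smult R I (F t)"
          using iffD1[OF tor(2) c] ax by blast
        have hc: "\<phi> (Suc t) h \<in> carrier (F t)" by (rule mod_homD(1)[OF \<phi>s h(1)])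
        have g0: "g (\<phi> (Suc t) h) = \<zero>\<^bsub>R\<^esub>"
          using mod_hom_zero[OF F regular_module_module[OF R] \<pi>[OF b]] comp[OF h(1)]
          unfolding g_def by simp
        have gm: "g (\<ominus>\<^bsub>F t\<^esub> \<phi> (Suc t) h) = \<zero>\<^bsub>R\<^esub>"
        proof -
          have "\<ominus>\<^bsub>F t\<^esub> \<phi> (Suc t) h = (\<ominus>\<^bsub>R\<^esub> \<one>\<^bsub>R\<^esub>) \<odot>\<^bsub>F t\<^esub> \<phi> (Suc t) h"
            using Ft.smult_l_minus[OF one_closed hc] hc by simp
          thus ?thesis using mod_homD(3)[OF g _ hc, of "\<ominus>\<^bsub>R\<^esub> \<one>\<^bsub>R\<^esub>"] g0 by simp
        qed
        have "g (c \<odot>\<^bsub>F t\<^esub> (a \<odot>\<^bsub>F t\<^esub> x) \<ominus>\<^bsub>F t\<^esub> \<phi> (Suc t) h) = c \<otimes>\<^bsub>R\<^esub> (a \<otimes>\<^bsub>R\<^esub> g x)"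
          using mod_homD(2)[OF g Ft.smult_closed[OF cc ax] Ft.M.a_inv_closed[OF hc]]
            mod_homD(3)[OF g cc ax] mod_homD(3)[OF g ac x] gm ac cc gx by (simp add: a_minus_def)
        moreover have "g (c \<odot>\<^bsub>F t\<^esub> (a \<odot>\<^bsub>F t\<^esub> x) \<ominus>\<^bsub>F t\<^esub> \<phi> (Suc t) h) \<in> I \<cdot>\<^bsub>R\<^esub> E"
          by (rule functional_ideal_smult[OF F I E g gE h(2)])
        ultimately show ?thesis using ac cc gx by (simp add: m_ac)
      qed
      have "\<mm> \<cdot>\<^bsub>R\<^esub> J \<subseteq> {k \<in> carrier R. g x \<otimes>\<^bsub>R\<^esub> k \<in> I \<cdot>\<^bsub>R\<^esub> E}"
      proof (rule ideal_prod_least[OF ideal.helper_max_prime[OF IE R gx]])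
        fix a c assume "a \<in> \<mm>" "c \<in> J"
        moreover from this have "a \<in> carrier R" "c \<in> carrier R"
          using ideal.Icarr[OF \<mm>'] ideal.Icarr[OF J] by auto
        ultimately show "a \<otimes>\<^bsub>R\<^esub> c \<in> {k \<in> carrier R. g x \<otimes>\<^bsub>R\<^esub> k \<in> I \<cdot>\<^bsub>R\<^esub> E}"
          using prod[of a c] m_comm[OF gx, of "a \<otimes>\<^bsub>R\<^esub> c"] by simp
      qed
      hence kg: "k \<otimes>\<^bsub>R\<^esub> g x \<in> I \<cdot>\<^bsub>R\<^esub> E" if "k \<in> \<mm> \<cdot>\<^bsub>R\<^esub> J" for k
        using that m_comm[OF gx ideal.Icarr[OF K that]] by auto
      have rad: "I \<subseteq> Q" if "primeideal Q R" "\<mm> \<cdot>\<^bsub>R\<^esub> J \<subseteq> Q" for Q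
        using prime_contains_prod[OF that(1) \<mm>' J that(2)] I\<mm> IJ by blast
      have "g x \<in> integral_closure R I"
        by (rule integral_closure_cancel[OF assms(1) I K assms(5) rad gx kg[unfolded E_def]])
      thus ?thesis using assms(4) unfolding g_def by simp
    qed
    moreover have "I \<subseteq> carrier R" using ideal.Icarr[OF I] by blast
    ultimately have "(\<Oplus>\<^bsub>?G\<^esub>b\<in>B. \<pi> b (\<phi> t x) \<odot>\<^bsub>?G\<^esub> b) \<in> ?IG"
      by (intro finsum_in_ideal_smult F B)
    thus ?thesis using expand[OF mod_homD(1)[OF \<phi>t x]] by simp
  qed
  let ?T = "tensor R (F t) ?N" and ?TG = "tensor R ?G ?N" and ?Q = "quot_mod ?G ?IG"
  let ?\<theta> = "quot_to_tensor R ?G I"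
  note q = mod_homD[OF coset_hom[OF R I F[of "t - 1"]]]
  interpret N: abelian_subgroup ?IG ?G
    by (rule submodule_abelian_subgroup[OF F I_submodule[OF R I F]])
  show ?thesis
  proof (intro equalityI subsetI)
    fix u assume u: "u \<in> ?d ` carrier ?T \<inter> ?\<theta> ` socle \<mm> ?Q"
    then obtain w X where w: "w \<in> carrier ?T" "u = ?d w" and X: "X \<in> socle \<mm> ?Q" "u = ?\<theta> X"
      by blast
    obtain x where x: "x \<in> carrier (F t)" "w = reduce R I (F t) x"
      using reduce_surj[OF R I F w(1)] by blast
    have \<phi>x: "\<phi> t x \<in> carrier ?G" by (rule mod_homD(1)[OF \<phi>t x(1)])
    have u': "u = reduce R I ?G (\<phi> t x)" using w(2) x d(2) by simp
    have "?\<theta> X = ?\<theta> (?IG +>\<^bsub>?G\<^esub> \<phi> t x)"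
      using X(2) u' quot_to_tensor_coset[OF R I F \<phi>x] by simp
    moreover have "X \<in> carrier ?Q" using X(1) unfolding socle_def by blast
    ultimately have Xx: "X = ?IG +>\<^bsub>?G\<^esub> \<phi> t x"
      using quot_to_tensor_iso(2)[OF F I, of "t - 1"] q(1)[OF \<phi>x] unfolding bij_betw_def
      by (metis inj_onD)
    have "a \<odot>\<^bsub>?G\<^esub> \<phi> t x \<in> ?IG" if a: "a \<in> \<mm>" for a
    proof -
      have ac: "a \<in> carrier R" by (rule ideal.Icarr[OF \<mm>' a])
      have "a \<odot>\<^bsub>?Q\<^esub> X = \<zero>\<^bsub>?Q\<^esub>" using X(1) a unfolding socle_def by blast
      hence "?IG +>\<^bsub>?G\<^esub> (a \<odot>\<^bsub>?G\<^esub> \<phi> t x) = ?IG"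
        unfolding Xx q(3)[OF ac \<phi>x] by simp
      thus ?thesis using N.a_rcos_self[OF G.smult_closed[OF ac \<phi>x]] by simp
    qed
    hence "\<phi> t x \<in> ?IG" by (rule key[OF x(1)])
    thus "u \<in> {\<zero>\<^bsub>?TG\<^esub>}" unfolding u' using reduce_eq_zero_iff[OF R I F \<phi>x] by simp
  next
    fix u assume "u \<in> {\<zero>\<^bsub>?TG\<^esub>}"
    hence u: "u = \<zero>\<^bsub>?TG\<^esub>" by simp
    note T = tensor_quot_module[OF R I F]
    interpret T: module R ?T by (rule T)
    interpret Q: module R ?Q by (rule quot_mod_module(1)[OF F I_submodule[OF R I F]])
    have "?d \<zero>\<^bsub>?T\<^esub> = u" unfolding u by (rule mod_hom_zero[OF T T d(1)])
    hence "u \<in> ?d ` carrier ?T" by (intro image_eqI[of _ _ "\<zero>\<^bsub>?T\<^esub>"]) simp_all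
    moreover have "\<zero>\<^bsub>?Q\<^esub> \<in> socle \<mm> ?Q"
      unfolding socle_def using Q.M.zero_closed Q.smult_r_null ideal.Icarr[OF \<mm>'] by blast
    moreover have "?\<theta> \<zero>\<^bsub>?Q\<^esub> = u"
      unfolding u by (rule mod_hom_zero[OF Q.module_axioms T quot_to_tensor_iso(1)[OF F I]])
    ultimately show "u \<in> ?d ` carrier ?T \<inter> ?\<theta> ` socle \<mm> ?Q" by blast
  qed
qed

end
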